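(* Let $\sigma\in T^c$. For any $\mathbf{s}\in\mathcal{B}^T(V)$, the metric $\omega_{\phi(\mathbf{s})}$ is $\sigma$-balanced if and only if $\mu^\sigma(\mathbf{s})=0$.
   Context: $(X,L)$ is a polarized compact Kähler manifold of dimension $n$; $k$ is a fixed sufficiently large integer, $V=V_k=H^0(X,L^{\otimes k})$, $N=\dim V$. $T$ is a maximal torus of $\mathrm{Aut}_0(X,L)$ (identity component of the group of automorphisms of $X$ lifting to $L$, modulo dilations) with complexification $T^c$; after replacing $L$ by a power there is a representation $\rho_k:\mathrm{Aut}_0(X,L)\to \mathrm{SL}(V)$, and $T^c$ is identified with its image, so that $\sigma\in T^c$ acts both on $V$ and on $X$. Let $V=\bigoplus_\chi V(\chi)$ be the weight decomposition under $T^c$, $N^\chi=\dim V(\chi)$, and let $\mathcal{B}^T(V)$ be the set of bases $\mathbf{s}=(s^\chi_i)_{\chi;\,1\le i\le N^\chi}$ of $V$ with $s_i^\chi\in V(\chi)$ for all $\chi,i$. Let $G=S(\prod_\chi U(N^\chi))$. Fix a $T$-invariant Hermitian metric $h_0$ on $L$ with positive curvature. For $\mathbf{s}=\{s_j\}\in\mathcal{B}^T(V)$ let $\phi(\mathbf{s})=\phi_{\mathbf{s}}$ be the Fubini–Study potential of the Hermitian form for which $\mathbf{s}$ is orthonormal, so that $\omega_{\phi_{\mathbf{s}}}=i\partial\bar\partial\log\sum_j|s_j|^2\in 2\pi c_1(L^{\otimes k})$ is the pullback of the Fubini–Study form by the embedding $X\to\mathbb{CP}^{N-1}$ defined by $\mathbf{s}$,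 and the associated metric on $L^{\otimes k}$ is (up to a constant) $h_0^k/\sum_j|s_j|^2_{h_0^k}$. Let $\mathrm{Hilb}(\phi)$ be the $L^2$ Hermitian form on $V$ defined by the metric on $L^{\otimes k}$ associated with $\phi$ and the volume form $d\mu_\phi$ of $\omega_\phi$, and for a Hermitian form $H$ on $V$ with orthonormal basis $\{s_\alpha\}$ let $\omega_{\mathrm{FS}(H)}=i\partial\bar\partial\log\sum_\alpha|s_\alpha|^2$. The metric $\omega_\phi$ is called $\sigma$-balanced if $\omega_{\mathrm{FS}\circ\mathrm{Hilb}(\phi)}=\sigma^*\omega_\phi$. The action of $\sigma$ on sections is such that $\omega_{\phi(\sigma\cdot\mathbf{s})}=\sigma^*\omega_{\phi(\mathbf{s})}$. The map $\mu^\sigma:\mathcal{B}^T(V)\to\mathrm{Lie}(G)$ is $\mu^\sigma(\mathbf{s})=\big(i\,\mathrm{Hilb}(\phi_{\mathbf{s}})_0(\sigma\cdot s_j,\sigma\cdot s_k)\big)_{jk}$, where the subscript $0$ means the trace-free part of the matrix; that is, up to a positive constant, $\mu^\sigma(\mathbf{s})$ is $i$ times the trace-free part of the matrix $\big(\int_X (\sigma\cdot s_j,\sigma\cdot s_k)_{h_0}/\sum_l|s_l|^2_{h_0}\,d\mu_{\phi_{\mathbf{s}}}\big)_{jk}$. *)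

theory Defs
  imports "HOL-Analysis.Analysis" "HOL-Complex_Analysis.Complex_Analysis"
    "HOL-Library.Function_Algebras"
begin

section \<open>Calculus on complex coordinate space\<close>

definition holo_map_on :: "(complex^'n) set \<Rightarrow> (complex^'n \<Rightarrow> complex^'m) \<Rightarrow> bool" where
  "holo_map_on S f \<longleftrightarrow>
     (\<forall>z\<in>S. \<exists>D. (f has_derivative D) (at z) \<and> (\<forall>c v. D (c *s v) = c *s D v))"

definition holo_fun_on :: "(complex^'n) set \<Rightarrow> (complex^'n \<Rightarrow> complex) \<Rightarrow> bool" where
  "holo_fun_on S f \<longleftrightarrow>
     (\<forall>z\<in>S. \<exists>D. (f has_derivative D) (at z) \<and> (\<forall>c v. D (c *s v) = c * D v))"

fun Ck_on :: "nat \<Rightarrow> 'a::euclidean_space set \<Rightarrow> ('a \<Rightarrow> real) \<Rightarrow> bool" where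
  "Ck_on 0 S f \<longleftrightarrow> continuous_on S f"
| "Ck_on (Suc m) S f \<longleftrightarrow>
     (\<forall>x\<in>S. f differentiable (at x)) \<and> (\<forall>v. Ck_on m S (\<lambda>x. frechet_derivative f (at x) v))"

definition smooth_on :: "'a::euclidean_space set \<Rightarrow> ('a \<Rightarrow> real) \<Rightarrow> bool" where
  "smooth_on S f \<longleftrightarrow> (\<forall>m. Ck_on m S f)"

text \<open>Wirtinger operators: half of the derivative in direction x minus (respectively plus)
  the imaginary unit times the derivative in direction y.\<close>

definition d_z :: "'n::finite \<Rightarrow> (complex^'n \<Rightarrow> complex) \<Rightarrow> complex^'n \<Rightarrow> complex" where
  "d_z j f z = (frechet_derivative f (at z) (axis j 1) - \<i> * frechet_derivative f (at z) (axis j \<i>)) / 2"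

definition d_zbar :: "'n::finite \<Rightarrow> (complex^'n \<Rightarrow> complex) \<Rightarrow> complex^'n \<Rightarrow> complex" where
  "d_zbar j f z = (frechet_derivative f (at z) (axis j 1) + \<i> * frechet_derivative f (at z) (axis j \<i>)) / 2"

section \<open>Complex manifolds and holomorphic line bundles\<close>

text \<open>The points of the manifold are all points of the type \<open>'x\<close>, those of the total space of the
  line bundle all points of the type \<open>'l\<close>. A chart \<open>(U, f)\<close> and a local trivialization
  \<open>(U, t)\<close> are maps whose values matter only on \<open>U\<close> and over \<open>U\<close>, respectively. The vector space
  structure on a fibre is the one transported from \<open>\<complex>\<close> by any trivialization.\<close>

record ('x, 'l, 'n) polarized =
  atlas :: "('x set \<times> ('x \<Rightarrow> complex^'n)) set"
  proj :: "'l \<Rightarrow> 'x"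
  trivs :: "('x set \<times> ('l \<Rightarrow> complex)) set"

abbreviation chart_inv :: "'x set \<times> ('x \<Rightarrow> complex^'n) \<Rightarrow> complex^'n \<Rightarrow> 'x" where
  "chart_inv c \<equiv> inv_into (fst c) (snd c)"

definition compact_complex_manifold :: "('x::t2_space, 'l, 'n::finite) polarized \<Rightarrow> bool" where
  "compact_complex_manifold M \<longleftrightarrow>
     compact (UNIV :: 'x set) \<and> connected (UNIV :: 'x set) \<and>
     (\<Union>c\<in>atlas M. fst c) = UNIV \<and>
     (\<forall>c\<in>atlas M. open (fst c) \<and> open (snd c ` fst c) \<and>
        homeomorphism (fst c) (snd c ` fst c) (snd c) (chart_inv c)) \<and>
     (\<forall>c\<in>atlas M. \<forall>d\<in>atlas M. holo_map_on (snd c ` (fst c \<inter> fst d)) (snd d \<circ> chart_inv c))"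

definition holo_fun :: "('x, 'l, 'n::finite) polarized \<Rightarrow> 'x set \<Rightarrow> ('x \<Rightarrow> complex) \<Rightarrow> bool" where
  "holo_fun M U g \<longleftrightarrow> (\<forall>c\<in>atlas M. holo_fun_on (snd c ` (U \<inter> fst c)) (g \<circ> chart_inv c))"

definition smooth_fun :: "('x, 'l, 'n::finite) polarized \<Rightarrow> 'x set \<Rightarrow> ('x \<Rightarrow> real) \<Rightarrow> bool" where
  "smooth_fun M U g \<longleftrightarrow> (\<forall>c\<in>atlas M. smooth_on (snd c ` (U \<inter> fst c)) (g \<circ> chart_inv c))"

definition holo_line_bundle :: "('x::t2_space, 'l, 'n::finite) polarized \<Rightarrow> bool" where
  "holo_line_bundle M \<longleftrightarrow>
     (\<Union>t\<in>trivs M. fst t) = UNIV \<and>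
     (\<forall>t\<in>trivs M. open (fst t) \<and> (\<forall>x\<in>fst t. bij_betw (snd t) (proj M -` {x}) UNIV)) \<and>
     (\<forall>t\<in>trivs M. \<forall>u\<in>trivs M. \<exists>g. holo_fun M (fst t \<inter> fst u) g \<and>
        (\<forall>v. proj M v \<in> fst t \<inter> fst u \<longrightarrow> g (proj M v) \<noteq> 0 \<and> snd u v = g (proj M v) * snd t v))"

definition nonzero :: "('x, 'l, 'n::finite) polarized \<Rightarrow> 'l \<Rightarrow> bool" where
  "nonzero M v \<longleftrightarrow> (\<exists>t\<in>trivs M. proj M v \<in> fst t \<and> snd t v \<noteq> 0)"

definition frame :: "('x, 'l, 'n::finite) polarized \<Rightarrow> 'x set \<times> ('l \<Rightarrow> complex) \<Rightarrow> 'x \<Rightarrow> 'l" where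
  "frame M t x = (THE v. proj M v = x \<and> snd t v = 1)"

definition triv_at :: "('x, 'l, 'n::finite) polarized \<Rightarrow> 'x \<Rightarrow> 'x set \<times> ('l \<Rightarrow> complex)" where
  "triv_at M x = (SOME t. t \<in> trivs M \<and> x \<in> fst t)"

definition chart_at :: "('x, 'l, 'n::finite) polarized \<Rightarrow> 'x \<Rightarrow> 'x set \<times> ('x \<Rightarrow> complex^'n)" where
  "chart_at M x = (SOME c. c \<in> atlas M \<and> x \<in> fst c)"

section \<open>Sections of the k-th tensor power\<close>

text \<open>A section \<open>a\<close> of the \<open>k\<close>-th tensor power of \<open>L\<close> is encoded by the function \<open>s\<close> on the nonzero
  vectors of \<open>L\<close> with \<open>a (proj v) = s v \<cdot> v\<^sup>\<otimes>\<^sup>k\<close>, extended by \<open>0\<close> to the zero vectors; thus \<open>s\<close> is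
  homogeneous of degree \<open>-k\<close> on fibres. With respect to the frame \<open>e\<close> on which the trivialization
  \<open>t\<close> equals \<open>1\<close> we have \<open>v = t v \<cdot> e\<close>, so that \<open>a = g \<cdot> e\<^sup>\<otimes>\<^sup>k\<close> means \<open>s v = g (proj v) / (t v)^k\<close>.\<close>

definition H0 :: "('x, 'l, 'n::finite) polarized \<Rightarrow> nat \<Rightarrow> ('l \<Rightarrow> complex) set" where
  "H0 M k = {s. (\<forall>v. \<not> nonzero M v \<longrightarrow> s v = 0) \<and>
     (\<forall>t\<in>trivs M. \<exists>g. holo_fun M (fst t) g \<and>
        (\<forall>v. proj M v \<in> fst t \<and> snd t v \<noteq> 0 \<longrightarrow> s v = g (proj M v) / snd t v ^ k))}"

global_interpretation sec: vector_space "\<lambda>(c::complex) (s::'l \<Rightarrow> complex) v. c * s v"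
  by unfold_locales (auto simp: fun_eq_iff algebra_simps)

definition is_basis :: "('l \<Rightarrow> complex) set \<Rightarrow> ('l \<Rightarrow> complex) set \<Rightarrow> bool" where
  "is_basis V B \<longleftrightarrow> finite B \<and> sec.independent B \<and> sec.span B = V"

text \<open>The map from X to projective space with homogeneous coordinates \<open>B\<close> is well defined, injective
  and immersive (a tangent vector is killed by the differential of the induced map to projective
  space iff the derivative of a local lift is a multiple of that lift). As X is compact this says
  that it is an embedding.\<close>

definition projective_embedding :: "('x, 'l, 'n::finite) polarized \<Rightarrow> ('l \<Rightarrow> complex) set \<Rightarrow> bool" where
  "projective_embedding M B \<longleftrightarrow>
     (\<forall>v. nonzero M v \<longrightarrow> (\<exists>s\<in>B. s v \<noteq> 0)) \<and>
     (\<forall>v w. nonzero M v \<and> nonzero M w \<and> (\<exists>c. \<forall>s\<in>B. s v = c * s w) \<longrightarrow> proj M v = proj M w) \<and>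
     (\<forall>c\<in>atlas M. \<forall>t\<in>trivs M. \<forall>x\<in>fst c \<inter> fst t. \<forall>\<xi>.
        (\<exists>a. \<forall>s\<in>B. frechet_derivative (\<lambda>z. s (frame M t (chart_inv c z))) (at (snd c x)) \<xi>
                    = a * s (frame M t x)) \<longrightarrow> \<xi> = 0)"

definition very_ample :: "('x, 'l, 'n::finite) polarized \<Rightarrow> nat \<Rightarrow> bool" where
  "very_ample M k \<longleftrightarrow> (\<exists>B. is_basis (H0 M k) B \<and> projective_embedding M B)"

section \<open>Automorphisms\<close>

definition holo_self_map :: "('x::t2_space, 'l, 'n::finite) polarized \<Rightarrow> ('x \<Rightarrow> 'x) \<Rightarrow> bool" where
  "holo_self_map M f \<longleftrightarrow> continuous_on UNIV f \<and>
     (\<forall>c\<in>atlas M. \<forall>d\<in>atlas M.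
        holo_map_on (snd c ` (fst c \<inter> f -` fst d)) (snd d \<circ> f \<circ> chart_inv c))"

text \<open>\<open>F\<close> is a holomorphic, fibrewise linear bijection of the total space of \<open>L\<close> covering \<open>f\<close>.\<close>

definition lifts :: "('x, 'l, 'n::finite) polarized \<Rightarrow> ('l \<Rightarrow> 'l) \<Rightarrow> ('x \<Rightarrow> 'x) \<Rightarrow> bool" where
  "lifts M F f \<longleftrightarrow> bij F \<and> (\<forall>v. proj M (F v) = f (proj M v)) \<and>
     (\<forall>t\<in>trivs M. \<forall>u\<in>trivs M. \<exists>g. holo_fun M (fst t \<inter> f -` fst u) g \<and>
        (\<forall>v. proj M v \<in> fst t \<inter> f -` fst u \<longrightarrow> snd u (F v) = g (proj M v) * snd t v))"

text \<open>Two lifts of the same automorphism of the compact connected X differ by a dilation, so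
  passing to automorphisms of the pair modulo dilations amounts to keeping only the underlying
  automorphism of X.\<close>

definition AutXL :: "('x::t2_space, 'l, 'n::finite) polarized \<Rightarrow> ('x \<Rightarrow> 'x) set" where
  "AutXL M = {f. bij f \<and> holo_self_map M f \<and> holo_self_map M (inv f) \<and> (\<exists>F. lifts M F f)}"

definition compact_open :: "('x::t2_space \<Rightarrow> 'x) topology" where
  "compact_open = topology_generated_by {{f. f ` K \<subseteq> U} | K U. compact K \<and> open U}"

definition Aut0 :: "('x::t2_space, 'l, 'n::finite) polarized \<Rightarrow> ('x \<Rightarrow> 'x) set" where
  "Aut0 M = connected_component_of_set (subtopology compact_open (AutXL M)) id"

text \<open>\<open>torus_in G T\<close>: \<open>T\<close> is the image of an injective continuous homomorphism from a power of the
  circle group to \<open>G\<close>. The rank may be \<open>0\<close>.\<close>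

definition circle_pow :: "nat \<Rightarrow> (nat \<Rightarrow> complex) set" where
  "circle_pow r = (\<Pi>\<^sub>E i\<in>{..<r}. sphere 0 1)"

definition cstar_pow :: "nat \<Rightarrow> (nat \<Rightarrow> complex) set" where
  "cstar_pow r = (\<Pi>\<^sub>E i\<in>{..<r}. - {0})"

definition cmult :: "nat \<Rightarrow> (nat \<Rightarrow> complex) \<Rightarrow> (nat \<Rightarrow> complex) \<Rightarrow> nat \<Rightarrow> complex" where
  "cmult r a b = (\<lambda>i\<in>{..<r}. a i * b i)"

definition torus_in :: "('x::t2_space \<Rightarrow> 'x) set \<Rightarrow> ('x \<Rightarrow> 'x) set \<Rightarrow> bool" where
  "torus_in G T \<longleftrightarrow> T \<subseteq> G \<and> (\<exists>r \<theta>.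
     continuous_map (product_topology (\<lambda>_. top_of_set (sphere 0 1)) {..<r}) compact_open \<theta> \<and>
     (\<forall>a\<in>circle_pow r. \<forall>b\<in>circle_pow r. \<theta> (cmult r a b) = \<theta> a \<circ> \<theta> b) \<and>
     inj_on \<theta> (circle_pow r) \<and> \<theta> ` circle_pow r = T)"

definition maximal_torus :: "('x::t2_space \<Rightarrow> 'x) set \<Rightarrow> ('x \<Rightarrow> 'x) set \<Rightarrow> bool" where
  "maximal_torus G T \<longleftrightarrow> torus_in G T \<and> (\<forall>T'. torus_in G T' \<and> T \<subseteq> T' \<longrightarrow> T' = T)"

text \<open>\<open>Tc\<close> is the image of an injective holomorphic homomorphism from a power of the multiplicative
  group of \<open>\<complex>\<close> whose restriction to the compact torus has image \<open>T\<close>. Holomorphic means that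
  \<open>\<theta>\<close> is continuous and the orbit maps are holomorphic in each variable.\<close>

definition complexification :: "('x::t2_space, 'l, 'n::finite) polarized \<Rightarrow> ('x \<Rightarrow> 'x) set \<Rightarrow> ('x \<Rightarrow> 'x) set \<Rightarrow> bool" where
  "complexification M T Tc \<longleftrightarrow> Tc \<subseteq> Aut0 M \<and> (\<exists>r \<theta>.
     continuous_map (product_topology (\<lambda>_. top_of_set (- {0})) {..<r}) compact_open \<theta> \<and>
     (\<forall>a\<in>cstar_pow r. \<forall>b\<in>cstar_pow r. \<theta> (cmult r a b) = \<theta> a \<circ> \<theta> b) \<and>
     (\<forall>a\<in>cstar_pow r. \<forall>i<r. \<forall>x. \<forall>c\<in>atlas M. \<forall>m.
        (\<lambda>w. snd c (\<theta> (a(i := w)) x) $ m) holomorphic_on {w. w \<noteq> 0 \<and> \<theta> (a(i := w)) x \<in> fst c}) \<and>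
     inj_on \<theta> (cstar_pow r) \<and> \<theta> ` cstar_pow r = Tc \<and> \<theta> ` circle_pow r = T)"

section \<open>The representation on sections\<close>

text \<open>Determinant (Leibniz formula) of the matrix of \<open>A\<close> in the basis \<open>B\<close>.\<close>

definition det_in :: "('l \<Rightarrow> complex) set \<Rightarrow> (('l \<Rightarrow> complex) \<Rightarrow> 'l \<Rightarrow> complex) \<Rightarrow> complex" where
  "det_in B A = (\<Sum>p | p permutes B. of_int (sign p) * (\<Prod>b\<in>B. sec.representation B (A b) (p b)))"

text \<open>A continuous representation of \<open>Aut0 M\<close> in the special linear group of \<open>H0 M k\<close>. It is
  geometric: \<open>f\<close> acts on sections through a lift \<open>F\<close>, by \<open>a \<mapsto> F \<circ> a \<circ> f\<inverse>\<close>, which is \<open>s \<mapsto> s \<circ> F\<inverse>\<close> in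
  the present encoding (in particular linear). Only the values on \<open>Aut0 M\<close> and \<open>H0 M k\<close> matter.\<close>

definition sl_representation ::
  "('x::t2_space, 'l, 'n::finite) polarized \<Rightarrow> nat \<Rightarrow> (('x \<Rightarrow> 'x) \<Rightarrow> ('l \<Rightarrow> complex) \<Rightarrow> 'l \<Rightarrow> complex) \<Rightarrow> bool" where
  "sl_representation M k \<rho> \<longleftrightarrow>
     (\<forall>f\<in>Aut0 M. (\<exists>F. lifts M F f \<and> (\<forall>s\<in>H0 M k. \<rho> f s = s \<circ> inv F)) \<and>
        (\<forall>B. is_basis (H0 M k) B \<longrightarrow> det_in B (\<rho> f) = 1)) \<and>
     (\<forall>f\<in>Aut0 M. \<forall>g\<in>Aut0 M. \<forall>s\<in>H0 M k. \<rho> (f \<circ> g) s = \<rho> f (\<rho> g s)) \<and>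
     (\<forall>s\<in>H0 M k. \<forall>v. continuous_map (subtopology compact_open (Aut0 M)) euclidean (\<lambda>f. \<rho> f s v))"

text \<open>The action of the (abelian) complex torus on sections is by pull-back, so that the
  Fubini--Study form of \<open>\<sigma> \<cdot> s\<close> is the pull-back by \<open>\<sigma>\<close> of that of \<open>s\<close>. For a left
  representation this forces the inverse.\<close>

definition act :: "(('x \<Rightarrow> 'x) \<Rightarrow> ('l \<Rightarrow> complex) \<Rightarrow> 'l \<Rightarrow> complex) \<Rightarrow> ('x \<Rightarrow> 'x) \<Rightarrow> ('l \<Rightarrow> complex) \<Rightarrow> 'l \<Rightarrow> complex" where
  "act \<rho> \<sigma> s = \<rho> (inv \<sigma>) s"

definition characters :: "('x \<Rightarrow> 'x) set \<Rightarrow> (('x \<Rightarrow> 'x) \<Rightarrow> complex) set" where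
  "characters Tc = {\<eta> \<in> extensional Tc. \<forall>f\<in>Tc. \<eta> f \<noteq> 0 \<and> (\<forall>g\<in>Tc. \<eta> (f \<circ> g) = \<eta> f * \<eta> g)}"

context
  fixes M :: "('x::t2_space, 'l, 'n::finite) polarized" and k :: nat
    and \<rho> :: "('x \<Rightarrow> 'x) \<Rightarrow> ('l \<Rightarrow> complex) \<Rightarrow> 'l \<Rightarrow> complex" and Tc :: "('x \<Rightarrow> 'x) set"
begin

definition weight_space :: "(('x \<Rightarrow> 'x) \<Rightarrow> complex) \<Rightarrow> ('l \<Rightarrow> complex) set" where
  "weight_space \<eta> = {s \<in> H0 M k. \<forall>f\<in>Tc. act \<rho> f s = (\<lambda>v. \<eta> f * s v)}"

definition weights :: "(('x \<Rightarrow> 'x) \<Rightarrow> complex) set" where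
  "weights = {\<eta> \<in> characters Tc. weight_space \<eta> \<noteq> {0}}"

definition basis_index :: "((('x \<Rightarrow> 'x) \<Rightarrow> complex) \<times> nat) set" where
  "basis_index = (SIGMA \<eta>:weights. {..<sec.dim (weight_space \<eta>)})"

definition torus_bases :: "((('x \<Rightarrow> 'x) \<Rightarrow> complex) \<times> nat \<Rightarrow> 'l \<Rightarrow> complex) set" where
  "torus_bases = {s. inj_on s basis_index \<and> is_basis (H0 M k) (s ` basis_index) \<and>
     (\<forall>(\<eta>, i)\<in>basis_index. s (\<eta>, i) \<in> weight_space \<eta>)}"

end

section \<open>Forms of type (1,1)\<close>

text \<open>A form is given in each chart by its matrix of coefficients: \<open>\<omega> c x\<close> is the matrix \<open>g\<close> for
  which the form at \<open>x\<close> is the sum of \<open>\<i> g\<^sub>j\<^sub>k dz\<^sub>j \<and> dzbar\<^sub>k\<close> in the coordinates \<open>c\<close>.\<close>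

type_synonym ('x, 'n) form = "'x set \<times> ('x \<Rightarrow> complex^'n) \<Rightarrow> 'x \<Rightarrow> complex^'n^'n"

definition form_eq :: "('x, 'l, 'n::finite) polarized \<Rightarrow> ('x, 'n) form \<Rightarrow> ('x, 'n) form \<Rightarrow> bool" where
  "form_eq M \<omega> \<omega>' \<longleftrightarrow> (\<forall>c\<in>atlas M. \<forall>x\<in>fst c. \<omega> c x = \<omega>' c x)"

definition positive_form :: "('x, 'l, 'n::finite) polarized \<Rightarrow> ('x, 'n) form \<Rightarrow> bool" where
  "positive_form M \<omega> \<longleftrightarrow> (\<forall>c\<in>atlas M. \<forall>x\<in>fst c. \<forall>\<xi>. \<xi> \<noteq> 0 \<longrightarrow>
     Re (\<Sum>j\<in>UNIV. \<Sum>k\<in>UNIV. \<omega> c x $ j $ k * \<xi> $ j * cnj (\<xi> $ k)) > 0)"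

definition pull_back :: "('x, 'l, 'n::finite) polarized \<Rightarrow> ('x \<Rightarrow> 'x) \<Rightarrow> ('x, 'n) form \<Rightarrow> ('x, 'n) form" where
  "pull_back M f \<omega> c x =
     (let d = chart_at M (f x);
          D = frechet_derivative (snd d \<circ> f \<circ> chart_inv c) (at (snd c x))
      in \<chi> j k. \<Sum>a\<in>UNIV. \<Sum>b\<in>UNIV. D (axis j 1) $ a * \<omega> d (f x) $ a $ b * cnj (D (axis k 1) $ b))"

text \<open>The form \<open>i \<partial> \<partial>bar log u(e)\<close>, where \<open>u\<close> is a positive function on nonzero vectors of \<open>L\<close> with
  \<open>u (c v) = |c|\<^sup>m u v\<close> for some integer \<open>m\<close>, and \<open>e\<close> is any local holomorphic frame; changing \<open>e\<close>
  changes \<open>log u(e)\<close> by a pluriharmonic function.\<close>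

definition i_ddbar_log :: "('x, 'l, 'n::finite) polarized \<Rightarrow> ('l \<Rightarrow> real) \<Rightarrow> ('x, 'n) form" where
  "i_ddbar_log M u c x =
     (\<chi> j k. d_z j (d_zbar k (\<lambda>z. of_real (ln (u (frame M (triv_at M x) (chart_inv c z)))))) (snd c x))"

text \<open>Integral of \<open>f\<close> against the volume form \<open>\<omega>\<^sup>n / n!\<close>, which in coordinates is \<open>2\<^sup>n det g\<close> times
  Lebesgue measure. X is cut into finitely many Borel pieces, each contained in a compact subset of
  a chart; by the change of variables formula the sum does not depend on the choice.\<close>

definition chart_cover :: "('x::t2_space, 'l, 'n::finite) polarized \<Rightarrow> (('x set \<times> ('x \<Rightarrow> complex^'n)) \<times> 'x set) list" where
  "chart_cover M = (SOME cs. (\<forall>(c, K)\<in>set cs. c \<in> atlas M \<and> compact K \<and> K \<subseteq> fst c) \<and>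
     (\<Union>(c, K)\<in>set cs. K) = UNIV)"

definition form_integral :: "('x::t2_space, 'l, 'n::finite) polarized \<Rightarrow> ('x, 'n) form \<Rightarrow> ('x \<Rightarrow> complex) \<Rightarrow> complex" where
  "form_integral M \<omega> f =
     (let cs = chart_cover M in
      \<Sum>i<length cs.
        let c = fst (cs ! i); P = snd (cs ! i) - (\<Union>j<i. snd (cs ! j))
        in LINT z:snd c ` P|lborel. 2 ^ CARD('n) * det (\<omega> c (chart_inv c z)) * f (chart_inv c z))"

section \<open>Hermitian metrics and balanced metrics\<close>

text \<open>A Hermitian metric on \<open>L\<close> is given by its squared norm \<open>h\<close>. A Hermitian metric on the \<open>k\<close>-th
  power is given by the function sending \<open>v\<close> to the squared norm of \<open>v\<^sup>\<otimes>\<^sup>k\<close>.\<close>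

definition hermitian_metric :: "('x, 'l, 'n::finite) polarized \<Rightarrow> ('l \<Rightarrow> real) \<Rightarrow> bool" where
  "hermitian_metric M h \<longleftrightarrow> (\<forall>t\<in>trivs M. \<exists>a. smooth_fun M (fst t) a \<and>
     (\<forall>v. proj M v \<in> fst t \<longrightarrow> a (proj M v) > 0 \<and> h v = a (proj M v) * (cmod (snd t v))\<^sup>2))"

definition curvature :: "('x, 'l, 'n::finite) polarized \<Rightarrow> ('l \<Rightarrow> real) \<Rightarrow> ('x, 'n) form" where
  "curvature M h = i_ddbar_log M (\<lambda>v. inverse (h v))"

text \<open>Pointwise Hermitian product of two sections for a metric \<open>hk\<close> on the \<open>k\<close>-th power: the value at
  \<open>x\<close> is computed with any nonzero vector \<open>v\<close> over \<open>x\<close>.\<close>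

definition pointwise :: "('x, 'l, 'n::finite) polarized \<Rightarrow> ('l \<Rightarrow> real) \<Rightarrow> ('l \<Rightarrow> complex) \<Rightarrow> ('l \<Rightarrow> complex) \<Rightarrow> 'x \<Rightarrow> complex" where
  "pointwise M hk s s' x =
     (let v = SOME v. nonzero M v \<and> proj M v = x in s v * cnj (s' v) * of_real (hk v))"

definition metric_of :: "('x, 'l, 'n::finite) polarized \<Rightarrow> nat \<Rightarrow> ('l \<Rightarrow> real) \<Rightarrow> ('x \<Rightarrow> real) \<Rightarrow> 'l \<Rightarrow> real" where
  "metric_of M k h0 \<phi> v = h0 v ^ k * exp (- \<phi> (proj M v))"

definition omega :: "('x, 'l, 'n::finite) polarized \<Rightarrow> nat \<Rightarrow> ('l \<Rightarrow> real) \<Rightarrow> ('x \<Rightarrow> real) \<Rightarrow> ('x, 'n) form" where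
  "omega M k h0 \<phi> = curvature M (metric_of M k h0 \<phi>)"

text \<open>Fubini--Study potential of the Hermitian form for which the family \<open>s\<close> is orthonormal.
  The metric \<open>metric_of\<close> of this potential is \<open>h0\<^sup>k\<close> divided by the sum of the \<open>|s\<^sub>j|\<^sup>2\<close>, and its
  form \<open>omega\<close> is \<open>i \<partial> \<partial>bar log\<close> of the sum of the \<open>|s\<^sub>j|\<^sup>2\<close>.\<close>

definition fs_potential ::
  "('x, 'l, 'n::finite) polarized \<Rightarrow> nat \<Rightarrow> ('l \<Rightarrow> real) \<Rightarrow> 'i set \<Rightarrow> ('i \<Rightarrow> 'l \<Rightarrow> complex) \<Rightarrow> 'x \<Rightarrow> real" where
  "fs_potential M k h0 I s x = ln (\<Sum>j\<in>I. Re (pointwise M (\<lambda>v. h0 v ^ k) (s j) (s j) x))"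

definition orthonormal_basis ::
  "('l \<Rightarrow> complex) set \<Rightarrow> (('l \<Rightarrow> complex) \<Rightarrow> ('l \<Rightarrow> complex) \<Rightarrow> complex) \<Rightarrow> ('l \<Rightarrow> complex) set \<Rightarrow> bool" where
  "orthonormal_basis V H B \<longleftrightarrow> is_basis V B \<and> (\<forall>a\<in>B. \<forall>b\<in>B. H a b = (if a = b then 1 else 0))"

definition FS ::
  "('x, 'l, 'n::finite) polarized \<Rightarrow> nat \<Rightarrow> ('l \<Rightarrow> real) \<Rightarrow> (('l \<Rightarrow> complex) \<Rightarrow> ('l \<Rightarrow> complex) \<Rightarrow> complex) \<Rightarrow> 'x \<Rightarrow> real" where
  "FS M k h0 H = fs_potential M k h0 (SOME B. orthonormal_basis (H0 M k) H B) (\<lambda>s. s)"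

definition Hilb ::
  "('x::t2_space, 'l, 'n::finite) polarized \<Rightarrow> nat \<Rightarrow> ('l \<Rightarrow> real) \<Rightarrow> ('x \<Rightarrow> real) \<Rightarrow> ('l \<Rightarrow> complex) \<Rightarrow> ('l \<Rightarrow> complex) \<Rightarrow> complex" where
  "Hilb M k h0 \<phi> s s' = form_integral M (omega M k h0 \<phi>) (pointwise M (metric_of M k h0 \<phi>) s s')"

definition sigma_balanced ::
  "('x::t2_space, 'l, 'n::finite) polarized \<Rightarrow> nat \<Rightarrow> ('l \<Rightarrow> real) \<Rightarrow> ('x \<Rightarrow> 'x) \<Rightarrow> ('x \<Rightarrow> real) \<Rightarrow> bool" where
  "sigma_balanced M k h0 \<sigma> \<phi> \<longleftrightarrow>
     form_eq M (omega M k h0 (FS M k h0 (Hilb M k h0 \<phi>))) (pull_back M \<sigma> (omega M k h0 \<phi>))"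

definition trace_free :: "'i set \<Rightarrow> ('i \<Rightarrow> 'i \<Rightarrow> complex) \<Rightarrow> 'i \<Rightarrow> 'i \<Rightarrow> complex" where
  "trace_free I A j l = A j l - (if j = l then (\<Sum>i\<in>I. A i i) / of_nat (card I) else 0)"

definition moment_map ::
  "('x::t2_space, 'l, 'n::finite) polarized \<Rightarrow> nat \<Rightarrow> ('l \<Rightarrow> real) \<Rightarrow> (('x \<Rightarrow> 'x) \<Rightarrow> ('l \<Rightarrow> complex) \<Rightarrow> 'l \<Rightarrow> complex)
     \<Rightarrow> ('x \<Rightarrow> 'x) \<Rightarrow> 'i set \<Rightarrow> ('i \<Rightarrow> 'l \<Rightarrow> complex) \<Rightarrow> 'i \<Rightarrow> 'i \<Rightarrow> complex" where
  "moment_map M k h0 \<rho> \<sigma> I s j l = \<i> * trace_free I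
     (\<lambda>a b. Hilb M k h0 (fs_potential M k h0 I s) (act \<rho> \<sigma> (s a)) (act \<rho> \<sigma> (s b))) j l"

end

theory Submission
  imports Defs
begin

text \<open>In a local frame the Fubini--Study form of a family \<open>s\<close> of sections is the Levi form of
  \<open>log \<Sum>|s\<^sub>j|\<^sup>2\<close>, an expression in the values and first derivatives of the \<open>s\<^sub>j\<close> that is unchanged when
  all \<open>s\<^sub>j\<close> are multiplied by a common function. Hence \<open>\<sigma>\<^sup>*\<omega>(s)\<close> is the form of the family \<open>t = \<sigma>\<cdot>s\<close>,
  which is again a basis because \<open>\<sigma>\<close> acts on each weight space by a nonzero scalar.

  Let \<open>B\<close> be an orthonormal basis of \<open>Hilb\<close>. If the forms of \<open>B\<close> and \<open>t\<close> agree, then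
  \<open>log \<Sum>|b|\<^sup>2 - log \<Sum>|t\<^sub>j|\<^sup>2\<close> is pluriharmonic on a compact connected manifold, hence constant;
  polarization gives \<open>\<Sum> b(v) b(w)\<^sup>- = a \<Sum> t\<^sub>j(v) t\<^sub>j(w)\<^sup>-\<close>, and pairing this kernel identity with \<open>t\<^sub>l\<close>
  shows that the matrix \<open>Hilb(t\<^sub>j, t\<^sub>l)\<close> is \<open>1/a\<close> times the identity. Conversely, if that matrix is a
  multiple of the identity, then \<open>t\<close> is orthonormal up to scale, and all orthonormal bases have the
  same kernel.\<close>

section \<open>Derivatives of holomorphic functions of several variables\<close>

text \<open>Two obstacles shape the development. The forms are defined through Frechet derivatives,
  while a function in \<open>holo_fun_on\<close> is only known to be complex differentiable at each
  point. \<open>i_ddbar_log\<close> needs a second derivative, so differentiability of the first one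
  has to be proved; such facts are reached through one complex variable, by restriction to complex
  lines. Moreover frames, charts, the vector over a point and the orthonormal basis in
  \<open>FS\<close> are picked by choice operators. \<open>levi\<close> ignores a common factor that
  is not known to be differentiable; this settles the choice of frame and, by the same lemma, the
  lift of \<sigma>. The choice of basis is harmless since only its kernel matters.

  The pairing argument needs \<open>Hilb\<close> to be positive definite. Here the embedding enters:
  immersivity makes the form, its determinant and thus the volume density positive. The trace-free
  part leaves the scale of the matrix free; when the matrix is given, positivity of
  \<open>Hilb\<close> makes that scale a positive real.\<close>

lemma norm_vec_scale: "norm (c *s v) = cmod c * norm v" for v :: "complex^'n"
  by (simp add: norm_vec_def vector_scalar_mult_def norm_mult L2_set_right_distrib)

lemma bounded_linear_scale_left: "bounded_linear (\<lambda>c. c *s v)" for v :: "complex^'n"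
  by (rule bounded_linear_intro[of _ "norm v"])
    (auto simp: norm_vec_scale vector_sadd_rdistrib vec_eq_iff)

lemma holo_fun_on_subset: "holo_fun_on S f \<Longrightarrow> T \<subseteq> S \<Longrightarrow> holo_fun_on T f"
  unfolding holo_fun_on_def by blast

lemma holo_fun_on_has_derivative:
  assumes "holo_fun_on S f" "z \<in> S"
  shows "(f has_derivative frechet_derivative f (at z)) (at z)"
  using assms unfolding holo_fun_on_def
  by (metis frechet_derivative_at)

lemma holo_fun_on_derivative_scale:
  assumes "holo_fun_on S f" "z \<in> S"
  shows "frechet_derivative f (at z) (c *s v) = c * frechet_derivative f (at z) v"
  using assms unfolding holo_fun_on_def
  by (metis frechet_derivative_at)

lemma holo_fun_on_continuous:
  assumes "holo_fun_on S f"
  shows "continuous_on S f"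
  by (intro continuous_at_imp_continuous_on ballI
      has_derivative_continuous[OF holo_fun_on_has_derivative[OF assms]])

text \<open>Along a complex line the derivative becomes an ordinary complex derivative, so that
  Cauchy's inequality, Taylor's formula, analytic continuation and the maximum principle become
  available.\<close>

lemma holo_fun_on_line:
  assumes f: "holo_fun_on S f" and z: "a + \<zeta> *s v \<in> S"
  shows "((\<lambda>\<zeta>. f (a + \<zeta> *s v)) has_field_derivative frechet_derivative f (at (a + \<zeta> *s v)) v) (at \<zeta>)"
proof -
  have "((\<lambda>\<zeta>. a + \<zeta> *s v) has_derivative (\<lambda>\<eta>. \<eta> *s v)) (at \<zeta>)"
    using has_derivative_add[OF has_derivative_const[of a]
        bounded_linear_imp_has_derivative[OF bounded_linear_scale_left[of v]]] by simp
  from has_derivative_compose[OF this holo_fun_on_has_derivative[OF f z]]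
  have "((\<lambda>\<zeta>. f (a + \<zeta> *s v)) has_derivative
      (\<lambda>\<eta>. frechet_derivative f (at (a + \<zeta> *s v)) (\<eta> *s v))) (at \<zeta>)" .
  then show ?thesis
    by (simp add: has_field_derivative_def holo_fun_on_derivative_scale[OF f z] mult.commute[of _ "frechet_derivative _ _ _"])
qed

lemma holo_fun_on_line_holomorphic:
  assumes f: "holo_fun_on S f" and "\<And>\<zeta>. \<zeta> \<in> W \<Longrightarrow> a + \<zeta> *s v \<in> S"
  shows "(\<lambda>\<zeta>. f (a + \<zeta> *s v)) holomorphic_on W"
proof (rule holomorphic_onI)
  fix \<zeta> assume "\<zeta> \<in> W"
  from holo_fun_on_line[OF f assms(2)[OF this]]
  show "(\<lambda>\<zeta>. f (a + \<zeta> *s v)) field_differentiable at \<zeta> within W"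
    using field_differentiable_at_within field_differentiable_def by blast
qed

lemma holo_fun_on_diff:
  assumes "holo_fun_on S f" "holo_fun_on S g"
  shows "holo_fun_on S (\<lambda>z. f z - g z)"
  unfolding holo_fun_on_def
proof (intro ballI exI conjI allI)
  fix z assume z: "z \<in> S"
  show "((\<lambda>z. f z - g z) has_derivative
     (\<lambda>v. frechet_derivative f (at z) v - frechet_derivative g (at z) v)) (at z)"
    by (intro has_derivative_diff holo_fun_on_has_derivative[OF assms(1) z] holo_fun_on_has_derivative[OF assms(2) z])
qed (simp add: holo_fun_on_derivative_scale[OF assms(1)] holo_fun_on_derivative_scale[OF assms(2)] algebra_simps)

lemma holo_fun_on_cmult:
  assumes "holo_fun_on S f"
  shows "holo_fun_on S (\<lambda>z. c * f z)"
  unfolding holo_fun_on_def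
proof (intro ballI exI conjI allI)
  fix z assume z: "z \<in> S"
  show "((\<lambda>z. c * f z) has_derivative (\<lambda>v. c * frechet_derivative f (at z) v)) (at z)"
    by (intro has_derivative_mult_right holo_fun_on_has_derivative[OF assms z])
qed (simp add: holo_fun_on_derivative_scale[OF assms(1)] algebra_simps)

lemma holo_fun_on_translate:
  assumes "holo_fun_on S f" "\<And>z. z \<in> T \<Longrightarrow> z + a \<in> S"
  shows "holo_fun_on T (\<lambda>z. f (z + a))"
  unfolding holo_fun_on_def
proof (intro ballI exI conjI allI)
  fix z assume z: "z \<in> T"
  have "((\<lambda>z. z + a) has_derivative (\<lambda>v. v)) (at z)"
    by (auto intro!: derivative_eq_intros)
  from has_derivative_compose[OF this holo_fun_on_has_derivative[OF assms(1) assms(2)[OF z]]]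
  show "((\<lambda>z. f (z + a)) has_derivative (\<lambda>v. frechet_derivative f (at (z + a)) v)) (at z)" .
qed (simp add: holo_fun_on_derivative_scale[OF assms(1)] assms)

lemma line_mem_ball: "(z + \<zeta> *s v) \<in> ball a R" if "z \<in> ball a r" "cmod \<zeta> * norm v \<le> R - r" for z v :: "complex^'n"
proof -
  have "norm (a - (z + \<zeta> *s v)) \<le> norm (a - z) + norm (\<zeta> *s v)"
    by (metis diff_diff_eq norm_triangle_ineq4)
  with that show ?thesis by (simp add: dist_norm norm_vec_scale)
qed

text \<open>Cauchy's inequality on the line through \<open>z\<close> in direction \<open>v\<close>,
  on a disc of half the radius \<open>(R - r) / norm v\<close> that would fit; hence the factor
  2.\<close>

lemma Cauchy_estimate_directional:
  assumes f: "holo_fun_on (ball a R) f" and r: "0 < r" "r < R" and z: "z \<in> ball a r"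
    and B: "\<And>w. w \<in> ball a R \<Longrightarrow> cmod (f w) \<le> B"
  shows "cmod (frechet_derivative f (at z) v) \<le> 2 * B / (R - r) * norm v"
proof (cases "v = 0")
  case True
  have "z \<in> ball a R" using z r by auto
  from has_derivative_bounded_linear[OF holo_fun_on_has_derivative[OF f this]] True
  show ?thesis by (simp add: bounded_linear.linear linear_0)
next
  case False
  define \<rho> where "\<rho> = (R - r) / (2 * norm v)"
  have \<rho>: "\<rho> > 0" using False r by (simp add: \<rho>_def)
  have in_ball: "z + \<zeta> *s v \<in> ball a R" if "\<zeta> \<in> cball 0 \<rho>" for \<zeta>
  proof (rule line_mem_ball[OF z])
    have "cmod \<zeta> * norm v \<le> \<rho> * norm v" using that by (intro mult_right_mono) auto
    also have "\<dots> \<le> R - r" using False r by (simp add: \<rho>_def)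
    finally show "cmod \<zeta> * norm v \<le> R - r" .
  qed
  have hol: "(\<lambda>\<zeta>. f (z + \<zeta> *s v)) holomorphic_on cball 0 \<rho>"
    by (rule holo_fun_on_line_holomorphic[OF f in_ball])
  have "cmod ((deriv ^^ 1) (\<lambda>\<zeta>. f (z + \<zeta> *s v)) 0) \<le> fact 1 * B / \<rho> ^ 1"
  proof (rule Cauchy_inequality[OF _ _ \<rho>])
    show "(\<lambda>\<zeta>. f (z + \<zeta> *s v)) holomorphic_on ball 0 \<rho>"
      using hol holomorphic_on_subset ball_subset_cball by blast
    show "continuous_on (cball 0 \<rho>) (\<lambda>\<zeta>. f (z + \<zeta> *s v))"
      using hol holomorphic_on_imp_continuous_on by blast
  qed (use in_ball B in auto)
  moreover have "deriv (\<lambda>\<zeta>. f (z + \<zeta> *s v)) 0 = frechet_derivative f (at z) v"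
    using DERIV_imp_deriv[OF holo_fun_on_line[OF f, of z 0 v]] z r by auto
  ultimately show ?thesis using False r by (simp add: \<rho>_def field_simps)
qed

text \<open>Cauchy's inequality on discs of radius \<open>R/3\<close> bounds the second derivative
  on the ball of radius \<open>R/2\<close>, since \<open>R/2 + R/3 < R\<close>; the constant is
  \<open>2 * B / (R/3)^2\<close>. The quadratic error is what gives difference quotients the rate
  \<open>1/n\<close>.\<close>

lemma complex_Taylor_quadratic:
  assumes hol: "\<phi> holomorphic_on ball 0 R" and "R > 0"
    and B: "\<And>\<zeta>. \<zeta> \<in> ball 0 R \<Longrightarrow> cmod (\<phi> \<zeta>) \<le> B" and h: "cmod h < R / 2"
  shows "cmod (\<phi> h - \<phi> 0 - deriv \<phi> 0 * h) \<le> 18 * B / R\<^sup>2 * (cmod h)\<^sup>2"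
proof -
  define f where "f i = (deriv ^^ i) \<phi>" for i
  have sub: "ball 0 (R/2) \<subseteq> ball (0::complex) R" using \<open>R > 0\<close> by (auto)
  have "cmod (f 0 h - (\<Sum>i\<le>1. f i 0 * (h-0) ^ i / (fact i))) \<le> 18 * B / R\<^sup>2 * cmod(h - 0)^(Suc 1) / fact 1"
  proof (rule complex_Taylor[of "ball 0 (R/2)"])
    fix i :: nat and x :: complex assume x: "x \<in> ball 0 (R/2)"
    have "f i holomorphic_on ball 0 R"
      unfolding f_def using hol by (intro holomorphic_higher_deriv) auto
    then have "(f i has_field_derivative deriv (f i) x) (at x)"
      using x sub by (meson holomorphic_derivI open_ball subsetD)
    then show "(f i has_field_derivative f (Suc i) x) (at x within ball 0 (R/2))"
      by (simp add: f_def has_field_derivative_at_within)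
  next
    fix x :: complex assume x: "x \<in> ball 0 (R/2)"
    have sub: "cball x (R/3) \<subseteq> ball 0 R"
    proof
      fix y assume "y \<in> cball x (R/3)"
      then have "cmod y \<le> cmod x + R / 3"
        using norm_triangle_ineq4[of x "x - y"] by (simp add: dist_norm)
      also have "\<dots> < R" using x \<open>R > 0\<close> by (simp add: dist_norm)
      finally show "y \<in> ball 0 R" by simp
    qed
    have "cmod (f (Suc 1) x) \<le> fact (Suc 1) * B / (R/3) ^ (Suc 1)"
      unfolding f_def
    proof (rule Cauchy_inequality)
      show "\<phi> holomorphic_on ball x (R/3)"
        by (meson hol holomorphic_on_subset sub ball_subset_cball order_trans)
      show "continuous_on (cball x (R/3)) \<phi>"
        by (meson hol holomorphic_on_subset sub holomorphic_on_imp_continuous_on)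
      show "cmod (\<phi> y) \<le> B" if "cmod (x - y) = R / 3" for y
        using that sub by (intro B) (auto simp: dist_norm)
    qed (use \<open>R > 0\<close> in auto)
    also have "\<dots> = 18 * B / R\<^sup>2" by (simp add: power2_eq_square)
    finally show "cmod (f (Suc 1) x) \<le> 18 * B / R\<^sup>2" .
  qed (use h \<open>R > 0\<close> in auto)
  then show ?thesis by (simp add: f_def power2_eq_square diff_diff_eq)
qed

text \<open>The difference quotients of \<open>f\<close> in direction \<open>v\<close> converge locally uniformly, at rate \<open>1/n\<close>.
  By Cauchy's estimates so do their derivatives.\<close>

lemma holo_fun_on_derivative:
  fixes f :: "complex^'n \<Rightarrow> complex"
  assumes f: "holo_fun_on S f" and S: "open S"
  shows "holo_fun_on S (\<lambda>z. frechet_derivative f (at z) v)"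
  unfolding holo_fun_on_def
proof
  fix a assume a: "a \<in> S"
  obtain R0 where R0: "R0 > 0" "ball a R0 \<subseteq> S" using a S by (meson openE)
  have "continuous (at a) f"
    using has_derivative_continuous[OF holo_fun_on_has_derivative[OF f a]] .
  then obtain R1 where R1: "R1 > 0" "\<And>z. dist z a < R1 \<Longrightarrow> dist (f z) (f a) < 1"
    unfolding continuous_at_eps_delta by (metis zero_less_one)
  \<comment> \<open>Room for three nested balls: \<open>f\<close> is bounded on radius
    \<open>4*r\<close>, its difference quotients live on \<open>2*r\<close>, and the estimate of
    their derivatives shrinks this to \<open>r\<close>.\<close>
  define r where "r = min R0 R1 / 4"
  define M where "M = cmod (f a) + 1"
  have r: "r > 0" using R0 R1 by (simp add: r_def)
  have sub: "ball a (4*r) \<subseteq> S" using R0 by (auto simp: r_def)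
  have M: "cmod (f z) \<le> M" if "z \<in> ball a (4*r)" for z
  proof -
    have "dist (f z) (f a) < 1" using that by (intro R1) (auto simp: r_def dist_commute)
    then show ?thesis unfolding M_def dist_norm by norm
  qed
  have f4: "holo_fun_on (ball a (4*r)) f" using f sub by (rule holo_fun_on_subset)
  \<comment> \<open>The summand 1 keeps the radius meaningful for \<open>v = 0\<close>.\<close>
  define \<rho> where "\<rho> = 2 * r / (norm v + 1)"
  have \<rho>: "\<rho> > 0" using r by (simp add: \<rho>_def add_nonneg_pos)
  define q where "q n z = of_nat n * (f (z + (1 / of_nat n) *s v) - f z)" for n :: nat and z
  define C where "C = 18 * M / \<rho>\<^sup>2"
  have C: "C \<ge> 0" by (simp add: C_def M_def add_nonneg_nonneg)
  obtain n0 :: nat where n0: "n0 > 0" "1 / real n0 < \<rho> / 2"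
    using \<rho> real_arch_inverse[of "\<rho>/2"] by (auto simp: inverse_eq_divide)
  have n0': "n > 0" "1 / real n < \<rho> / 2" if "n \<ge> n0" for n
  proof -
    show "n > 0" using that n0 by simp
    have "1 / real n \<le> 1 / real n0" using that n0 by (simp add: frac_le)
    then show "1 / real n < \<rho> / 2" using n0 by simp
  qed
  have rhov: "\<rho> * norm v \<le> 2 * r"
  proof -
    have "\<rho> * norm v \<le> \<rho> * (norm v + 1)" using \<rho> by simp
    also have "\<dots> = 2 * r" by (simp add: \<rho>_def add_nonneg_eq_0_iff)
    finally show ?thesis .
  qed
  have in4: "z + \<zeta> *s v \<in> ball a (4*r)" if "z \<in> ball a (2*r)" "cmod \<zeta> < \<rho>" for z \<zeta>
  proof (rule line_mem_ball[OF that(1)])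
    have "cmod \<zeta> * norm v \<le> \<rho> * norm v" using that by (simp add: mult_right_mono)
    then show "cmod \<zeta> * norm v \<le> 4 * r - 2 * r" using rhov by simp
  qed
  have q_approx: "cmod (q n z - frechet_derivative f (at z) v) \<le> C / real n"
    if n: "n \<ge> n0" and z: "z \<in> ball a (2*r)" for n z
  proof -
    let ?\<phi> = "\<lambda>\<zeta>. f (z + \<zeta> *s v)"
    have z4: "z + 0 *s v \<in> ball a (4*r)" by (rule in4[OF z]) (use \<rho> in simp)
    have d: "deriv ?\<phi> 0 = frechet_derivative f (at z) v"
      using DERIV_imp_deriv[OF holo_fun_on_line[OF f4 z4]] by simp
    have "?\<phi> holomorphic_on ball 0 \<rho>"
      by (rule holo_fun_on_line_holomorphic[OF f4]) (use in4[OF z] in simp)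
    then have "cmod (?\<phi> (1 / of_nat n) - ?\<phi> 0 - deriv ?\<phi> 0 * (1 / of_nat n)) \<le> 18 * M / \<rho>\<^sup>2 * (cmod (1 / of_nat n))\<^sup>2"
      by (rule complex_Taylor_quadratic[OF _ \<rho>]) (use in4[OF z] M n0'[OF n] in \<open>auto simp: norm_divide\<close>)
    then have "real n * cmod (?\<phi> (1 / of_nat n) - ?\<phi> 0 - deriv ?\<phi> 0 * (1 / of_nat n)) \<le> real n * (C * (1 / real n)\<^sup>2)"
      by (intro mult_left_mono) (auto simp: C_def norm_divide)
    also have "\<dots> = C / real n" using n0'[OF n] by (simp add: power2_eq_square)
    also have "real n * cmod (?\<phi> (1 / of_nat n) - ?\<phi> 0 - deriv ?\<phi> 0 * (1 / of_nat n))
      = cmod (of_nat n * (?\<phi> (1 / of_nat n) - ?\<phi> 0 - deriv ?\<phi> 0 * (1 / of_nat n)))"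
      by (simp add: norm_mult)
    also have "of_nat n * (?\<phi> (1 / of_nat n) - ?\<phi> 0 - deriv ?\<phi> 0 * (1 / of_nat n))
       = q n z - frechet_derivative f (at z) v"
      using n0'[OF n] by (simp add: q_def d algebra_simps)
    finally show ?thesis .
  qed
  have q_holo: "holo_fun_on (ball a (2*r)) (q n)" if n: "n \<ge> n0" for n
    unfolding q_def
  proof (intro holo_fun_on_cmult holo_fun_on_diff holo_fun_on_translate[OF f4])
    fix z assume "z \<in> ball a (2*r)"
    then show "z + (1 / of_nat n) *s v \<in> ball a (4*r)"
      by (rule in4) (use n0'[OF n] \<rho> in \<open>auto simp: norm_divide\<close>)
  next
    show "holo_fun_on (ball a (2*r)) f" using f4 by (rule holo_fun_on_subset) (use r in auto)
  qed
  define D where "D n z = frechet_derivative (q n) (at z)" for n z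
  \<comment> \<open>Uniform closeness of \<open>q n\<close> and \<open>q m\<close> on the larger
    ball passes to their derivatives on the smaller one, with a bound linear in
    \<open>norm h\<close>, as \<open>has_derivative_sequence\<close> demands.\<close>
  have q_cauchy: "cmod (D n z h - D m z h) \<le> 2 * (C / real n + C / real m) / r * norm h"
    if n: "n \<ge> n0" and m: "m \<ge> n0" and z: "z \<in> ball a r" for n m z h
  proof -
    have z2: "z \<in> ball a (2*r)" using z r by auto
    have d: "frechet_derivative (\<lambda>z. q n z - q m z) (at z) = (\<lambda>h. D n z h - D m z h)"
      unfolding D_def
      by (rule frechet_derivative_at[symmetric], rule has_derivative_diff)
        (rule holo_fun_on_has_derivative[OF q_holo z2], fact)+
    have "cmod (frechet_derivative (\<lambda>z. q n z - q m z) (at z) h) \<le> 2 * (C / real n + C / real m) / (2 * r - r) * norm h"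
    proof (rule Cauchy_estimate_directional[OF _ r _ z])
      show "holo_fun_on (ball a (2*r)) (\<lambda>z. q n z - q m z)"
        by (intro holo_fun_on_diff q_holo n m)
      fix w assume w: "w \<in> ball a (2*r)"
      show "cmod (q n w - q m w) \<le> C / real n + C / real m"
        using q_approx[OF n w] q_approx[OF m w]
          norm_triangle_ineq4[of "q n w - frechet_derivative f (at w) v" "q m w - frechet_derivative f (at w) v"]
        by simp
    qed (use r in auto)
    then show ?thesis by (simp add: d)
  qed
  have conv: "convergent (\<lambda>n. D n z h)" if z: "z \<in> ball a r" for z h
  proof (rule Cauchy_convergent, rule metric_CauchyI)
    fix e :: real assume e: "e > 0"
    have "(\<lambda>n. 4 * C / r * norm h * (1 / real n)) \<longlonglongrightarrow> 4 * C / r * norm h * 0"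
      by (intro tendsto_intros lim_1_over_n)
    then have "eventually (\<lambda>n. 4 * C / r * norm h * (1 / real n) < e) sequentially"
      using e by (intro order_tendstoD(2)) auto
    then obtain N where N: "4 * C / r * norm h * (1 / real n) < e" if "n \<ge> N" for n
      unfolding eventually_sequentially by blast
    define K where "K = max N n0"
    show "\<exists>K. \<forall>m\<ge>K. \<forall>n\<ge>K. dist (D m z h) (D n z h) < e"
    proof (intro exI[of _ K] allI impI)
      fix m n assume mn: "m \<ge> K" "n \<ge> K"
      have K0: "K > 0" "K \<ge> n0" "K \<ge> N" using n0 by (auto simp: K_def)
      have "dist (D m z h) (D n z h) \<le> 2 * (C / real m + C / real n) / r * norm h"
        unfolding dist_norm using mn K0 by (intro q_cauchy z) auto
      also have "\<dots> \<le> 2 * (C / real K + C / real K) / r * norm h"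
        using mn K0 C r by (intro mult_right_mono divide_right_mono mult_left_mono add_mono frac_le) auto
      also have "\<dots> = 4 * C / r * norm h * (1 / real K)" by (simp add: field_simps)
      also have "\<dots> < e" using N K0 by auto
      finally show "dist (D m z h) (D n z h) < e" .
    qed
  qed
  define g' where "g' z h = lim (\<lambda>n. D n z h)" for z h
  have g'_lim: "(\<lambda>n. D n z h) \<longlonglongrightarrow> g' z h" if "z \<in> ball a r" for z h
    using conv[OF that] by (simp add: g'_def convergent_LIMSEQ_iff)
  have g'_bound: "cmod (D n z h - g' z h) \<le> 2 * C / r * norm h / real n"
    if n: "n \<ge> n0" and z: "z \<in> ball a r" for n z h
  proof (rule Lim_bounded)
    show "(\<lambda>m. cmod (D n z h - D m z h) - 2 * C / r * norm h * (1 / real m)) \<longlonglongrightarrow>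
        cmod (D n z h - g' z h)"
      using tendsto_diff[OF tendsto_norm[OF tendsto_diff[OF tendsto_const g'_lim[OF z]]]
          tendsto_mult[OF tendsto_const[of "2 * C / r * norm h"] lim_1_over_n]]
      by simp
    show "\<forall>m\<ge>n0. cmod (D n z h - D m z h) - 2 * C / r * norm h * (1 / real m) \<le> 2 * C / r * norm h / real n"
    proof (intro allI impI)
      fix m assume "m \<ge> n0"
      from q_cauchy[OF n this z, of h]
      show "cmod (D n z h - D m z h) - 2 * C / r * norm h * (1 / real m) \<le> 2 * C / r * norm h / real n"
        by (simp add: ring_distribs add_divide_distrib mult.commute mult.left_commute)
    qed
  qed
  have lim_q: "(\<lambda>n. q n z) \<longlonglongrightarrow> frechet_derivative f (at z) v" if "z \<in> ball a (2*r)" for z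
  proof (rule LIM_zero_cancel, rule Lim_null_comparison)
    show "\<forall>\<^sub>F n in sequentially. norm (q n z - frechet_derivative f (at z) v) \<le> C * (1 / real n)"
      unfolding eventually_sequentially using q_approx[OF _ that] by (intro exI[of _ n0]) simp
    show "(\<lambda>n. C * (1 / real n)) \<longlonglongrightarrow> 0"
      using tendsto_mult[OF tendsto_const[of C] lim_1_over_n] by simp
  qed
  \<comment> \<open>The shift by \<open>n0\<close> is there because \<open>q n\<close> is known to
    be holomorphic on the ball only from \<open>n0\<close> on.\<close>
  have "\<exists>g. \<forall>z\<in>ball a r. (\<lambda>n. q (n + n0) z) \<longlonglongrightarrow> g z \<and> (g has_derivative g' z) (at z within ball a r)"
  proof (rule has_derivative_sequence[of "ball a r" "\<lambda>n. q (n + n0)" "\<lambda>n. D (n + n0)" g' a])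
    show "(q (n + n0) has_derivative D (n + n0) z) (at z within ball a r)" if "z \<in> ball a r" for n z
    proof -
      have "z \<in> ball a (2*r)" using that r by auto
      then show ?thesis unfolding D_def
        by (intro has_derivative_at_withinI[OF holo_fun_on_has_derivative[OF q_holo]]) auto
    qed
    fix e :: real assume e: "e > 0"
    have "(\<lambda>n. 2 * C / r * (1 / real n)) \<longlonglongrightarrow> 2 * C / r * 0"
      by (intro tendsto_intros lim_1_over_n)
    then have "eventually (\<lambda>n. 2 * C / r * (1 / real n) < e) sequentially"
      using e by (intro order_tendstoD(2)) auto
    then obtain N where N: "2 * C / r * (1 / real n) < e" if "n \<ge> N" for n
      unfolding eventually_sequentially by blast
    show "\<forall>\<^sub>F n in sequentially. \<forall>z\<in>ball a r. \<forall>h. norm (D (n + n0) z h - g' z h) \<le> e * norm h"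
      unfolding eventually_sequentially
    proof (intro exI[of _ N] allI impI ballI)
      fix n z h assume n: "n \<ge> N" and z: "z \<in> ball a r"
      have "norm (D (n + n0) z h - g' z h) \<le> 2 * C / r * (1 / real (n + n0)) * norm h"
        using g'_bound[of "n + n0" z h] z by (simp add: field_simps)
      also have "\<dots> \<le> e * norm h" using N[of "n + n0"] n by (intro mult_right_mono) auto
      finally show "norm (D (n + n0) z h - g' z h) \<le> e * norm h" .
    qed
  next
    show "(\<lambda>n. q (n + n0) a) \<longlonglongrightarrow> frechet_derivative f (at a) v"
      using LIMSEQ_ignore_initial_segment[OF lim_q[of a]] r by simp
  qed (use r in auto)
  then obtain g where g: "\<And>z. z \<in> ball a r \<Longrightarrow> (\<lambda>n. q (n + n0) z) \<longlonglongrightarrow> g z"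
    "\<And>z. z \<in> ball a r \<Longrightarrow> (g has_derivative g' z) (at z within ball a r)" by blast
  have g_eq: "g z = frechet_derivative f (at z) v" if "z \<in> ball a r" for z
    using LIMSEQ_unique[OF g(1)[OF that] LIMSEQ_ignore_initial_segment[OF lim_q]] that r by auto
  have "(g has_derivative g' a) (at a)"
    using g(2)[of a] r by (simp add: at_within_open[of a "ball a r"])
  then have der: "((\<lambda>z. frechet_derivative f (at z) v) has_derivative g' a) (at a)"
    by (rule has_derivative_transform_within_open[of _ _ _ _ "ball a r"]) (use r g_eq in auto)
  have "g' a (c *s h) = c * g' a h" for c h
  proof (rule LIMSEQ_unique)
    show "(\<lambda>n. D (n + n0) a (c *s h)) \<longlonglongrightarrow> g' a (c *s h)"
      using LIMSEQ_ignore_initial_segment[OF g'_lim] r by simp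
    have "D (n + n0) a (c *s h) = c * D (n + n0) a h" for n
      unfolding D_def by (rule holo_fun_on_derivative_scale[OF q_holo]) (use r in auto)
    then show "(\<lambda>n. D (n + n0) a (c *s h)) \<longlonglongrightarrow> c * g' a h"
      using tendsto_mult[OF tendsto_const[of c] LIMSEQ_ignore_initial_segment[OF g'_lim[of a h], of n0]] r by simp
  qed
  then show "\<exists>D. ((\<lambda>z. frechet_derivative f (at z) v) has_derivative D) (at a) \<and>
      (\<forall>c v. D (c *s v) = c * D v)"
    using der by blast
qed

section \<open>The Levi form of the logarithm of a sum of squares\<close>

text \<open>The Fubini--Study Hermitian form at the projective point of \<open>u\<close>: the inner
  product of the components of \<open>p\<close> and \<open>q\<close> orthogonal to \<open>u\<close>,
  divided by the squared length of \<open>u\<close>. With \<open>u\<close> the values and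
  \<open>p\<close>, \<open>q\<close> the first derivatives of holomorphic functions it is the mixed
  second derivative of the logarithm of their sum of squares.\<close>

definition levi :: "'i set \<Rightarrow> ('i \<Rightarrow> complex) \<Rightarrow> ('i \<Rightarrow> complex) \<Rightarrow> ('i \<Rightarrow> complex) \<Rightarrow> complex" where
  "levi I u p q = (\<Sum>i\<in>I. p i * cnj (q i)) / (\<Sum>i\<in>I. u i * cnj (u i)) -
     (\<Sum>i\<in>I. p i * cnj (u i)) * (\<Sum>i\<in>I. u i * cnj (q i)) / (\<Sum>i\<in>I. u i * cnj (u i))\<^sup>2"

lemma levi_cong:
  assumes "\<And>i. i \<in> I \<Longrightarrow> u i = u' i" "\<And>i. i \<in> I \<Longrightarrow> p i = p' i" "\<And>i. i \<in> I \<Longrightarrow> q i = q' i"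
  shows "levi I u p q = levi I u' p' q'"
  using assms by (simp add: levi_def)

lemma sum_mult_cnj: "(\<Sum>i\<in>I. u i * cnj (u i)) = of_real (\<Sum>i\<in>I. (cmod (u i))\<^sup>2)"
  unfolding of_real_sum complex_norm_square ..

lemma sum_norm_square_pos:
  assumes "finite I" "\<exists>i\<in>I. u i \<noteq> 0"
  shows "(\<Sum>i\<in>I. (cmod (u i))\<^sup>2) > 0"
proof -
  from assms(2) obtain i where "i \<in> I" "u i \<noteq> 0" by blast
  then show ?thesis by (intro sum_pos2[OF assms(1)]) auto
qed

lemma sum_mult_cnj_nonzero:
  assumes "finite I" "\<exists>i\<in>I. u i \<noteq> 0"
  shows "(\<Sum>i\<in>I. u i * cnj (u i)) \<noteq> 0"
  using sum_norm_square_pos[OF assms] unfolding sum_mult_cnj of_real_eq_0_iff by simp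

text \<open>Multiples of \<open>u\<close> do not affect the components orthogonal to
  \<open>u\<close>, and \<open>g\<close> scales numerator and denominator by
  \<open>g * cnj g\<close>. The arguments have the shape that the product rule gives for a family
  multiplied by a function with value \<open>g\<close> and derivatives \<open>a\<close>,
  \<open>b\<close>.\<close>

lemma levi_multiple:
  assumes g: "g \<noteq> 0" and S: "(\<Sum>i\<in>I. u i * cnj (u i)) \<noteq> 0"
  shows "levi I (\<lambda>i. g * u i) (\<lambda>i. g * p i + a * u i) (\<lambda>i. g * q i + b * u i) = levi I u p q"
proof -
  define P where "P = (\<Sum>i\<in>I. p i * cnj (q i))"
  define A where "A = (\<Sum>i\<in>I. p i * cnj (u i))"
  define B where "B = (\<Sum>i\<in>I. u i * cnj (q i))"
  define S where "S = (\<Sum>i\<in>I. u i * cnj (u i))"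
  have 1: "(\<Sum>i\<in>I. (g * u i) * cnj (g * u i)) = g * cnj g * S"
    by (simp add: S_def sum_distrib_left mult_ac)
  have 2: "(\<Sum>i\<in>I. (g * p i + a * u i) * cnj (g * q i + b * u i)) =
      g * cnj g * P + g * cnj b * A + a * cnj g * B + a * cnj b * S"
    by (simp add: S_def P_def A_def B_def sum_distrib_left sum.distrib[symmetric] algebra_simps)
  have 3: "(\<Sum>i\<in>I. (g * p i + a * u i) * cnj (g * u i)) = g * cnj g * A + a * cnj g * S"
    by (simp add: S_def A_def sum_distrib_left sum.distrib[symmetric] algebra_simps)
  have 4: "(\<Sum>i\<in>I. (g * u i) * cnj (g * q i + b * u i)) = g * cnj g * B + g * cnj b * S"
    by (simp add: S_def B_def sum_distrib_left sum.distrib[symmetric] algebra_simps)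
  have S0: "S \<noteq> 0" "cnj g \<noteq> 0" using S g by (auto simp: S_def)
  define G where "G = g * cnj g"
  define R where "R = g * cnj b * A + a * cnj g * B + a * cnj b * S"
  have G0: "G \<noteq> 0" using S0 g by (simp add: G_def)
  have 5: "(G * A + a * cnj g * S) * (G * B + g * cnj b * S) = G * G * (A * B) + G * S * R"
    by (simp add: G_def R_def algebra_simps)
  have 6: "G * P + g * cnj b * A + a * cnj g * B + a * cnj b * S = G * P + R"
    by (simp add: R_def)
  have "(G * P + R) / (G * S) - (G * G * (A * B) + G * S * R) / (G * S)\<^sup>2 = P / S - A * B / S\<^sup>2"
    using S0 G0 by (simp add: add_divide_distrib power2_eq_square)
  then show ?thesis
    unfolding levi_def 1 2 3 4 P_def[symmetric] A_def[symmetric] B_def[symmetric] S_def[symmetric]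
      G_def[symmetric] 5 6 .
qed

text \<open>Sesquilinearity, in the form needed for coordinate expansions: once for the Jacobian in
  \<open>pull_back\<close>, once for evaluating a form on a tangent vector.\<close>

lemma levi_sum:
  "levi I u (\<lambda>i. \<Sum>a\<in>A. x a * p a i) (\<lambda>i. \<Sum>b\<in>B. y b * q b i) =
    (\<Sum>a\<in>A. \<Sum>b\<in>B. x a * levi I u (p a) (q b) * cnj (y b))"
proof -
  have 1: "(\<Sum>i\<in>I. (\<Sum>a\<in>A. x a * p a i) * cnj (\<Sum>b\<in>B. y b * q b i)) =
     (\<Sum>a\<in>A. \<Sum>b\<in>B. x a * cnj (y b) * (\<Sum>i\<in>I. p a i * cnj (q b i)))"
  proof -
    have "(\<Sum>i\<in>I. (\<Sum>a\<in>A. x a * p a i) * cnj (\<Sum>b\<in>B. y b * q b i)) =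
       (\<Sum>i\<in>I. \<Sum>a\<in>A. \<Sum>b\<in>B. x a * cnj (y b) * (p a i * cnj (q b i)))"
      by (simp add: cnj_sum sum_product mult_ac)
    also have "\<dots> = (\<Sum>a\<in>A. \<Sum>b\<in>B. \<Sum>i\<in>I. x a * cnj (y b) * (p a i * cnj (q b i)))"
      by (subst sum.swap) (intro sum.cong refl sum.swap)
    finally show ?thesis by (simp add: sum_distrib_left)
  qed
  have 2: "(\<Sum>i\<in>I. (\<Sum>a\<in>A. x a * p a i) * cnj (u i)) = (\<Sum>a\<in>A. x a * (\<Sum>i\<in>I. p a i * cnj (u i)))"
    unfolding sum_distrib_left sum_distrib_right by (subst sum.swap) (simp add: mult_ac)
  have 3: "(\<Sum>i\<in>I. u i * cnj (\<Sum>b\<in>B. y b * q b i)) = (\<Sum>b\<in>B. cnj (y b) * (\<Sum>i\<in>I. u i * cnj (q b i)))"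
    unfolding cnj_sum sum_distrib_left by (subst sum.swap) (simp add: mult_ac)
  have 4: "(\<Sum>a\<in>A. \<Sum>b\<in>B. x a * cnj (y b) * P a b) / s - (\<Sum>a\<in>A. x a * C a) * (\<Sum>b\<in>B. cnj (y b) * D b) / t =
      (\<Sum>a\<in>A. \<Sum>b\<in>B. x a * (P a b / s - C a * D b / t) * cnj (y b))" for P C D s t
    by (simp add: sum_product sum_divide_distrib sum_subtractf left_diff_distrib right_diff_distrib mult_ac)
  show ?thesis unfolding levi_def 1 2 3 4 ..
qed

text \<open>\<open>a * u\<close> is the orthogonal projection of \<open>p\<close> to the line
  spanned by \<open>u\<close>; the squared length of the remainder is left.\<close>

lemma levi_self:
  fixes u p :: "'i \<Rightarrow> complex"
  assumes S: "(\<Sum>i\<in>I. u i * cnj (u i)) \<noteq> 0"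
  defines "a \<equiv> (\<Sum>i\<in>I. p i * cnj (u i)) / (\<Sum>i\<in>I. u i * cnj (u i))"
  shows "levi I u p p = (\<Sum>i\<in>I. (p i - a * u i) * cnj (p i - a * u i)) / (\<Sum>i\<in>I. u i * cnj (u i))"
proof -
  define P where "P = (\<Sum>i\<in>I. p i * cnj (p i))"
  define A where "A = (\<Sum>i\<in>I. p i * cnj (u i))"
  define S where "S = (\<Sum>i\<in>I. u i * cnj (u i))"
  have cA: "(\<Sum>i\<in>I. u i * cnj (p i)) = cnj A" by (simp add: A_def mult_ac)
  have cS: "cnj S = S" by (simp add: S_def mult_ac)
  have S0: "S \<noteq> 0" using S by (simp add: S_def)
  have "(\<Sum>i\<in>I. (p i - a * u i) * cnj (p i - a * u i)) = P - cnj a * A - a * cnj A + a * cnj a * S"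
    unfolding cA[symmetric]
    by (simp add: P_def A_def S_def sum_distrib_left sum.distrib[symmetric] sum_subtractf[symmetric] algebra_simps)
  then show ?thesis
    unfolding levi_def cA P_def[symmetric] A_def[symmetric] S_def[symmetric]
    using S0 by (simp add: a_def A_def[symmetric] S_def[symmetric] cS field_simps power2_eq_square)
qed

text \<open>The condition on \<open>p\<close> is the one by which
  \<open>projective_embedding\<close> expresses immersivity.\<close>

lemma levi_pos:
  assumes I: "finite I" and u: "\<exists>i\<in>I. u i \<noteq> 0" and p: "\<nexists>a. \<forall>i\<in>I. p i = a * u i"
  shows "Re (levi I u p p) > 0"
proof -
  have S: "(\<Sum>i\<in>I. (cmod (u i))\<^sup>2) > 0" by (rule sum_norm_square_pos[OF I u])
  define a where "a = (\<Sum>i\<in>I. p i * cnj (u i)) / (\<Sum>i\<in>I. u i * cnj (u i))"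
  have "\<exists>i\<in>I. p i - a * u i \<noteq> 0" using p by auto
  from sum_norm_square_pos[OF I this]
  have "(\<Sum>i\<in>I. (cmod (p i - a * u i))\<^sup>2) > 0" .
  moreover have "levi I u p p = of_real ((\<Sum>i\<in>I. (cmod (p i - a * u i))\<^sup>2) / (\<Sum>i\<in>I. (cmod (u i))\<^sup>2))"
    unfolding of_real_divide sum_mult_cnj[symmetric] a_def
    by (rule levi_self[OF sum_mult_cnj_nonzero[OF I u]])
  ultimately show ?thesis using S by simp
qed

text \<open>\<open>G\<close> is not assumed differentiable. Instead the identity
  \<open>u i * w i0 = u i0 * w i\<close> is differentiated, and division by \<open>w i0 z\<close>
  yields a correction \<open>g\<close> common to all \<open>i\<close>.\<close>

lemma derivative_multiple:
  fixes u w :: "'i \<Rightarrow> 'a::real_normed_vector \<Rightarrow> complex"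
  assumes u: "\<And>i. i \<in> I \<Longrightarrow> (u i has_derivative U i) (at z)"
    and w: "\<And>i. i \<in> I \<Longrightarrow> (w i has_derivative W i) (at z)"
    and S: "open S" "z \<in> S" and G: "\<And>y i. y \<in> S \<Longrightarrow> i \<in> I \<Longrightarrow> u i y = G y * w i y"
    and i0: "i0 \<in> I" "w i0 z \<noteq> 0"
  shows "\<exists>g. \<forall>i\<in>I. \<forall>v. U i v = G z * W i v + g v * w i z"
proof (intro exI ballI allI)
  fix i v assume i: "i \<in> I"
  have "((\<lambda>y. u i y * w i0 y - u i0 y * w i y) has_derivative
      (\<lambda>v. (u i z * W i0 v + U i v * w i0 z) - (u i0 z * W i v + U i0 v * w i z))) (at z)"
    by (intro has_derivative_diff has_derivative_mult u w i i0)
  moreover have "((\<lambda>y. u i y * w i0 y - u i0 y * w i y) has_derivative (\<lambda>v. 0)) (at z)"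
    by (rule has_derivative_transform_within_open[OF has_derivative_const[of 0] S]) (use G i i0 in auto)
  ultimately have "(u i z * W i0 v + U i v * w i0 z) - (u i0 z * W i v + U i0 v * w i z) = 0"
    by (rule fun_cong[OF has_derivative_unique])
  then show "U i v = G z * W i v + ((U i0 v - G z * W i0 v) / w i0 z) * w i z"
    using i0 G[OF S(2) i] G[OF S(2) i0(1)] by (simp add: field_simps)
qed

text \<open>Used for a change of frame and for the lift of an automorphism; in both cases the common
  factor is given pointwise by values of a trivialization.\<close>

lemma levi_eq_multiple:
  fixes u w :: "'i \<Rightarrow> 'a::real_normed_vector \<Rightarrow> complex"
  assumes I: "finite I" and u: "\<And>i. i \<in> I \<Longrightarrow> (u i has_derivative U i) (at z)"
    and w: "\<And>i. i \<in> I \<Longrightarrow> (w i has_derivative W i) (at z)"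
    and S: "open S" "z \<in> S" and G: "\<And>y i. y \<in> S \<Longrightarrow> i \<in> I \<Longrightarrow> u i y = G y * w i y"
    and u0: "\<exists>i\<in>I. u i z \<noteq> 0"
  shows "levi I (\<lambda>i. u i z) (\<lambda>i. U i a) (\<lambda>i. U i b) = levi I (\<lambda>i. w i z) (\<lambda>i. W i a) (\<lambda>i. W i b)"
proof -
  obtain i0 where i0: "i0 \<in> I" "w i0 z \<noteq> 0" and G0: "G z \<noteq> 0" using u0 G[OF S(2)] by fastforce
  obtain g where g: "\<And>i v. i \<in> I \<Longrightarrow> U i v = G z * W i v + g v * w i z"
    using derivative_multiple[where u = u and w = w and U = U and W = W and G = G, OF u w S G i0] by blast
  have "levi I (\<lambda>i. u i z) (\<lambda>i. U i a) (\<lambda>i. U i b) =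
     levi I (\<lambda>i. G z * w i z) (\<lambda>i. G z * W i a + g a * w i z) (\<lambda>i. G z * W i b + g b * w i z)"
    by (rule levi_cong) (auto simp: g G S)
  also have "\<dots> = levi I (\<lambda>i. w i z) (\<lambda>i. W i a) (\<lambda>i. W i b)"
    using i0 by (intro levi_multiple[OF G0] sum_mult_cnj_nonzero[OF I]) auto
  finally show ?thesis .
qed

text \<open>With \<open>q\<close> the derivatives of \<open>f\<close> the quotient is the
  antiholomorphic derivative of the logarithm of the sum of squares. Real derivatives on any normed
  space are allowed, because the rule serves both in several coordinates and on a complex
  line.\<close>

lemma has_derivative_dlog:
  fixes f q :: "'i \<Rightarrow> 'a::real_normed_vector \<Rightarrow> complex"
  assumes f: "\<And>i. i \<in> I \<Longrightarrow> (f i has_derivative F i) (at z)"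
    and q: "\<And>i. i \<in> I \<Longrightarrow> (q i has_derivative Q i) (at z)"
    and S: "(\<Sum>i\<in>I. f i z * cnj (f i z)) \<noteq> 0"
  shows "((\<lambda>y. (\<Sum>i\<in>I. f i y * cnj (q i y)) / (\<Sum>i\<in>I. f i y * cnj (f i y))) has_derivative
    (\<lambda>v. (\<Sum>i\<in>I. F i v * cnj (q i z) + f i z * cnj (Q i v)) / (\<Sum>i\<in>I. f i z * cnj (f i z)) -
      (\<Sum>i\<in>I. f i z * cnj (q i z)) * (\<Sum>i\<in>I. F i v * cnj (f i z) + f i z * cnj (F i v)) /
        (\<Sum>i\<in>I. f i z * cnj (f i z))\<^sup>2)) (at z)"
proof -
  have 1: "((\<lambda>y. \<Sum>i\<in>I. f i y * cnj (g i y)) has_derivative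
      (\<lambda>v. \<Sum>i\<in>I. f i z * cnj (G i v) + F i v * cnj (g i z))) (at z)"
    if "\<And>i. i \<in> I \<Longrightarrow> (g i has_derivative G i) (at z)" for g G
    by (intro has_derivative_sum has_derivative_mult f
        bounded_linear.has_derivative[OF bounded_linear_cnj] that)
  show ?thesis
    by (rule has_derivative_eq_rhs[OF has_derivative_divide'[OF 1[OF q] 1[OF f] S]])
      (use S in \<open>auto simp: fun_eq_iff diff_divide_distrib power2_eq_square add.commute\<close>)
qed

lemma has_derivative_ln_sum_norm_square:
  fixes f :: "'i \<Rightarrow> 'a::real_normed_vector \<Rightarrow> complex"
  assumes f: "\<And>i. i \<in> I \<Longrightarrow> (f i has_derivative F i) (at z)"
    and I: "finite I" and nz: "\<exists>i\<in>I. f i z \<noteq> 0"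
  shows "((\<lambda>y. ln (\<Sum>i\<in>I. (cmod (f i y))\<^sup>2)) has_derivative
    (\<lambda>v. 2 * Re ((\<Sum>i\<in>I. F i v * cnj (f i z)) / (\<Sum>i\<in>I. f i z * cnj (f i z))))) (at z)"
proof -
  define S where "S = (\<Sum>i\<in>I. (cmod (f i z))\<^sup>2)"
  have S: "S > 0" unfolding S_def by (rule sum_norm_square_pos[OF I nz])
  have "((\<lambda>y. \<Sum>i\<in>I. f i y * cnj (f i y)) has_derivative
      (\<lambda>v. \<Sum>i\<in>I. f i z * cnj (F i v) + F i v * cnj (f i z))) (at z)"
    by (intro has_derivative_sum has_derivative_mult f bounded_linear.has_derivative[OF bounded_linear_cnj])
  from bounded_linear.has_derivative[OF bounded_linear_Re this]
  have d: "((\<lambda>y. \<Sum>i\<in>I. (cmod (f i y))\<^sup>2) has_derivative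
      (\<lambda>v. Re (\<Sum>i\<in>I. f i z * cnj (F i v) + F i v * cnj (f i z)))) (at z)"
    unfolding sum_mult_cnj Re_complex_of_real .
  have "((\<lambda>y. ln (\<Sum>i\<in>I. (cmod (f i y))\<^sup>2)) has_derivative
      (\<lambda>v. Re (\<Sum>i\<in>I. f i z * cnj (F i v) + F i v * cnj (f i z)) * inverse S)) (at z)"
    using has_derivative_ln[OF _ d] S unfolding S_def[symmetric] by simp
  moreover have "Re (\<Sum>i\<in>I. f i z * cnj (F i v) + F i v * cnj (f i z)) * inverse S =
      2 * Re ((\<Sum>i\<in>I. F i v * cnj (f i z)) / (\<Sum>i\<in>I. f i z * cnj (f i z)))" for v
  proof -
    have "(\<Sum>i\<in>I. f i z * cnj (F i v) + F i v * cnj (f i z)) =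
        cnj (\<Sum>i\<in>I. F i v * cnj (f i z)) + (\<Sum>i\<in>I. F i v * cnj (f i z))"
      by (simp add: sum.distrib mult.commute)
    then show ?thesis
      unfolding sum_mult_cnj S_def[symmetric] Re_divide_of_real by (simp add: divide_inverse del: Re_sum cnj_sum)
  qed
  ultimately show ?thesis by simp
qed

lemma axis_imaginary: "axis j \<i> = \<i> *s axis j (1::complex)"
  by (simp add: vec_eq_iff axis_def)

text \<open>The real derivative is twice the real part of a complex linear map; the Wirtinger
  combination keeps its conjugate linear half.\<close>

lemma d_zbar_ln:
  fixes f :: "'i \<Rightarrow> complex^'n \<Rightarrow> complex"
  assumes S: "open S" "z \<in> S" and I: "finite I" and f: "\<And>i. i \<in> I \<Longrightarrow> holo_fun_on S (f i)"
    and nz: "\<exists>i\<in>I. f i z \<noteq> 0"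
    and u: "\<And>w. w \<in> S \<Longrightarrow> u w = ln (\<Sum>i\<in>I. (cmod (f i w))\<^sup>2)"
  shows "d_zbar k (\<lambda>w. complex_of_real (u w)) z =
    (\<Sum>i\<in>I. f i z * cnj (frechet_derivative (f i) (at z) (axis k 1))) / (\<Sum>i\<in>I. f i z * cnj (f i z))"
proof -
  let ?F = "\<lambda>i. frechet_derivative (f i) (at z)"
  define S0 where "S0 = (\<Sum>i\<in>I. (cmod (f i z))\<^sup>2)"
  have S0: "S0 > 0" unfolding S0_def by (rule sum_norm_square_pos[OF I nz])
  define A where "A v = (\<Sum>i\<in>I. ?F i v * cnj (f i z))" for v
  have "(u has_derivative (\<lambda>v. 2 * Re (A v / of_real S0))) (at z)"
    by (rule has_derivative_transform_within_open[OF has_derivative_ln_sum_norm_square[where I = I and f = f and F = ?F, OF _ I nz,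
      unfolded sum_mult_cnj, folded S0_def A_def] S])
      (use f S u in \<open>auto intro: holo_fun_on_has_derivative\<close>)
  from has_derivative_of_real[OF this]
  have d: "frechet_derivative (\<lambda>w. complex_of_real (u w)) (at z) = (\<lambda>v. of_real (2 * Re (A v / of_real S0)))"
    by (rule frechet_derivative_at[symmetric])
  have A: "A (\<i> *s v) = \<i> * A v" for v
    unfolding A_def sum_distrib_left
    by (rule sum.cong[OF refl]) (simp add: holo_fun_on_derivative_scale[OF f S(2)])
  have cA: "(\<Sum>i\<in>I. f i z * cnj (?F i (axis k 1))) = cnj (A (axis k 1))"
    by (simp add: A_def mult_ac)
  show ?thesis
    unfolding d_zbar_def d axis_imaginary A cA sum_mult_cnj S0_def[symmetric]
    by (simp add: complex_eq_iff)
qed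

text \<open>Second derivatives enter the derivative of \<open>d_zbar\<close> only through
  conjugates, and \<open>d_z\<close> removes conjugate linear terms. Hence the result contains first
  derivatives only, although differentiability of \<open>q\<close>, from
  \<open>holo_fun_on_derivative\<close>, is needed to get there.\<close>

lemma d_z_d_zbar_ln:
  fixes f :: "'i \<Rightarrow> complex^'n \<Rightarrow> complex"
  assumes S: "open S" "z \<in> S" and I: "finite I" and f: "\<And>i. i \<in> I \<Longrightarrow> holo_fun_on S (f i)"
    and nz: "\<And>w. w \<in> S \<Longrightarrow> \<exists>i\<in>I. f i w \<noteq> 0"
    and u: "\<And>w. w \<in> S \<Longrightarrow> u w = ln (\<Sum>i\<in>I. (cmod (f i w))\<^sup>2)"
  shows "d_z j (d_zbar k (\<lambda>w. complex_of_real (u w))) z =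
    levi I (\<lambda>i. f i z) (\<lambda>i. frechet_derivative (f i) (at z) (axis j 1))
      (\<lambda>i. frechet_derivative (f i) (at z) (axis k 1))"
proof -
  define q where "q i w = frechet_derivative (f i) (at w) (axis k 1)" for i w
  have q: "holo_fun_on S (q i)" if "i \<in> I" for i
    unfolding q_def by (rule holo_fun_on_derivative[OF f[OF that] S(1)])
  let ?F = "\<lambda>i. frechet_derivative (f i) (at z)" and ?Q = "\<lambda>i. frechet_derivative (q i) (at z)"
  define S0 where "S0 = (\<Sum>i\<in>I. f i z * cnj (f i z))"
  have "S0 \<noteq> 0" unfolding S0_def by (rule sum_mult_cnj_nonzero[OF I nz[OF S(2)]])
  then have "((\<lambda>y. (\<Sum>i\<in>I. f i y * cnj (q i y)) / (\<Sum>i\<in>I. f i y * cnj (f i y))) has_derivative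
    (\<lambda>v. (\<Sum>i\<in>I. ?F i v * cnj (q i z) + f i z * cnj (?Q i v)) / S0 -
      (\<Sum>i\<in>I. f i z * cnj (q i z)) * (\<Sum>i\<in>I. ?F i v * cnj (f i z) + f i z * cnj (?F i v)) / S0\<^sup>2)) (at z)"
    unfolding S0_def
    by (intro has_derivative_dlog holo_fun_on_has_derivative[OF f S(2)] holo_fun_on_has_derivative[OF q S(2)])
  then have "(d_zbar k (\<lambda>w. complex_of_real (u w)) has_derivative
    (\<lambda>v. (\<Sum>i\<in>I. ?F i v * cnj (q i z) + f i z * cnj (?Q i v)) / S0 -
      (\<Sum>i\<in>I. f i z * cnj (q i z)) * (\<Sum>i\<in>I. ?F i v * cnj (f i z) + f i z * cnj (?F i v)) / S0\<^sup>2)) (at z)"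
    by (rule has_derivative_transform_within_open[OF _ S])
      (simp add: q_def d_zbar_ln[OF S(1) _ I f nz u])
  then have d: "frechet_derivative (d_zbar k (\<lambda>w. complex_of_real (u w))) (at z) =
    (\<lambda>v. ((\<Sum>i\<in>I. ?F i v * cnj (q i z)) + (\<Sum>i\<in>I. f i z * cnj (?Q i v))) / S0 -
      (\<Sum>i\<in>I. f i z * cnj (q i z)) * ((\<Sum>i\<in>I. ?F i v * cnj (f i z)) + (\<Sum>i\<in>I. f i z * cnj (?F i v))) / S0\<^sup>2)"
    unfolding sum.distrib by (rule frechet_derivative_at[symmetric])
  have i1: "(\<Sum>i\<in>I. ?F i (\<i> *s v) * c i) = \<i> * (\<Sum>i\<in>I. ?F i v * c i)" for c v
    unfolding sum_distrib_left
    by (rule sum.cong[OF refl]) (simp add: holo_fun_on_derivative_scale[OF f S(2)])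
  have i2: "(\<Sum>i\<in>I. c i * cnj (?F i (\<i> *s v))) = - \<i> * (\<Sum>i\<in>I. c i * cnj (?F i v))" for c v
    unfolding sum_distrib_left
    by (rule sum.cong[OF refl]) (simp add: holo_fun_on_derivative_scale[OF f S(2)])
  have i3: "(\<Sum>i\<in>I. c i * cnj (?Q i (\<i> *s v))) = - \<i> * (\<Sum>i\<in>I. c i * cnj (?Q i v))" for c v
    unfolding sum_distrib_left
    by (rule sum.cong[OF refl]) (simp add: holo_fun_on_derivative_scale[OF q S(2)])
  have alg: "((a + b) / s - c * (d + e) / s\<^sup>2 - \<i> * ((\<i> * a + - \<i> * b) / s - c * (\<i> * d + - \<i> * e) / s\<^sup>2)) / 2
      = a / s - d * c / s\<^sup>2" for a b c d e s :: complex
    by (simp add: add_divide_distrib diff_divide_distrib algebra_simps)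
  show ?thesis
    unfolding d_z_def d axis_imaginary i1 i2 i3 alg levi_def S0_def by (simp add: q_def)
qed

section \<open>Sections and Fubini--Study forms on a polarized manifold\<close>

locale polarized_manifold =
  fixes M :: "('x::t2_space, 'l, 'n::finite) polarized" and k :: nat
  assumes manifold: "compact_complex_manifold M" and line_bundle: "holo_line_bundle M"
    and ample: "very_ample M k"
begin

lemma atlas_cover: "\<exists>c\<in>atlas M. x \<in> fst c"
  using manifold unfolding compact_complex_manifold_def by blast

lemma chart_open: "c \<in> atlas M \<Longrightarrow> open (fst c)" "c \<in> atlas M \<Longrightarrow> open (snd c ` fst c)"
  and chart_homeomorphism: "c \<in> atlas M \<Longrightarrow> homeomorphism (fst c) (snd c ` fst c) (snd c) (chart_inv c)"
  using manifold unfolding compact_complex_manifold_def by blast+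

lemma chart_inv_left: "c \<in> atlas M \<Longrightarrow> x \<in> fst c \<Longrightarrow> chart_inv c (snd c x) = x"
  using chart_homeomorphism unfolding homeomorphism_def by blast

lemma chart_image_open:
  assumes c: "c \<in> atlas M" and U: "open U"
  shows "open (snd c ` (U \<inter> fst c))"
proof -
  have "open (snd c ` fst c \<inter> chart_inv c -` U)"
    using chart_homeomorphism[OF c] chart_open(2)[OF c] U
    unfolding homeomorphism_def by (metis continuous_on_open_vimage inf_commute)
  moreover have "snd c ` fst c \<inter> chart_inv c -` U = snd c ` (U \<inter> fst c)"
    using chart_inv_left[OF c] by (auto simp del: inv_into_f_f)
  ultimately show ?thesis by simp
qed

lemma chart_image_inv:
  assumes "c \<in> atlas M" "z \<in> snd c ` (U \<inter> fst c)"
  shows "chart_inv c z \<in> U" "chart_inv c z \<in> fst c"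
  using assms chart_inv_left by auto

lemma chart_at: "chart_at M x \<in> atlas M" "x \<in> fst (chart_at M x)"
  using someI_ex[of "\<lambda>c. c \<in> atlas M \<and> x \<in> fst c"] atlas_cover unfolding chart_at_def by blast+

lemma triv_cover: "\<exists>t\<in>trivs M. x \<in> fst t"
  using line_bundle unfolding holo_line_bundle_def by blast

lemma triv_open: "t \<in> trivs M \<Longrightarrow> open (fst t)"
  using line_bundle unfolding holo_line_bundle_def by blast

lemma triv_at: "triv_at M x \<in> trivs M" "x \<in> fst (triv_at M x)"
  using someI_ex[of "\<lambda>t. t \<in> trivs M \<and> x \<in> fst t"] triv_cover unfolding triv_at_def by blast+

lemma triv_bij: "t \<in> trivs M \<Longrightarrow> x \<in> fst t \<Longrightarrow> bij_betw (snd t) (proj M -` {x}) UNIV"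
  using line_bundle unfolding holo_line_bundle_def by blast

lemma triv_change:
  assumes "t \<in> trivs M" "u \<in> trivs M" "proj M v \<in> fst t" "proj M v \<in> fst u"
  shows "snd t v \<noteq> 0 \<Longrightarrow> snd u v \<noteq> 0"
  using assms line_bundle unfolding holo_line_bundle_def by (metis IntI mult_eq_0_iff)

lemma nonzero_iff:
  assumes "t \<in> trivs M" "proj M v \<in> fst t"
  shows "nonzero M v \<longleftrightarrow> snd t v \<noteq> 0"
  using assms triv_change unfolding nonzero_def by blast

lemma frame:
  assumes "t \<in> trivs M" "x \<in> fst t"
  shows "proj M (frame M t x) = x" "snd t (frame M t x) = 1" "nonzero M (frame M t x)"
proof -
  have "\<exists>!v. proj M v = x \<and> snd t v = 1"
  proof -
    have inj: "inj_on (snd t) (proj M -` {x})" and "1 \<in> snd t ` (proj M -` {x})"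
      using triv_bij[OF assms] unfolding bij_betw_def by auto
    then obtain v where v: "proj M v = x" "snd t v = 1" by auto
    show ?thesis
    proof (rule ex1I[of _ v])
      show "w = v" if "proj M w = x \<and> snd t w = 1" for w
        using that v by (intro inj_onD[OF inj]) auto
    qed (use v in simp)
  qed
  from theI'[OF this] show *: "proj M (frame M t x) = x" "snd t (frame M t x) = 1"
    unfolding frame_def by blast+
  show "nonzero M (frame M t x)" using nonzero_iff[OF assms(1)] * assms by simp
qed

lemma nonzero_over: "\<exists>v. nonzero M v \<and> proj M v = x"
  using triv_cover frame by metis

lemma H0_frame:
  assumes s: "s \<in> H0 M k" and t: "t \<in> trivs M" "proj M v \<in> fst t" and v: "nonzero M v"
  shows "s v = s (frame M t (proj M v)) / snd t v ^ k"
proof -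
  obtain g where g: "\<And>v. proj M v \<in> fst t \<Longrightarrow> snd t v \<noteq> 0 \<Longrightarrow> s v = g (proj M v) / snd t v ^ k"
    using s t unfolding H0_def by blast
  show ?thesis
    using g[of v] g[of "frame M t (proj M v)"] frame[OF t] t v nonzero_iff[OF t] by simp
qed

lemma H0_zero: "s \<in> H0 M k \<Longrightarrow> \<not> nonzero M v \<Longrightarrow> s v = 0"
  unfolding H0_def by blast

text \<open>The factor \<open>a\<close> is common to all sections, so every ratio built from
  sections depends on the base point only.\<close>

lemma H0_fibre:
  assumes v: "nonzero M v" and w: "nonzero M w" and vw: "proj M v = proj M w"
  shows "\<exists>a. a \<noteq> 0 \<and> (\<forall>s\<in>H0 M k. s v = a * s w)"
proof -
  obtain t where t: "t \<in> trivs M" "proj M v \<in> fst t" using triv_cover by blast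
  have t': "proj M w \<in> fst t" using t vw by simp
  have nz: "snd t v \<noteq> 0" "snd t w \<noteq> 0"
    using v w nonzero_iff[OF t(1) t(2)] nonzero_iff[OF t(1) t'] by auto
  show ?thesis
  proof (intro exI conjI ballI)
    show "(snd t w / snd t v) ^ k \<noteq> 0" using nz by simp
    show "s v = (snd t w / snd t v) ^ k * s w" if "s \<in> H0 M k" for s
      using H0_frame[OF that t v] H0_frame[OF that t(1) t' w] nz vw by (simp add: power_divide)
  qed
qed

lemma H0_local_holo:
  assumes s: "s \<in> H0 M k" and t: "t \<in> trivs M" and c: "c \<in> atlas M"
  shows "holo_fun_on (snd c ` (fst t \<inter> fst c)) (\<lambda>z. s (frame M t (chart_inv c z)))"
proof -
  obtain g where g: "holo_fun M (fst t) g"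
    "\<And>v. proj M v \<in> fst t \<Longrightarrow> snd t v \<noteq> 0 \<Longrightarrow> s v = g (proj M v) / snd t v ^ k"
    using s t unfolding H0_def by blast
  let ?S = "snd c ` (fst t \<inter> fst c)"
  have S: "open ?S" by (rule chart_image_open[OF c triv_open[OF t]])
  have eq: "(g \<circ> chart_inv c) z = s (frame M t (chart_inv c z))" if "z \<in> ?S" for z
    using g(2)[of "frame M t (chart_inv c z)"] frame[OF t chart_image_inv(1)[OF c that]]
      chart_image_inv(1)[OF c that] by (simp del: inv_into_f_f)
  have "holo_fun_on ?S (g \<circ> chart_inv c)" using g(1) c unfolding holo_fun_def by blast
  then show ?thesis
    unfolding holo_fun_on_def
    by (metis (no_types, lifting) has_derivative_transform_within_open[OF _ S] eq)
qed

lemma H0_subspace: "sec.subspace (H0 M k)"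
  using ample sec.subspace_span unfolding very_ample_def is_basis_def by metis

text \<open>Base point free families.\<close>

definition bpf_family :: "'i set \<Rightarrow> ('i \<Rightarrow> 'l \<Rightarrow> complex) \<Rightarrow> bool" where
  "bpf_family I s \<longleftrightarrow> finite I \<and> (\<forall>i\<in>I. s i \<in> H0 M k) \<and> (\<forall>v. nonzero M v \<longrightarrow> (\<exists>i\<in>I. s i v \<noteq> 0))"

lemma bpf_familyD:
  assumes "bpf_family I s"
  shows "finite I" "i \<in> I \<Longrightarrow> s i \<in> H0 M k" "nonzero M v \<Longrightarrow> \<exists>i\<in>I. s i v \<noteq> 0"
  using assms by (auto simp: bpf_family_def)

lemma bpf_family_sum_pos:
  assumes "bpf_family I s" "nonzero M v"
  shows "(\<Sum>i\<in>I. (cmod (s i v))\<^sup>2) > 0"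
  by (rule sum_norm_square_pos[OF bpf_familyD(1,3)[OF assms(1)]]) (rule assms)

end

locale metrized_manifold = polarized_manifold M k
  for M :: "('x::t2_space, 'l, 'n::finite) polarized" and k :: nat +
  fixes h0 :: "'l \<Rightarrow> real"
  assumes metric: "hermitian_metric M h0"
begin

lemma h0_pos: "nonzero M v \<Longrightarrow> h0 v > 0"
proof -
  assume v: "nonzero M v"
  obtain t where t: "t \<in> trivs M" "proj M v \<in> fst t" using triv_cover by blast
  then show "h0 v > 0"
    using metric v nonzero_iff[OF t] unfolding hermitian_metric_def by fastforce
qed

text \<open>The degree \<open>-k\<close> of each section cancels against \<open>h0 v ^ k\<close>,
  which scales by the k-th power of the squared modulus; this makes the choice of vector in
  \<open>pointwise\<close> immaterial.\<close>

lemma h0_fibre: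
  assumes v: "nonzero M v" and w: "nonzero M w" and vw: "proj M v = proj M w"
    and s: "s \<in> H0 M k" "s' \<in> H0 M k"
  shows "s v * cnj (s' v) * of_real (h0 v ^ k) = s w * cnj (s' w) * of_real (h0 w ^ k)"
proof -
  obtain t where t: "t \<in> trivs M" "proj M v \<in> fst t" using triv_cover by blast
  have t': "proj M w \<in> fst t" using t vw by simp
  have nz: "snd t v \<noteq> 0" "snd t w \<noteq> 0"
    using v w nonzero_iff[OF t(1) t(2)] nonzero_iff[OF t(1) t'] by auto
  obtain a where a: "\<And>v. proj M v \<in> fst t \<Longrightarrow> h0 v = a (proj M v) * (cmod (snd t v))\<^sup>2"
    using metric t unfolding hermitian_metric_def by metis
  have *: "s u * cnj (s' u) * of_real (h0 u ^ k) =
      s (frame M t (proj M u)) * cnj (s' (frame M t (proj M u))) * of_real (a (proj M u)) ^ k"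
    if u: "nonzero M u" "proj M u \<in> fst t" for u
  proof -
    have nz: "snd t u \<noteq> 0" using nonzero_iff[OF t(1)] u by simp
    have "of_real (h0 u ^ k) = of_real (a (proj M u)) ^ k * (snd t u ^ k * cnj (snd t u) ^ k)"
      unfolding a[OF u(2)] of_real_power of_real_mult complex_norm_square[unfolded of_real_power]
      by (simp add: power_mult_distrib)
    then show ?thesis
      using nz unfolding H0_frame[OF s(1) t(1) u(2) u(1)] H0_frame[OF s(2) t(1) u(2) u(1)]
      by simp
  qed
  show ?thesis using *[OF v t(2)] *[OF w t'] vw by simp
qed

lemma pointwise_eq:
  assumes v: "nonzero M v" and s: "s \<in> H0 M k" "s' \<in> H0 M k"
  shows "pointwise M (\<lambda>v. h0 v ^ k) s s' (proj M v) = s v * cnj (s' v) * of_real (h0 v ^ k)"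
proof -
  let ?v = "SOME w. nonzero M w \<and> proj M w = proj M v"
  have "nonzero M ?v \<and> proj M ?v = proj M v" by (rule someI[of _ v]) (simp add: v)
  then show ?thesis unfolding pointwise_def Let_def by (intro h0_fibre v s) auto
qed

lemma fs_potential_eq:
  assumes s: "bpf_family I s" and v: "nonzero M v"
  shows "fs_potential M k h0 I s (proj M v) = ln (h0 v ^ k * (\<Sum>i\<in>I. (cmod (s i v))\<^sup>2))"
proof -
  have "Re (pointwise M (\<lambda>v. h0 v ^ k) (s i) (s i) (proj M v)) = h0 v ^ k * (cmod (s i v))\<^sup>2" if "i \<in> I" for i
    unfolding pointwise_eq[OF v bpf_familyD(2)[OF s that] bpf_familyD(2)[OF s that]]
      complex_norm_square[symmetric] of_real_mult[symmetric] by simp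
  then show ?thesis unfolding fs_potential_def sum_distrib_left by simp
qed

lemma metric_of_fs_potential:
  assumes s: "bpf_family I s" and v: "nonzero M v"
  shows "metric_of M k h0 (fs_potential M k h0 I s) v = 1 / (\<Sum>i\<in>I. (cmod (s i v))\<^sup>2)"
  using bpf_family_sum_pos[OF s v] h0_pos[OF v]
  unfolding metric_of_def fs_potential_eq[OF s v] by (simp add: exp_minus field_simps)

text \<open>The background metric has dropped out, and the right-hand side is unchanged when
  \<open>v\<close> moves within its fibre.\<close>

lemma pointwise_fs:
  assumes f: "bpf_family I f" and v: "nonzero M v" and s: "s \<in> H0 M k" "s' \<in> H0 M k"
  shows "pointwise M (metric_of M k h0 (fs_potential M k h0 I f)) s s' (proj M v) =
    s v * cnj (s' v) / (\<Sum>i\<in>I. f i v * cnj (f i v))"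
proof -
  let ?w = "SOME w. nonzero M w \<and> proj M w = proj M v"
  have w: "nonzero M ?w \<and> proj M ?w = proj M v" by (rule someI[of _ v]) (simp add: v)
  obtain a where a: "a \<noteq> 0" "\<And>s. s \<in> H0 M k \<Longrightarrow> s ?w = a * s v"
    using H0_fibre[OF conjunct1[OF w] v conjunct2[OF w]] by blast
  have "(\<Sum>i\<in>I. f i ?w * cnj (f i ?w)) = a * cnj a * (\<Sum>i\<in>I. f i v * cnj (f i v))"
    unfolding sum_distrib_left
    by (rule sum.cong[OF refl]) (simp add: a(2)[OF bpf_familyD(2)[OF f]])
  then show ?thesis
    unfolding pointwise_def Let_def metric_of_fs_potential[OF f conjunct1[OF w]] of_real_divide of_real_1
      sum_mult_cnj[symmetric] a(2)[OF s(1)] a(2)[OF s(2)]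
    using a(1) by simp
qed

text \<open>The definition uses the frame selected by \<open>triv_at\<close> at each point; the
  freedom in \<open>t\<close> allows one frame to serve a whole neighbourhood, as continuity and
  restriction to lines require.\<close>

lemma omega_fs:
  assumes s: "bpf_family I s" and c: "c \<in> atlas M" "x \<in> fst c" and t: "t \<in> trivs M" "x \<in> fst t"
  defines "D \<equiv> \<lambda>i. frechet_derivative (\<lambda>z. s i (frame M t (chart_inv c z))) (at (snd c x))"
  shows "omega M k h0 (fs_potential M k h0 I s) c x $ j $ l =
    levi I (\<lambda>i. s i (frame M t x)) (\<lambda>i. D i (axis j 1)) (\<lambda>i. D i (axis l 1))"
proof -
  let ?t = "triv_at M x" and ?z = "snd c x"
  have t0: "?t \<in> trivs M" "x \<in> fst ?t" by (rule triv_at)+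
  let ?f = "\<lambda>t i z. s i (frame M t (chart_inv c z))"
  let ?S = "\<lambda>t. snd c ` (fst t \<inter> fst c)"
  have inv: "chart_inv c ?z = x" by (rule chart_inv_left[OF c])
  have S: "open (?S t)" "?z \<in> ?S t" if "t \<in> trivs M" "x \<in> fst t" for t
    using that c by (auto intro!: chart_image_open[OF c(1) triv_open])
  have holo: "holo_fun_on (?S t) (?f t i)" if "t \<in> trivs M" "i \<in> I" for t i
    using that c by (intro H0_local_holo bpf_familyD(2)[OF s])
  have der: "(?f t i has_derivative frechet_derivative (?f t i) (at ?z)) (at ?z)"
    if "t \<in> trivs M" "x \<in> fst t" "i \<in> I" for t i
    by (rule holo_fun_on_has_derivative[OF holo[OF that(1,3)] S(2)[OF that(1,2)]])
  have nz: "nonzero M (frame M t (chart_inv c w))" if "t \<in> trivs M" "w \<in> ?S t" for t w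
    by (rule frame(3)[OF that(1) chart_image_inv(1)[OF c(1) that(2)]])
  have "omega M k h0 (fs_potential M k h0 I s) c x $ j $ l =
    levi I (\<lambda>i. ?f ?t i ?z) (\<lambda>i. frechet_derivative (?f ?t i) (at ?z) (axis j 1))
      (\<lambda>i. frechet_derivative (?f ?t i) (at ?z) (axis l 1))"
    unfolding omega_def curvature_def i_ddbar_log_def vec_lambda_beta
  proof (rule d_z_d_zbar_ln[OF S[OF t0] bpf_familyD(1)[OF s] holo[OF t0(1)]])
    fix w assume w: "w \<in> ?S ?t"
    show "\<exists>i\<in>I. ?f ?t i w \<noteq> 0" by (rule bpf_familyD(3)[OF s nz[OF t0(1) w]])
    show "ln (inverse (metric_of M k h0 (fs_potential M k h0 I s) (frame M ?t (chart_inv c w)))) =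
       ln (\<Sum>i\<in>I. (cmod (?f ?t i w))\<^sup>2)"
      unfolding metric_of_fs_potential[OF s nz[OF t0(1) w]] by simp
  qed
  \<comment> \<open>The two frames differ by values of the trivialization \<open>t\<close>, whose
    k-th power is the common factor of all sections.\<close>
  also have "\<dots> = levi I (\<lambda>i. ?f t i ?z) (\<lambda>i. frechet_derivative (?f t i) (at ?z) (axis j 1))
      (\<lambda>i. frechet_derivative (?f t i) (at ?z) (axis l 1))"
  proof (rule levi_eq_multiple[where u = "?f ?t" and w = "?f t" and U = "\<lambda>i. frechet_derivative (?f ?t i) (at ?z)"
        and W = "\<lambda>i. frechet_derivative (?f t i) (at ?z)" and S = "?S ?t \<inter> ?S t"
        and G = "\<lambda>y. 1 / snd t (frame M ?t (chart_inv c y)) ^ k", OF bpf_familyD(1)[OF s]])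
    show "\<exists>i\<in>I. ?f ?t i ?z \<noteq> 0" by (rule bpf_familyD(3)[OF s nz[OF t0(1) S(2)[OF t0]]])
    fix y i assume y: "y \<in> ?S ?t \<inter> ?S t" and i: "i \<in> I"
    have "proj M (frame M ?t (chart_inv c y)) = chart_inv c y" "chart_inv c y \<in> fst t"
      using y frame(1)[OF t0(1)] chart_image_inv(1)[OF c(1)] by blast+
    then show "?f ?t i y = 1 / snd t (frame M ?t (chart_inv c y)) ^ k * ?f t i y"
      using H0_frame[OF bpf_familyD(2)[OF s i] t(1), of "frame M ?t (chart_inv c y)"] nz[OF t0(1)] y by simp
  qed (use der[OF t0] der[OF t] S[OF t0] S[OF t] in \<open>simp_all only: open_Int Int_iff simp_thms\<close>)
  finally show ?thesis unfolding D_def inv .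
qed

text \<open>\<open>F\<close> covers \<open>f\<close> on nonzero vectors and turns \<open>s\<close>
  into \<open>s'\<close> by composition. In local frames the coefficients of \<open>s'\<close> are
  those of \<open>s\<close> composed with \<open>f\<close>, up to a common factor which
  \<open>levi\<close> ignores; the chain rule and sesquilinearity then account for the Jacobian in
  \<open>pull_back\<close>.\<close>

lemma pull_back_omega_fs:
  assumes s: "bpf_family I s" and s': "bpf_family I s'" and f: "holo_self_map M f"
    and F: "\<And>v. nonzero M v \<Longrightarrow> nonzero M (F v) \<and> proj M (F v) = f (proj M v)"
      "\<And>v i. nonzero M v \<Longrightarrow> i \<in> I \<Longrightarrow> s' i v = s i (F v)"
  shows "form_eq M (pull_back M f (omega M k h0 (fs_potential M k h0 I s)))
     (omega M k h0 (fs_potential M k h0 I s'))"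
  unfolding form_eq_def
proof (intro ballI)
  fix c x assume c: "c \<in> atlas M" "x \<in> fst c"
  obtain t where t: "t \<in> trivs M" "x \<in> fst t" using triv_cover by blast
  obtain u where u: "u \<in> trivs M" "f x \<in> fst u" using triv_cover by blast
  define d where "d = chart_at M (f x)"
  have d: "d \<in> atlas M" "f x \<in> fst d" using chart_at unfolding d_def by blast+
  let ?z = "snd c x" and ?y = "snd d (f x)"
  define fc where "fc = snd d \<circ> f \<circ> chart_inv c"
  define D where "D = frechet_derivative fc (at ?z)"
  have invc: "chart_inv c ?z = x" and invd: "chart_inv d ?y = f x"
    using chart_inv_left c d by blast+
  have "holo_map_on (snd c ` (fst c \<inter> f -` fst d)) fc" using f c d unfolding holo_self_map_def fc_def by blast
  moreover have "?z \<in> snd c ` (fst c \<inter> f -` fst d)" using c d by auto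
  ultimately have D: "(fc has_derivative D) (at ?z)" "\<And>a v. D (a *s v) = a *s D v"
    unfolding holo_map_on_def D_def by (metis frechet_derivative_at)+
  have fcz: "fc ?z = ?y" by (simp add: fc_def invc[simplified])
  let ?w = "\<lambda>i y. s i (frame M u (chart_inv d y))" and ?u = "\<lambda>i z. s' i (frame M t (chart_inv c z))"
  define W where "W i = frechet_derivative (?w i) (at ?y)" for i
  define U where "U i = frechet_derivative (?u i) (at ?z)" for i
  have y: "?y \<in> snd d ` (fst u \<inter> fst d)" using d u by auto
  have z: "?z \<in> snd c ` (fst t \<inter> fst c)" using c t by auto
  have W: "(?w i has_derivative W i) (at ?y)" "\<And>a v. W i (a *s v) = a * W i v" if "i \<in> I" for i
    using holo_fun_on_has_derivative[OF H0_local_holo[OF bpf_familyD(2)[OF s that] u(1) d(1)] y]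
      holo_fun_on_derivative_scale[OF H0_local_holo[OF bpf_familyD(2)[OF s that] u(1) d(1)] y]
    unfolding W_def by blast+
  have U: "(?u i has_derivative U i) (at ?z)" if "i \<in> I" for i
    using holo_fun_on_has_derivative[OF H0_local_holo[OF bpf_familyD(2)[OF s' that] t(1) c(1)] z]
    unfolding U_def by blast
  have wfc: "((\<lambda>z. ?w i (fc z)) has_derivative (\<lambda>v. W i (D v))) (at ?z)" if "i \<in> I" for i
    using has_derivative_compose[OF D(1), of "?w i" "W i"] W(1)[OF that] by (simp only: fcz)
  have fcont: "continuous_on UNIV f" using f unfolding holo_self_map_def by blast
  \<comment> \<open>On this neighbourhood of \<open>x\<close> the frame at the source and both the
    frame and the chart at the image are available.\<close>
  define V where "V = fst t \<inter> f -` (fst u \<inter> fst d)"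
  have V: "open V" unfolding V_def using t u d
    by (intro open_Int triv_open open_vimage[OF _ fcont] chart_open)
  define S where "S = snd c ` (V \<inter> fst c)"
  have S: "open S" unfolding S_def by (rule chart_image_open[OF c(1) V])
  have zS: "?z \<in> S" unfolding S_def V_def using c t u d by auto
  have Sinv: "chart_inv c z \<in> V \<inter> fst c" if "z \<in> S" for z
    using that chart_image_inv[OF c(1)] unfolding S_def by blast
  have eq: "levi I (\<lambda>i. ?u i ?z) (\<lambda>i. U i a) (\<lambda>i. U i b) =
      levi I (\<lambda>i. ?w i ?y) (\<lambda>i. W i (D a)) (\<lambda>i. W i (D b))" for a b
    unfolding fcz[symmetric]
  proof (rule levi_eq_multiple[where u = ?u and w = "\<lambda>i z. ?w i (fc z)" and S = S
      and G = "\<lambda>z. 1 / snd u (F (frame M t (chart_inv c z))) ^ k", OF bpf_familyD(1)[OF s] U wfc S zS])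
    show "\<exists>i\<in>I. ?u i ?z \<noteq> 0"
      using bpf_familyD(3)[OF s' frame(3)[OF t]] by (simp only: invc)
    fix z i assume z: "z \<in> S" and i: "i \<in> I"
    let ?x = "chart_inv c z" and ?v = "F (frame M t (chart_inv c z))"
    have x: "?x \<in> V" using Sinv[OF z] by blast
    then have xt: "?x \<in> fst t" "f ?x \<in> fst u" "f ?x \<in> fst d" by (auto simp: V_def)
    have v: "nonzero M ?v" "proj M ?v = f ?x"
      using F(1)[OF frame(3)[OF t(1) xt(1)]] frame(1)[OF t(1) xt(1)] by auto
    have "s' i (frame M t ?x) = s i ?v" by (rule F(2)[OF frame(3)[OF t(1) xt(1)] i])
    also have "\<dots> = s i (frame M u (f ?x)) / snd u ?v ^ k"
      using H0_frame[OF bpf_familyD(2)[OF s i] u(1), of ?v] v xt by simp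
    also have "f ?x = chart_inv d (fc z)"
      unfolding fc_def comp_def by (rule chart_inv_left[OF d(1) xt(3), symmetric])
    finally show "?u i z = 1 / snd u ?v ^ k * ?w i (fc z)" by simp
  qed
  show "pull_back M f (omega M k h0 (fs_potential M k h0 I s)) c x =
     omega M k h0 (fs_potential M k h0 I s') c x"
    unfolding vec_eq_iff
  proof (intro allI)
    fix j l
    have Dj: "W i (D (axis j 1)) = (\<Sum>a\<in>UNIV. D (axis j 1) $ a * W i (axis a 1))" if "i \<in> I" for i j
    proof -
      have lin: "linear (W i)" using has_derivative_linear[OF W(1)[OF that]] .
      have "W i (D (axis j 1)) = W i (\<Sum>a\<in>UNIV. D (axis j 1) $ a *s axis a 1)"
        by (simp add: basis_expansion)
      also have "\<dots> = (\<Sum>a\<in>UNIV. D (axis j 1) $ a * W i (axis a 1))"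
        unfolding linear_sum[OF lin] by (simp add: W(2)[OF that])
      finally show ?thesis .
    qed
    have "pull_back M f (omega M k h0 (fs_potential M k h0 I s)) c x $ j $ l =
      (\<Sum>a\<in>UNIV. \<Sum>b\<in>UNIV. D (axis j 1) $ a * levi I (\<lambda>i. s i (frame M u (f x)))
        (\<lambda>i. W i (axis a 1)) (\<lambda>i. W i (axis b 1)) * cnj (D (axis l 1) $ b))"
      unfolding pull_back_def Let_def d_def[symmetric] fc_def[symmetric] D_def[symmetric] vec_lambda_beta
        omega_fs[OF s d u] W_def ..
    also have "\<dots> = levi I (\<lambda>i. ?w i ?y) (\<lambda>i. W i (D (axis j 1))) (\<lambda>i. W i (D (axis l 1)))"
      unfolding levi_sum[symmetric] invd
      by (rule levi_cong) (simp_all add: Dj)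
    also have "\<dots> = levi I (\<lambda>i. ?u i ?z) (\<lambda>i. U i (axis j 1)) (\<lambda>i. U i (axis l 1))"
      by (rule eq[symmetric])
    also have "\<dots> = omega M k h0 (fs_potential M k h0 I s') c x $ j $ l"
      unfolding omega_fs[OF s' c t] U_def invc ..
    finally show "pull_back M f (omega M k h0 (fs_potential M k h0 I s)) c x $ j $ l =
      omega M k h0 (fs_potential M k h0 I s') c x $ j $ l" .
  qed
qed

end

section \<open>Integration over a compact manifold\<close>

lemma det_cnj: "det (\<chi> i j. cnj (A $ i $ j)) = cnj (det A)" for A :: "complex^'n^'n"
  by (simp add: det_def)

text \<open>The segment from the identity to \<open>G\<close> consists of positive definite
  Hermitian matrices, whose determinants are real and nonzero. Starting at 1, the determinant cannot
  reach a non-positive value without a zero.\<close>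

lemma det_hermitian_pos:
  fixes G :: "complex^'n^'n"
  assumes herm: "\<And>j l. G $ l $ j = cnj (G $ j $ l)"
    and pos: "\<And>\<xi>. \<xi> \<noteq> 0 \<Longrightarrow> Re (\<Sum>j\<in>UNIV. \<Sum>l\<in>UNIV. G $ j $ l * \<xi> $ j * cnj (\<xi> $ l)) > 0"
  shows "Im (det G) = 0" "Re (det G) > 0"
proof -
  have real: "Im (det A) = 0" if "\<And>j l. A $ l $ j = cnj (A $ j $ l)" for A :: "complex^'n^'n"
  proof -
    have "(\<chi> i j. cnj (A $ i $ j)) = transpose A"
      by (simp add: vec_eq_iff transpose_def that[symmetric])
    with det_cnj[of A] have "cnj (det A) = det A" by (simp add: det_transpose)
    then show ?thesis by (metis cnj.simps(2) neg_equal_zero)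
  qed
  show "Im (det G) = 0" using real herm by blast
  define H where "H t = (\<chi> i j. of_real (1 - t) * (if i = j then 1 else 0) + of_real t * G $ i $ j)" for t :: real
  have Hherm: "H t $ l $ j = cnj (H t $ j $ l)" for t j l
    by (simp add: H_def herm[of l j])
  have nz: "det (H t) \<noteq> 0" if t: "0 \<le> t" "t \<le> 1" for t
  proof
    assume "det (H t) = 0"
    then have "\<not> inj ((*v) (H t))"
      using invertible_det_nz invertible_left_inverse matrix_left_invertible_injective by metis
    then obtain \<eta> where \<eta>: "H t *v \<eta> = 0" "\<eta> \<noteq> 0"
      by (metis (no_types, lifting) injI matrix_vector_mult_diff_distrib right_minus_eq)
    \<comment> \<open>The quadratic form pairs \<open>G $ j $ l\<close> with
      \<open>cnj (\<xi> $ l)\<close>, so a kernel vector of the matrix has to enter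
      conjugated.\<close>
    define \<xi> :: "complex^'n" where "\<xi> = (\<chi> i. cnj (\<eta> $ i))"
    have \<xi>: "\<xi> \<noteq> 0" using \<eta>(2) by (simp add: \<xi>_def vec_eq_iff)
    have "(\<Sum>j\<in>UNIV. \<Sum>l\<in>UNIV. H t $ j $ l * \<xi> $ j * cnj (\<xi> $ l)) = (\<Sum>j\<in>UNIV. \<xi> $ j * (H t *v \<eta>) $ j)"
      by (simp add: matrix_vector_mult_def sum_distrib_left \<xi>_def mult_ac)
    also have "\<dots> = 0" using \<eta>(1) by simp
    finally have 0: "(\<Sum>j\<in>UNIV. \<Sum>l\<in>UNIV. H t $ j $ l * \<xi> $ j * cnj (\<xi> $ l)) = 0" .
    have "(\<Sum>l\<in>UNIV. of_real (1 - t) * (if j = l then 1 else 0) * \<xi> $ j * cnj (\<xi> $ l)) =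
        of_real (1 - t) * (\<xi> $ j * cnj (\<xi> $ j))" for j
      by (subst sum.remove[of _ j]) (auto simp: sum.neutral)
    then have "(\<Sum>j\<in>UNIV. \<Sum>l\<in>UNIV. H t $ j $ l * \<xi> $ j * cnj (\<xi> $ l)) =
        of_real (1 - t) * (\<Sum>j\<in>UNIV. \<xi> $ j * cnj (\<xi> $ j)) +
        of_real t * (\<Sum>j\<in>UNIV. \<Sum>l\<in>UNIV. G $ j $ l * \<xi> $ j * cnj (\<xi> $ l))"
      by (simp add: H_def distrib_right sum.distrib sum_distrib_left mult.assoc)
    then have "(1 - t) * (\<Sum>j\<in>UNIV. (cmod (\<xi> $ j))\<^sup>2) +
        t * Re (\<Sum>j\<in>UNIV. \<Sum>l\<in>UNIV. G $ j $ l * \<xi> $ j * cnj (\<xi> $ l)) = 0"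
      unfolding 0 sum_mult_cnj of_real_mult[symmetric] complex_eq_iff plus_complex.sel Re_complex_of_real
      by (simp add: complex_eq_iff del: Re_sum)
    moreover have "(\<Sum>j\<in>UNIV. (cmod (\<xi> $ j))\<^sup>2) > 0"
      using \<xi> by (intro sum_norm_square_pos) (auto simp: vec_eq_iff)
    ultimately show False
      using pos[OF \<xi>] t by (smt (verit, best) mult_nonneg_nonneg mult_pos_pos)
  qed
  have cont: "continuous_on {0..1} (\<lambda>t. Re (det (H t)))"
    unfolding det_def H_def by (simp only: vec_lambda_beta) (intro continuous_intros)
  have H0: "det (H 0) = 1" and H1: "H 1 = G"
  proof -
    have "H 0 = mat 1" by (simp add: H_def mat_def vec_eq_iff)
    then show "det (H 0) = 1" by simp
    show "H 1 = G" by (simp add: H_def vec_eq_iff)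
  qed
  show "Re (det G) > 0"
  proof (rule ccontr)
    assume "\<not> Re (det G) > 0"
    then have "\<exists>t. 0 \<le> t \<and> t \<le> 1 \<and> Re (det (H t)) = 0"
      by (intro IVT2' cont) (auto simp: H0 H1)
    then obtain t where t: "0 \<le> t" "t \<le> 1" "Re (det (H t)) = 0" by blast
    have "Im (det (H t)) = 0" by (rule real) (rule Hherm)
    with t nz[of t] show False by (simp add: complex_eq_iff)
  qed
qed

lemma levi_cnj: "levi I u q p = cnj (levi I u p q)"
  by (simp add: levi_def mult_ac)

lemma AE_lborel_not_in_open:
  fixes U :: "'a::euclidean_space set"
  assumes "open U" "AE x in lborel. x \<notin> U"
  shows "U = {}"
proof (rule ccontr)
  assume "U \<noteq> {}"
  then obtain x e where xe: "e > 0" "ball x e \<subseteq> U" using \<open>open U\<close> by (metis equals0I openE)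
  have "AE y in lborel. y \<notin> ball x e" using assms(2) by eventually_elim (use xe in auto)
  then have "ball x e \<in> null_sets lborel" by (simp add: AE_iff_null_sets)
  then have "measure lborel (ball x e) = 0" by (simp add: measure_def null_setsD1)
  with content_ball_pos[OF xe(1), of x] show False by simp
qed

lemma set_integral_pos:
  fixes f :: "'a::euclidean_space \<Rightarrow> real"
  assumes f: "set_integrable lborel A f" and nonneg: "\<And>x. x \<in> A \<Longrightarrow> f x \<ge> 0"
    and U: "open U" "U \<noteq> {}" "U \<subseteq> A" and pos: "\<And>x. x \<in> U \<Longrightarrow> f x > 0"
  shows "(LINT x:A|lborel. f x) > 0"
proof -
  let ?g = "\<lambda>x. indicator A x *\<^sub>R f x"
  have g: "integrable lborel ?g" using f by (simp add: set_integrable_def)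
  have g0: "?g x \<ge> 0" for x using nonneg by (simp add: indicator_def)
  have "integral\<^sup>L lborel ?g \<noteq> 0"
  proof
    assume "integral\<^sup>L lborel ?g = 0"
    then have "AE x in lborel. ?g x = 0"
      using integral_nonneg_eq_0_iff_AE[OF g] g0 by simp
    then have "AE x in lborel. x \<notin> U"
      by eventually_elim (use U pos in \<open>force simp: indicator_def\<close>)
    with AE_lborel_not_in_open U show False by blast
  qed
  moreover have "integral\<^sup>L lborel ?g \<ge> 0" by (rule Bochner_Integration.integral_nonneg) (rule g0)
  ultimately show ?thesis unfolding set_lebesgue_integral_def by simp
qed

lemma continuous_on_locally:
  fixes f :: "'a::t2_space \<Rightarrow> 'b::topological_space"
  assumes "\<And>x. x \<in> A \<Longrightarrow> \<exists>S. open S \<and> x \<in> S \<and> continuous_on S f"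
  shows "continuous_on A f"
proof (rule continuous_at_imp_continuous_on, rule ballI)
  fix x assume "x \<in> A"
  then obtain S where "open S" "x \<in> S" "continuous_on S f" using assms by blast
  then show "isCont f x" using continuous_on_eq_continuous_at by blast
qed

section \<open>The chart cover and its Borel pieces\<close>

context polarized_manifold
begin

text \<open>Closed coordinate balls are compact, the open ones cover X, and finitely many suffice.
  This justifies the choice made by \<open>chart_cover\<close>.\<close>

lemma chart_cover_exists:
  "\<exists>cs. (\<forall>(c, K)\<in>set cs. c \<in> atlas M \<and> compact K \<and> K \<subseteq> fst c) \<and> (\<Union>(c, K)\<in>set cs. K) = UNIV"
proof -
  have "\<exists>c K W. c \<in> atlas M \<and> compact K \<and> K \<subseteq> fst c \<and> open W \<and> x \<in> W \<and> W \<subseteq> K" for x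
  proof -
    obtain c where c: "c \<in> atlas M" "x \<in> fst c" using atlas_cover by blast
    have hom: "homeomorphism (fst c) (snd c ` fst c) (snd c) (chart_inv c)" by (rule chart_homeomorphism[OF c(1)])
    obtain e where e: "e > 0" "cball (snd c x) e \<subseteq> snd c ` fst c"
      using chart_open(2)[OF c(1)] c(2) by (meson imageI open_contains_cball)
    define K where "K = chart_inv c ` cball (snd c x) e"
    define W where "W = fst c \<inter> snd c -` ball (snd c x) e"
    have K: "compact K" unfolding K_def
      by (rule compact_continuous_image[OF continuous_on_subset[OF _ e(2)]])
        (use homeomorphism_cont1[OF hom] homeomorphism_cont2[OF hom] in auto)
    have Kc: "K \<subseteq> fst c"
      using image_mono[OF e(2), of "chart_inv c"] homeomorphism_image2[OF hom] unfolding K_def by simp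
    have W: "open W" unfolding W_def
      by (rule continuous_open_preimage[OF _ chart_open(1)[OF c(1)]])
        (use homeomorphism_cont1[OF hom] homeomorphism_cont2[OF hom] in auto)
    have WK: "W \<subseteq> K"
    proof
      fix y assume y: "y \<in> W"
      then have "y = chart_inv c (snd c y)" "snd c y \<in> cball (snd c x) e"
        using chart_inv_left[OF c(1)] by (auto simp: W_def)
      then show "y \<in> K" unfolding K_def by blast
    qed
    have "x \<in> W" using c e by (simp add: W_def)
    with c K Kc W WK show ?thesis by blast
  qed
  then obtain c K W where ckw: "\<And>x. c x \<in> atlas M" "\<And>x. compact (K x)" "\<And>x. K x \<subseteq> fst (c x)"
    "\<And>x. open (W x)" "\<And>x. x \<in> W x" "\<And>x. W x \<subseteq> K x"
    by metis
  have "compact (UNIV :: 'x set)" using manifold unfolding compact_complex_manifold_def by blast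
  moreover have "UNIV \<subseteq> (\<Union>x\<in>UNIV. W x)" using ckw(5) by blast
  ultimately obtain C where C: "finite C" "UNIV \<subseteq> (\<Union>x\<in>C. W x)"
    by (rule compactE_image[OF _ ckw(4)])
  obtain xs where xs: "set xs = C" using finite_list C(1) by blast
  show ?thesis
  proof (intro exI[of _ "map (\<lambda>x. (c x, K x)) xs"] conjI)
    show "\<forall>(c, K)\<in>set (map (\<lambda>x. (c x, K x)) xs). c \<in> atlas M \<and> compact K \<and> K \<subseteq> fst c"
      using ckw by auto
    show "(\<Union>(c, K)\<in>set (map (\<lambda>x. (c x, K x)) xs). K) = UNIV"
      using C ckw(6) xs by auto blast
  qed
qed

lemma chart_cover:
  shows "i < length (chart_cover M) \<Longrightarrow> fst (chart_cover M ! i) \<in> atlas M"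
    "i < length (chart_cover M) \<Longrightarrow> compact (snd (chart_cover M ! i))"
    "i < length (chart_cover M) \<Longrightarrow> snd (chart_cover M ! i) \<subseteq> fst (fst (chart_cover M ! i))"
    "(\<Union>i<length (chart_cover M). snd (chart_cover M ! i)) = UNIV"
proof -
  have *: "(\<forall>(c, K)\<in>set (chart_cover M). c \<in> atlas M \<and> compact K \<and> K \<subseteq> fst c) \<and>
      (\<Union>(c, K)\<in>set (chart_cover M). K) = UNIV"
    unfolding chart_cover_def by (rule someI_ex[OF chart_cover_exists])
  show "i < length (chart_cover M) \<Longrightarrow> fst (chart_cover M ! i) \<in> atlas M"
    "i < length (chart_cover M) \<Longrightarrow> compact (snd (chart_cover M ! i))"
    "i < length (chart_cover M) \<Longrightarrow> snd (chart_cover M ! i) \<subseteq> fst (fst (chart_cover M ! i))"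
    using conjunct1[OF *] nth_mem[of i "chart_cover M"] by (force simp: case_prod_beta)+
  show "(\<Union>i<length (chart_cover M). snd (chart_cover M ! i)) = UNIV"
  proof (intro set_eqI iffI UNIV_I)
    fix x :: 'x
    have "x \<in> (\<Union>(c, K)\<in>set (chart_cover M). K)" unfolding conjunct2[OF *] by (rule UNIV_I)
    then obtain p where p: "p \<in> set (chart_cover M)" "x \<in> snd p" by (auto simp: case_prod_beta)
    then obtain i where "i < length (chart_cover M)" "chart_cover M ! i = p" unfolding in_set_conv_nth by blast
    with p show "x \<in> (\<Union>i<length (chart_cover M). snd (chart_cover M ! i))" by auto
  qed
qed

definition piece :: "nat \<Rightarrow> 'x set" where
  "piece i = snd (chart_cover M ! i) - (\<Union>j<i. snd (chart_cover M ! j))"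

definition piece_chart :: "nat \<Rightarrow> 'x set \<times> ('x \<Rightarrow> complex^'n)" where
  "piece_chart i = fst (chart_cover M ! i)"

lemma form_integral_pieces:
  "form_integral M \<omega> f = (\<Sum>i<length (chart_cover M). LINT z:snd (piece_chart i) ` piece i|lborel.
     2 ^ CARD('n) * det (\<omega> (piece_chart i) (chart_inv (piece_chart i) z)) * f (chart_inv (piece_chart i) z))"
  by (simp add: form_integral_def Let_def piece_def piece_chart_def)

lemma piece_chart:
  assumes "i < length (chart_cover M)"
  shows "piece_chart i \<in> atlas M" "piece i \<subseteq> fst (piece_chart i)"
  using chart_cover(1,3)[OF assms] unfolding piece_def piece_chart_def by auto

text \<open>A piece is a difference of compact sets. Injectivity of the chart carries this over to
  its image, which is therefore Borel; integrability is inherited from the compact set containing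
  it.\<close>

lemma set_integrable_piece:
  fixes g :: "complex^'n \<Rightarrow> 'b::{banach, second_countable_topology}"
  assumes i: "i < length (chart_cover M)"
    and g: "continuous_on (snd (piece_chart i) ` fst (piece_chart i)) g"
  shows "set_integrable lborel (snd (piece_chart i) ` piece i) g"
proof -
  let ?c = "piece_chart i" and ?K = "\<lambda>j. snd (chart_cover M ! j)"
  have K: "compact (?K j)" "closed (?K j)" if "j < length (chart_cover M)" for j
    using chart_cover(2)[OF that] compact_imp_closed by blast+
  have Kc: "?K i \<subseteq> fst ?c" using chart_cover(3)[OF i] by (simp add: piece_chart_def)
  have hom: "homeomorphism (fst ?c) (snd ?c ` fst ?c) (snd ?c) (chart_inv ?c)"
    by (rule chart_homeomorphism[OF piece_chart(1)[OF i]])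
  then have cont: "continuous_on (fst ?c) (snd ?c)" by (simp add: homeomorphism_def)
  have inj: "inj_on (snd ?c) (fst ?c)"
    by (rule inj_on_inverseI[of _ "chart_inv ?c"]) (rule chart_inv_left[OF piece_chart(1)[OF i]])
  have img: "compact (snd ?c ` L)" if "compact L" "L \<subseteq> ?K i" for L
    using that Kc by (intro compact_continuous_image continuous_on_subset[OF cont]) auto
  have "snd ?c ` piece i = snd ?c ` ?K i - snd ?c ` (?K i \<inter> (\<Union>j<i. ?K j))"
    using inj_on_image_set_diff[OF inj, of "?K i" "?K i \<inter> (\<Union>j<i. ?K j)"] Kc
    unfolding piece_def by (auto simp: Diff_Int)
  moreover have "compact (?K i \<inter> (\<Union>j<i. ?K j))"
    using i K by (intro compact_Int_closed) (auto intro!: closed_UN)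
  ultimately have m: "snd ?c ` piece i \<in> sets lborel"
    using img[of "?K i"] img[of "?K i \<inter> (\<Union>j<i. ?K j)"] K(1)[OF i]
    by (simp add: sets.Diff borel_compact)
  have "set_integrable lborel (snd ?c ` ?K i) g"
    unfolding set_integrable_def
    by (rule borel_integrable_compact[OF img[OF K(1)[OF i] order_refl] continuous_on_subset[OF g image_mono[OF Kc]]])
  then show ?thesis
    by (rule set_integrable_subset[OF _ m]) (auto simp: piece_def)
qed

text \<open>A piece may have empty interior, so strict positivity of an integral needs one that
  contains an open part of \<open>U\<close>. With \<open>m\<close> least such that the first
  \<open>m\<close> compact sets cover \<open>U\<close>, removing the earlier \<open>m - 1\<close>
  closed sets leaves a nonempty open set inside the last piece.\<close>

lemma open_meets_piece:
  assumes U: "open U" "U \<noteq> {}"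
  shows "\<exists>i<length (chart_cover M). \<exists>W. open W \<and> W \<noteq> {} \<and> W \<subseteq> U \<inter> piece i"
proof -
  let ?K = "\<lambda>j. snd (chart_cover M ! j)" and ?n = "length (chart_cover M)"
  define m where "m = (LEAST m. U \<subseteq> (\<Union>j<m. ?K j))"
  have ex: "U \<subseteq> (\<Union>j<?n. ?K j)" using chart_cover(4) by blast
  have m: "U \<subseteq> (\<Union>j<m. ?K j)" unfolding m_def by (rule LeastI[of _ ?n]) (rule ex)
  have mn: "m \<le> ?n" unfolding m_def by (rule Least_le) (rule ex)
  have "m \<noteq> 0" using m U(2) by auto
  then obtain i where i: "m = Suc i" by (cases m) auto
  have "\<not> U \<subseteq> (\<Union>j<i. ?K j)" using not_less_Least[of i "\<lambda>m. U \<subseteq> (\<Union>j<m. ?K j)"] i unfolding m_def by simp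
  moreover have "closed (\<Union>j<i. ?K j)"
    using mn i by (intro closed_UN) (auto intro!: compact_imp_closed chart_cover(2))
  moreover have "U - (\<Union>j<i. ?K j) \<subseteq> piece i"
    using m unfolding i piece_def lessThan_Suc by blast
  ultimately show ?thesis using mn i U(1)
    by (intro exI[of _ i] conjI exI[of _ "U - (\<Union>j<i. ?K j)"] open_Diff) auto
qed

end

section \<open>Hermitian forms and orthonormal bases\<close>

lemma sum_fun_apply: "sum f A x = (\<Sum>a\<in>A. f a x)"
  by (induction A rule: infinite_finite_induct) (auto simp: zero_fun_def plus_fun_def)

lemma subspace_lincomb:
  assumes V: "sec.subspace V" and t: "\<And>i. i \<in> I \<Longrightarrow> t i \<in> V"
  shows "(\<lambda>v. \<Sum>i\<in>I. c i * t i v) \<in> V"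
proof -
  have "(\<Sum>i\<in>I. (\<lambda>v. c i * t i v)) \<in> V"
    by (intro sec.subspace_sum[OF V] sec.subspace_scale[OF V] t)
  also have "(\<Sum>i\<in>I. (\<lambda>v. c i * t i v)) = (\<lambda>v. \<Sum>i\<in>I. c i * t i v)"
    by (simp add: fun_eq_iff sum_fun_apply)
  finally show ?thesis .
qed

lemma independent_family_zero:
  assumes inj: "inj_on t I" and ind: "sec.independent (t ` I)" and I: "finite I"
    and 0: "\<And>v. (\<Sum>i\<in>I. c i * t i v) = 0" and i: "i \<in> I"
  shows "c i = 0"
proof -
  have "(\<Sum>s\<in>t ` I. (\<lambda>v. c (inv_into I t s) * s v)) = 0"
    by (subst sum.reindex[OF inj]) (simp add: fun_eq_iff sum_fun_apply 0 inv_into_f_f[OF inj])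
  from sec.independentD[OF ind finite_imageI[OF I] order_refl this, of "t i"] i
  show ?thesis by (simp add: inv_into_f_f[OF inj])
qed

text \<open>Injectivity comes from the same hypothesis: \<open>t i = t j\<close> with distinct
  indices would be a relation with coefficients 1 and -1.\<close>

lemma independent_familyI:
  assumes I: "finite I" and 0: "\<And>c i. (\<And>v. (\<Sum>i\<in>I. c i * t i v) = 0) \<Longrightarrow> i \<in> I \<Longrightarrow> c i = 0"
  shows "inj_on t I" "sec.independent (t ` I)"
proof -
  show inj: "inj_on t I"
  proof (rule inj_onI, rule ccontr)
    fix i j assume ij: "i \<in> I" "j \<in> I" "t i = t j" "i \<noteq> j"
    define c where "c l = (if l = i then 1 else if l = j then - 1 else 0 :: complex)" for l
    have "(\<Sum>l\<in>I. c l * t l v) = (\<Sum>l\<in>{i, j}. c l * t l v)" for v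
      by (rule sum.mono_neutral_right[OF I]) (use ij in \<open>auto simp: c_def\<close>)
    also have "(\<Sum>l\<in>{i, j}. c l * t l v) = 0" for v using ij by (simp add: c_def)
    finally show False using 0[of c i] ij by (simp add: c_def)
  qed
  show "sec.independent (t ` I)"
  proof
    assume "sec.dependent (t ` I)"
    then obtain u where u: "\<exists>s\<in>t ` I. u s \<noteq> 0" "(\<Sum>s\<in>t ` I. (\<lambda>v. u s * s v)) = 0"
      unfolding sec.dependent_finite[OF finite_imageI[OF I]] by blast
    have "(\<Sum>i\<in>I. u (t i) * t i v) = 0" for v
      using fun_cong[OF u(2), of v] by (simp add: sum_fun_apply sum.reindex[OF inj])
    from 0[of "\<lambda>i. u (t i)", OF this] u(1) show False by blast
  qed
qed

text \<open>All conditions are relative to \<open>V\<close>: \<open>Hilb\<close> is defined on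
  arbitrary functions, but is controlled only on holomorphic sections.\<close>

definition pd_hermitian :: "('l \<Rightarrow> complex) set \<Rightarrow> (('l \<Rightarrow> complex) \<Rightarrow> ('l \<Rightarrow> complex) \<Rightarrow> complex) \<Rightarrow> bool" where
  "pd_hermitian V H \<longleftrightarrow> sec.subspace V \<and>
     (\<forall>s\<in>V. \<forall>s'\<in>V. \<forall>u\<in>V. \<forall>a b. H (\<lambda>v. a * s v + b * s' v) u = a * H s u + b * H s' u) \<and>
     (\<forall>s\<in>V. \<forall>u\<in>V. H u s = cnj (H s u)) \<and>
     (\<forall>s\<in>V. s \<noteq> 0 \<longrightarrow> Re (H s s) > 0)"

context
  fixes V :: "('l \<Rightarrow> complex) set" and H
  assumes pd: "pd_hermitian V H"
begin

lemma pd_subspace: "sec.subspace V"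
  using pd unfolding pd_hermitian_def by (elim conjE)

lemma pd_linear: "s \<in> V \<Longrightarrow> s' \<in> V \<Longrightarrow> u \<in> V \<Longrightarrow> H (\<lambda>v. a * s v + b * s' v) u = a * H s u + b * H s' u"
  by (rule pd[unfolded pd_hermitian_def, THEN conjunct2, THEN conjunct1, THEN bspec, THEN bspec, THEN bspec,
        THEN spec, THEN spec])

lemma pd_cnj: "s \<in> V \<Longrightarrow> u \<in> V \<Longrightarrow> H u s = cnj (H s u)"
  by (rule pd[unfolded pd_hermitian_def, THEN conjunct2, THEN conjunct2, THEN conjunct1, THEN bspec, THEN bspec])

lemma pd_pos: "s \<in> V \<Longrightarrow> s \<noteq> 0 \<Longrightarrow> Re (H s s) > 0"
  by (rule pd[unfolded pd_hermitian_def, THEN conjunct2, THEN conjunct2, THEN conjunct2, THEN bspec, THEN mp])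

lemma pd_scale: "s \<in> V \<Longrightarrow> u \<in> V \<Longrightarrow> H (\<lambda>v. a * s v) u = a * H s u"
  using pd_linear[of s s u a 0] by simp

lemma pd_scale_right: "s \<in> V \<Longrightarrow> u \<in> V \<Longrightarrow> H u (\<lambda>v. a * s v) = cnj a * H u s"
  using pd_cnj[of "\<lambda>v. a * s v" u] pd_cnj[of s u] sec.subspace_scale[OF pd_subspace, of s a] by (simp add: pd_scale)

lemma pd_zero: "u \<in> V \<Longrightarrow> H (\<lambda>v. 0) u = 0"
  using pd_scale[of u u 0] by simp

lemma pd_lincomb:
  assumes "\<And>i. i \<in> I \<Longrightarrow> t i \<in> V" and u: "u \<in> V"
  shows "H (\<lambda>v. \<Sum>i\<in>I. c i * t i v) u = (\<Sum>i\<in>I. c i * H (t i) u)"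
  using assms(1)
proof (induction I rule: infinite_finite_induct)
  case (insert i I)
  have "(\<lambda>v. \<Sum>i\<in>I. c i * t i v) \<in> V"
    by (rule subspace_lincomb[OF pd_subspace]) (use insert in auto)
  from pd_linear[OF _ this u, of "t i" "c i" 1] show ?case using insert by simp
qed (use pd_zero u in auto)

lemma pd_real: "s \<in> V \<Longrightarrow> H s s = of_real (Re (H s s))"
  using pd_cnj[of s s] by (metis Reals_cnj_iff of_real_Re)

lemma orthonormal_independent:
  assumes E: "finite E" "E \<subseteq> V" and on: "\<forall>a\<in>E. \<forall>b\<in>E. H a b = (if a = b then 1 else 0)"
  shows "sec.independent E"
proof -
  have "c e = 0" if c: "\<And>v. (\<Sum>e\<in>E. c e * e v) = 0" and e: "e \<in> E" for c e
  proof -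
    have "0 = H (\<lambda>v. \<Sum>e\<in>E. c e * e v) e" using e E by (simp add: c pd_zero subset_iff)
    also have "\<dots> = (\<Sum>b\<in>E. c b * H b e)" by (rule pd_lincomb) (use e E in auto)
    also have "\<dots> = (\<Sum>b\<in>E. if b = e then c b else 0)"
      by (rule sum.cong) (use on e in auto)
    also have "\<dots> = c e" using e E by simp
    finally show ?thesis by simp
  qed
  then have "sec.independent ((\<lambda>e. e) ` E)" by (rule independent_familyI(2)[OF E(1)])
  then show ?thesis by simp
qed

lemma gram_schmidt_exists:
  assumes "finite B" "B \<subseteq> V" "sec.independent B"
  shows "\<exists>E. finite E \<and> E \<subseteq> V \<and> sec.span E = sec.span B \<and> (\<forall>a\<in>E. \<forall>b\<in>E. H a b = (if a = b then 1 else 0))"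
  using assms
proof (induction B rule: finite_induct)
  case empty
  then show ?case by auto
next
  case (insert x B)
  have xB: "x \<notin> sec.span B" "sec.independent B"
    using insert.prems(2) insert.hyps(2) sec.independent_insert[of x B] by simp_all
  then obtain E where E: "finite E" "E \<subseteq> V" "sec.span E = sec.span B"
    "\<And>a b. a \<in> E \<Longrightarrow> b \<in> E \<Longrightarrow> H a b = (if a = b then 1 else 0)"
    using insert by auto
  have x: "x \<in> V" using insert.prems by simp
  define p where "p = (\<lambda>v. \<Sum>e\<in>E. H x e * e v)"
  \<comment> \<open>The explicit coefficients 1 and -1 match the shape of
    \<open>pd_linear\<close>.\<close>
  define y where "y = (\<lambda>v. 1 * x v + (-1) * p v)"
  have pV: "p \<in> V" unfolding p_def by (rule subspace_lincomb[OF pd_subspace]) (use E in auto)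
  have psp: "p \<in> sec.span E" unfolding p_def
    by (rule subspace_lincomb[OF sec.subspace_span]) (rule sec.span_base)
  have y_eq: "y = x - p" by (simp add: y_def fun_eq_iff)
  have yV: "y \<in> V" unfolding y_eq by (rule sec.subspace_diff[OF pd_subspace x pV])
  have ysp: "y \<notin> sec.span E"
  proof
    assume "y \<in> sec.span E"
    from sec.span_add[OF this psp] have "x \<in> sec.span B" using E(3) by (simp add: y_eq)
    with xB show False by blast
  qed
  then have "y \<noteq> 0" using sec.span_zero[of E] by auto
  with yV have n: "Re (H y y) > 0" by (rule pd_pos)
  define r where "r = 1 / sqrt (Re (H y y))"
  have r: "r > 0" "r * r * Re (H y y) = 1" using n by (auto simp: r_def)
  define e where "e = (\<lambda>v. of_real r * y v)"
  have eV: "e \<in> V" unfolding e_def by (rule sec.subspace_scale[OF pd_subspace yV])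
  have ye: "H y b = 0" if b: "b \<in> E" for b
  proof -
    have bV: "b \<in> V" using b E by auto
    have "H p b = (\<Sum>e\<in>E. H x e * H e b)" unfolding p_def by (rule pd_lincomb) (use E bV in auto)
    also have "\<dots> = (\<Sum>e\<in>E. if e = b then H x e else 0)" by (rule sum.cong) (use E b in auto)
    also have "\<dots> = H x b" using E b by simp
    finally show ?thesis unfolding y_def pd_linear[OF x pV bV] by simp
  qed
  have eb: "H e b = 0" "H b e = 0" if b: "b \<in> E" for b
  proof -
    have bV: "b \<in> V" using b E by auto
    show "H e b = 0" unfolding e_def pd_scale[OF yV bV] ye[OF b] by simp
    then show "H b e = 0" using pd_cnj[OF eV bV] by simp
  qed
  have "H e e = of_real (r * r * Re (H y y))"
    unfolding e_def pd_scale[OF yV eV[unfolded e_def]] pd_scale_right[OF yV yV]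
    by (subst pd_real[OF yV]) simp
  then have ee: "H e e = 1" using r by simp
  have "sec.span (insert e E) = sec.span (insert x B)"
  proof (rule subset_antisym; rule sec.span_minimal[OF _ sec.subspace_span])
    have sub: "sec.span E \<subseteq> sec.span (insert x B)" unfolding E(3) by (rule sec.span_mono) auto
    have "e \<in> sec.span (insert x B)" unfolding e_def y_eq
      by (intro sec.span_scale sec.span_diff sec.span_base subsetD[OF sub psp]) simp
    then show "insert e E \<subseteq> sec.span (insert x B)" using sub sec.span_superset by blast
    have sub2: "sec.span E \<subseteq> sec.span (insert e E)" by (rule sec.span_mono) auto
    have "x = (\<lambda>v. of_real (1 / r) * e v) + p"
      using r by (simp add: e_def y_eq fun_eq_iff)
    also have "\<dots> \<in> sec.span (insert e E)"
      by (intro sec.span_add sec.span_scale sec.span_base subsetD[OF sub2 psp]) simp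
    finally have "x \<in> sec.span (insert e E)" .
    then show "insert x B \<subseteq> sec.span (insert e E)"
      using sub2 sec.span_superset[of B] E(3) by blast
  qed
  moreover have "\<forall>a\<in>insert e E. \<forall>b\<in>insert e E. H a b = (if a = b then 1 else 0)"
    using E(4) eb ee by fastforce
  ultimately show ?case using E eV by (intro exI[of _ "insert e E"]) auto
qed

lemma orthonormal_basisI:
  assumes E: "finite E" "sec.span E = V" and on: "\<forall>a\<in>E. \<forall>b\<in>E. H a b = (if a = b then 1 else 0)"
  shows "orthonormal_basis V H E"
  using orthonormal_independent[OF E(1) _ on] E on sec.span_superset[of E]
  unfolding orthonormal_basis_def is_basis_def by blast

lemma orthonormal_basis_exists:
  assumes "is_basis V B"
  shows "\<exists>E. orthonormal_basis V H E"
proof -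
  have B: "finite B" "B \<subseteq> V" "sec.independent B" "sec.span B = V"
    using assms sec.span_superset[of B] unfolding is_basis_def by auto
  from gram_schmidt_exists[OF B(1-3)] B(4) orthonormal_basisI show ?thesis by metis
qed

text \<open>The remainder \<open>d\<close> after subtracting the expansion is orthogonal to
  \<open>E\<close>, hence to its span \<open>V\<close>, hence to itself.\<close>

lemma orthonormal_basis_expansion:
  assumes E: "orthonormal_basis V H E" and s: "s \<in> V"
  shows "s w = (\<Sum>e\<in>E. H s e * e w)"
proof -
  have E': "finite E" "sec.span E = V" "\<And>a b. a \<in> E \<Longrightarrow> b \<in> E \<Longrightarrow> H a b = (if a = b then 1 else 0)"
    using E unfolding orthonormal_basis_def is_basis_def by auto
  have EV: "E \<subseteq> V" using sec.span_superset[of E] E'(2) by simp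
  define p where "p = (\<lambda>v. \<Sum>e\<in>E. H s e * e v)"
  define d where "d = (\<lambda>v. 1 * s v + (-1) * p v)"
  have pV: "p \<in> V" unfolding p_def by (rule subspace_lincomb[OF pd_subspace]) (use EV in auto)
  have dV: "d \<in> V" using sec.subspace_diff[OF pd_subspace s pV] by (simp add: d_def fun_diff_def)
  have de: "H d b = 0" if b: "b \<in> E" for b
  proof -
    have bV: "b \<in> V" using b EV by auto
    have "H p b = (\<Sum>e\<in>E. H s e * H e b)" unfolding p_def by (rule pd_lincomb) (use EV bV in auto)
    also have "\<dots> = (\<Sum>e\<in>E. if e = b then H s e else 0)" by (rule sum.cong) (use E' b in auto)
    also have "\<dots> = H s b" using E' b by simp
    finally show ?thesis unfolding d_def pd_linear[OF s pV bV] by simp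
  qed
  have "sec.subspace {u \<in> V. H u d = 0}"
  proof (rule sec.subspaceI)
    show "0 \<in> {u \<in> V. H u d = 0}"
      using sec.subspace_0[OF pd_subspace] pd_zero[OF dV] by (simp add: zero_fun_def)
    show "x + y \<in> {u \<in> V. H u d = 0}" if "x \<in> {u \<in> V. H u d = 0}" "y \<in> {u \<in> V. H u d = 0}" for x y
      using that sec.subspace_add[OF pd_subspace] pd_linear[OF _ _ dV, of x y 1 1] by (simp add: plus_fun_def)
    show "(\<lambda>v. c * x v) \<in> {u \<in> V. H u d = 0}" if "x \<in> {u \<in> V. H u d = 0}" for c x
      using that sec.subspace_scale[OF pd_subspace, of x c] pd_scale[OF _ dV, of x c] by simp
  qed
  moreover have "E \<subseteq> {u \<in> V. H u d = 0}"
    using EV de pd_cnj[OF dV] by auto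
  ultimately have "sec.span E \<subseteq> {u \<in> V. H u d = 0}" by (intro sec.span_minimal)
  then have "H d d = 0" using dV unfolding E'(2) by blast
  then have "d = 0" using pd_pos[OF dV] by (metis less_irrefl zero_complex.sel(1))
  then have "d w = 0" by simp
  then show ?thesis by (simp add: d_def p_def)
qed

text \<open>Each \<open>b\<close> is expanded in \<open>E\<close>; after exchanging the sums, the
  expansion of \<open>e\<close> in \<open>B\<close> collapses the inner one. This is the uniqueness
  of the reproducing kernel.\<close>

lemma orthonormal_kernel_unique:
  assumes E: "orthonormal_basis V H E" and B: "orthonormal_basis V H B"
  shows "(\<Sum>b\<in>B. b v * cnj (b w)) = (\<Sum>e\<in>E. e v * cnj (e w))"
proof -
  have EV: "E \<subseteq> V" and BV: "B \<subseteq> V"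
    using sec.span_superset[of E] sec.span_superset[of B] E B
    unfolding orthonormal_basis_def is_basis_def by blast+
  have "(\<Sum>b\<in>B. b v * cnj (b w)) = (\<Sum>b\<in>B. \<Sum>e\<in>E. H b e * e v * cnj (b w))"
  proof (rule sum.cong[OF refl])
    fix b assume "b \<in> B"
    then have "b v = (\<Sum>e\<in>E. H b e * e v)" using orthonormal_basis_expansion[OF E] BV by blast
    then show "b v * cnj (b w) = (\<Sum>e\<in>E. H b e * e v * cnj (b w))" by (simp only: sum_distrib_right)
  qed
  also have "\<dots> = (\<Sum>e\<in>E. \<Sum>b\<in>B. H b e * e v * cnj (b w))" by (rule sum.swap)
  also have "\<dots> = (\<Sum>e\<in>E. e v * cnj (e w))"
  proof (rule sum.cong[OF refl])
    fix e assume e: "e \<in> E"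
    have "(\<Sum>b\<in>B. H b e * e v * cnj (b w)) = e v * cnj (\<Sum>b\<in>B. H e b * b w)"
      unfolding cnj_sum sum_distrib_left
      by (rule sum.cong[OF refl]) (use pd_cnj[of e] e EV BV in auto)
    also have "(\<Sum>b\<in>B. H e b * b w) = e w"
      using orthonormal_basis_expansion[OF B, of e w] e EV by auto
    finally show "(\<Sum>b\<in>B. H b e * e v * cnj (b w)) = e v * cnj (e w)" .
  qed
  finally show ?thesis .
qed

text \<open>Paired with \<open>t j\<close> in the variable \<open>v\<close>, the left-hand kernel
  reproduces \<open>cnj (t j w)\<close>, while the right-hand one gives a combination of the
  \<open>cnj (t i w)\<close> whose coefficients are the matrix entries times \<open>c\<close>.
  Linear independence of the family compares coefficients.\<close>

lemma kernel_eq_imp_orthogonal: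
  assumes B: "orthonormal_basis V H B"
    and t: "finite I" "inj_on t I" "is_basis V (t ` I)"
    and ker: "\<And>v w. (\<Sum>b\<in>B. b v * cnj (b w)) = of_real c * (\<Sum>i\<in>I. t i v * cnj (t i w))"
    and ij: "i \<in> I" "j \<in> I"
  shows "of_real c * H (t i) (t j) = (if i = j then 1 else 0)"
proof -
  have BV: "B \<subseteq> V" and tV: "t i \<in> V" if "i \<in> I" for i
    using sec.span_superset[of B] sec.span_superset[of "t ` I"] B t that
    unfolding orthonormal_basis_def is_basis_def by blast+
  have "t j w = (\<Sum>i\<in>I. of_real c * cnj (H (t i) (t j)) * t i w)" for w
  proof -
    have "(\<lambda>v. \<Sum>b\<in>B. cnj (b w) * b v) = (\<lambda>v. \<Sum>i\<in>I. (of_real c * cnj (t i w)) * t i v)"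
      using ker[of _ w] by (simp add: fun_eq_iff sum_distrib_left mult_ac)
    then have "H (\<lambda>v. \<Sum>b\<in>B. cnj (b w) * b v) (t j) = H (\<lambda>v. \<Sum>i\<in>I. (of_real c * cnj (t i w)) * t i v) (t j)"
      by simp
    moreover have "H (\<lambda>v. \<Sum>b\<in>B. cnj (b w) * b v) (t j) = (\<Sum>b\<in>B. cnj (b w) * H b (t j))"
      by (rule pd_lincomb) (use BV tV ij in auto)
    moreover have "H (\<lambda>v. \<Sum>i\<in>I. (of_real c * cnj (t i w)) * t i v) (t j) =
        (\<Sum>i\<in>I. (of_real c * cnj (t i w)) * H (t i) (t j))"
      by (rule pd_lincomb) (use tV ij in auto)
    moreover have "(\<Sum>b\<in>B. cnj (b w) * H b (t j)) = cnj (\<Sum>b\<in>B. H (t j) b * b w)"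
      unfolding cnj_sum by (rule sum.cong[OF refl]) (use pd_cnj[OF tV[OF ij(2)]] BV ij in \<open>auto simp: mult.commute\<close>)
    moreover have "(\<Sum>b\<in>B. H (t j) b * b w) = t j w"
      using orthonormal_basis_expansion[OF B tV[OF ij(2)]] by simp
    ultimately have "cnj (t j w) = (\<Sum>i\<in>I. (of_real c * cnj (t i w)) * H (t i) (t j))" by simp
    from arg_cong[OF this, of cnj] show ?thesis by (simp add: mult_ac)
  qed
  then have "(\<Sum>i\<in>I. (of_real c * cnj (H (t i) (t j)) - (if i = j then 1 else 0)) * t i w) = 0" for w
    using ij t(1) by (simp add: left_diff_distrib sum_subtractf if_distrib[of "\<lambda>x. x * _"] cong: if_cong)
  from independent_family_zero[OF t(2) _ t(1) this ij(1)] t(3)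
  have "of_real c * cnj (H (t i) (t j)) = (if i = j then 1 else 0)"
    unfolding is_basis_def by simp
  from arg_cong[OF this, of cnj] show ?thesis by (simp split: if_splits)
qed

text \<open>Multiplying the family by \<open>1 / sqrt c\<close> makes it orthonormal, and
  orthonormal bases share one kernel.\<close>

lemma orthogonal_imp_kernel_eq:
  assumes B: "orthonormal_basis V H B"
    and t: "finite I" "inj_on t I" "is_basis V (t ` I)"
    and c: "c > 0" and orth: "\<And>i j. i \<in> I \<Longrightarrow> j \<in> I \<Longrightarrow> H (t i) (t j) = (if i = j then of_real c else 0)"
  shows "(\<Sum>b\<in>B. b v * cnj (b w)) = of_real (1 / c) * (\<Sum>i\<in>I. t i v * cnj (t i w))"
proof -
  define a where "a = complex_of_real (1 / sqrt c)"
  have a: "a \<noteq> 0" "cnj a = a" "a * a = of_real (1 / c)"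
    using c by (auto simp: a_def simp flip: of_real_mult)
  define e where "e i = (\<lambda>v. a * t i v)" for i
  have tV: "t i \<in> V" if "i \<in> I" for i
    using sec.span_superset[of "t ` I"] t that unfolding is_basis_def by blast
  have inj: "inj_on e I"
  proof (rule inj_onI)
    fix i j assume ij: "i \<in> I" "j \<in> I" "e i = e j"
    then have "t i = t j" using a by (simp add: e_def fun_eq_iff)
    with ij t(2) show "i = j" by (meson inj_onD)
  qed
  have He: "H (e i) (e j) = (if i = j then 1 else 0)" if ij: "i \<in> I" "j \<in> I" for i j
  proof -
    have "e j \<in> V" unfolding e_def by (rule sec.subspace_scale[OF pd_subspace tV[OF ij(2)]])
    then have "H (e i) (e j) = a * (cnj a * H (t i) (t j))"
      unfolding e_def by (subst pd_scale[OF tV[OF ij(1)]]) (simp_all add: pd_scale_right[OF tV[OF ij(2)] tV[OF ij(1)]])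
    also have "\<dots> = of_real (1 / c) * H (t i) (t j)" by (simp only: a(2) a(3)[symmetric] mult.assoc)
    finally show ?thesis using orth[OF ij] c by simp
  qed
  have "orthonormal_basis V H (e ` I)"
  proof (rule orthonormal_basisI)
    show "finite (e ` I)" using t by simp
    show "\<forall>a\<in>e ` I. \<forall>b\<in>e ` I. H a b = (if a = b then 1 else 0)"
      using He inj by (auto simp: inj_on_eq_iff)
    show "sec.span (e ` I) = V"
    proof (rule subset_antisym)
      show "sec.span (e ` I) \<subseteq> V"
        by (rule sec.span_minimal[OF _ pd_subspace]) (auto simp: e_def intro!: sec.subspace_scale[OF pd_subspace] tV)
      have "t ` I \<subseteq> sec.span (e ` I)"
      proof
        fix x assume "x \<in> t ` I"
        then obtain i where i: "i \<in> I" "x = t i" by blast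
        have "(\<lambda>v. (1 / a) * e i v) \<in> sec.span (e ` I)"
          by (intro sec.span_scale sec.span_base) (use i in auto)
        then show "x \<in> sec.span (e ` I)" using a i by (simp add: e_def)
      qed
      from sec.span_minimal[OF this sec.subspace_span] show "V \<subseteq> sec.span (e ` I)"
        using t(3) unfolding is_basis_def by simp
    qed
  qed
  from orthonormal_kernel_unique[OF this B, of v w]
  have "(\<Sum>b\<in>B. b v * cnj (b w)) = (\<Sum>i\<in>I. (a * cnj a) * (t i v * cnj (t i w)))"
    unfolding sum.reindex[OF inj] by (simp add: e_def mult_ac)
  then show ?thesis by (simp only: a(2,3) sum_distrib_left)
qed

end

section \<open>The Hermitian form Hilb\<close>

lemma continuous_on_levi:
  assumes "finite I" "\<And>i. i \<in> I \<Longrightarrow> continuous_on S (u i)" "\<And>i. i \<in> I \<Longrightarrow> continuous_on S (p i)"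
    "\<And>i. i \<in> I \<Longrightarrow> continuous_on S (q i)" "\<And>z. z \<in> S \<Longrightarrow> \<exists>i\<in>I. u i z \<noteq> 0"
  shows "continuous_on S (\<lambda>z. levi I (\<lambda>i. u i z) (\<lambda>i. p i z) (\<lambda>i. q i z))"
proof -
  have "(\<Sum>i\<in>I. u i z * cnj (u i z)) \<noteq> 0" if "z \<in> S" for z
    by (rule sum_mult_cnj_nonzero[OF assms(1) assms(5)[OF that]])
  then show ?thesis unfolding levi_def by (intro continuous_intros assms) auto
qed

section \<open>Base point freeness, immersivity and continuity for arbitrary bases of
  sections\<close>

context polarized_manifold
begin

definition basis_family :: "'i set \<Rightarrow> ('i \<Rightarrow> 'l \<Rightarrow> complex) \<Rightarrow> bool" where
  "basis_family I s \<longleftrightarrow> finite I \<and> inj_on s I \<and> is_basis (H0 M k) (s ` I)"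

lemma basis_familyD:
  assumes "basis_family I s"
  shows "finite I" "inj_on s I" "is_basis (H0 M k) (s ` I)" "sec.span (s ` I) = H0 M k" "i \<in> I \<Longrightarrow> s i \<in> H0 M k"
  using assms sec.span_superset[of "s ` I"] unfolding basis_family_def is_basis_def by blast+

lemma basis_family_linear:
  assumes s: "basis_family I s" and V: "sec.subspace V" and I: "\<And>i. i \<in> I \<Longrightarrow> s i \<in> V" and x: "x \<in> H0 M k"
  shows "x \<in> V"
proof -
  have "sec.span (s ` I) \<subseteq> V" by (rule sec.span_minimal[OF _ V]) (use I in auto)
  then show ?thesis using x basis_familyD(4)[OF s] by blast
qed

text \<open>\<open>very_ample\<close> speaks of some basis only. Sections vanishing at
  \<open>v\<close> form a subspace, so if it contained this family it would contain that basis as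
  well.\<close>

lemma basis_family_bpf:
  assumes s: "basis_family I s"
  shows "bpf_family I s"
  unfolding bpf_family_def
proof (intro conjI ballI allI impI)
  fix v assume v: "nonzero M v"
  obtain B where B: "is_basis (H0 M k) B" "projective_embedding M B" using ample unfolding very_ample_def by blast
  then obtain b where b: "b \<in> B" "b v \<noteq> 0" using v unfolding projective_embedding_def by blast
  have bH: "b \<in> H0 M k" using b B sec.span_superset[of B] unfolding is_basis_def by blast
  show "\<exists>i\<in>I. s i v \<noteq> 0"
  proof (rule ccontr)
    assume "\<not> (\<exists>i\<in>I. s i v \<noteq> 0)"
    then have "b \<in> {x. x v = 0}"
      by (intro basis_family_linear[OF s _ _ bH] sec.subspaceI) auto
    with b show False by simp
  qed
qed (use basis_familyD[OF s] in auto)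

text \<open>For fixed \<xi> and \<open>a\<close> the condition on the derivative is linear in the
  section, hence passes from this family to the embedding basis.\<close>

lemma basis_family_immersion:
  assumes s: "basis_family I s" and c: "c \<in> atlas M" "x \<in> fst c" and t: "t \<in> trivs M" "x \<in> fst t"
    and D: "\<And>i. i \<in> I \<Longrightarrow> frechet_derivative (\<lambda>z. s i (frame M t (chart_inv c z))) (at (snd c x)) \<xi> = a * s i (frame M t x)"
  shows "\<xi> = 0"
proof -
  obtain B where B: "is_basis (H0 M k) B" "projective_embedding M B" using ample unfolding very_ample_def by blast
  have BH: "B \<subseteq> H0 M k" using B sec.span_superset[of B] unfolding is_basis_def by blast
  let ?f = "\<lambda>x z. x (frame M t (chart_inv c z))" and ?z = "snd c x"
  let ?D = "\<lambda>x. frechet_derivative (?f x) (at ?z)"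
  have z: "?z \<in> snd c ` (fst t \<inter> fst c)" using c t by auto
  have der: "(?f x has_derivative ?D x) (at ?z)" if "x \<in> H0 M k" for x
    by (rule holo_fun_on_has_derivative[OF H0_local_holo[OF that t(1) c(1)] z])
  define V where "V = {u \<in> H0 M k. ?D u \<xi> = a * u (frame M t x)}"
  have V: "sec.subspace V"
  proof (rule sec.subspaceI)
    show "0 \<in> V" using sec.subspace_0[OF H0_subspace] by (simp add: V_def zero_fun_def)
    show "u + w \<in> V" if uw: "u \<in> V" "w \<in> V" for u w
    proof -
      have "(?f (u + w) has_derivative (\<lambda>v. ?D u v + ?D w v)) (at ?z)"
        unfolding plus_fun_def by (intro has_derivative_add der) (use uw in \<open>auto simp: V_def\<close>)
      then have "?D (u + w) = (\<lambda>v. ?D u v + ?D w v)" by (rule frechet_derivative_at[symmetric])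
      then show ?thesis using uw sec.subspace_add[OF H0_subspace, of u w]
        by (simp add: V_def algebra_simps)
    qed
    show "(\<lambda>v. b * u v) \<in> V" if u: "u \<in> V" for b u
    proof -
      have "(?f (\<lambda>v. b * u v) has_derivative (\<lambda>v. b * ?D u v)) (at ?z)"
        by (intro has_derivative_mult_right der) (use u in \<open>auto simp: V_def\<close>)
      then have "?D (\<lambda>v. b * u v) = (\<lambda>v. b * ?D u v)" by (rule frechet_derivative_at[symmetric])
      then show ?thesis using u sec.subspace_scale[OF H0_subspace, of u b]
        by (simp add: V_def algebra_simps)
    qed
  qed
  have "s i \<in> V" if "i \<in> I" for i
    using D[OF that] basis_familyD(5)[OF s that] by (simp add: V_def)
  then have "B \<subseteq> V" using basis_family_linear[OF s V] BH by blast
  then have "\<forall>b\<in>B. ?D b \<xi> = a * b (frame M t x)" by (auto simp: V_def)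
  then show ?thesis using B(2) c t unfolding projective_embedding_def by blast
qed

lemma section_continuous_on_frame:
  assumes s: "s \<in> H0 M k" and t: "t \<in> trivs M"
  shows "continuous_on (fst t) (\<lambda>x. s (frame M t x))"
proof (rule continuous_on_locally)
  fix x assume x: "x \<in> fst t"
  obtain c where c: "c \<in> atlas M" "x \<in> fst c" using atlas_cover by blast
  let ?S = "fst t \<inter> fst c"
  have "continuous_on ?S (\<lambda>x. s (frame M t (chart_inv c (snd c x))))"
    by (rule continuous_on_compose2[OF holo_fun_on_continuous[OF H0_local_holo[OF s t c(1)]]
          continuous_on_subset[OF homeomorphism_cont1[OF chart_homeomorphism[OF c(1)]]]]) auto
  then have "continuous_on ?S (\<lambda>x. s (frame M t x))"
    by (rule continuous_on_eq) (simp add: chart_inv_left[OF c(1)] del: inv_into_f_f)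
  then show "\<exists>S. open S \<and> x \<in> S \<and> continuous_on S (\<lambda>x. s (frame M t x))"
    using x c open_Int[OF triv_open[OF t] chart_open(1)[OF c(1)]] by (intro exI[of _ ?S]) simp
qed

text \<open>Supplies the open set on which the integrand of the squared norm of a nonzero section is
  strictly positive.\<close>

lemma open_section_nonzero:
  assumes s: "s \<in> H0 M k"
  shows "open {x. \<exists>v. proj M v = x \<and> s v \<noteq> 0}"
proof -
  have "{x. \<exists>v. proj M v = x \<and> s v \<noteq> 0} = (\<Union>t\<in>trivs M. fst t \<inter> (\<lambda>x. s (frame M t x)) -` (- {0}))" (is "?L = ?R")
  proof (intro subset_antisym subsetI)
    fix x assume "x \<in> ?L"
    then obtain v where v: "proj M v = x" "s v \<noteq> 0" by blast
    then have nz: "nonzero M v" using H0_zero[OF s] by blast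
    obtain t where t: "t \<in> trivs M" "x \<in> fst t" using triv_cover by blast
    then have "s (frame M t x) \<noteq> 0" using H0_frame[OF s t(1) _ nz] v by auto
    with t show "x \<in> ?R" by auto
  next
    fix x assume "x \<in> ?R"
    then show "x \<in> ?L" using frame by fastforce
  qed
  also have "open \<dots>"
    by (intro open_UN ballI continuous_open_preimage section_continuous_on_frame[OF s] triv_open) auto
  finally show ?thesis .
qed

end

section \<open>Volume form and Hermitian form of a Fubini--Study potential\<close>

context metrized_manifold
begin

text \<open>Evaluation of the form on one tangent vector involves only the derivatives in that
  direction. This serves positivity and, later, the restriction of the form to complex
  lines.\<close>

lemma omega_fs_quadratic:
  assumes s: "bpf_family I s" and c: "c \<in> atlas M" "x \<in> fst c" and t: "t \<in> trivs M" "x \<in> fst t"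
  defines "D \<equiv> \<lambda>i. frechet_derivative (\<lambda>z. s i (frame M t (chart_inv c z))) (at (snd c x))"
  shows "(\<Sum>j\<in>UNIV. \<Sum>l\<in>UNIV. omega M k h0 (fs_potential M k h0 I s) c x $ j $ l * \<xi> $ j * cnj (\<xi> $ l)) =
    levi I (\<lambda>i. s i (frame M t x)) (\<lambda>i. D i \<xi>) (\<lambda>i. D i \<xi>)"
proof -
  have z: "snd c x \<in> snd c ` (fst t \<inter> fst c)" using c t by auto
  have D\<xi>: "D i \<xi> = (\<Sum>j\<in>UNIV. \<xi> $ j * D i (axis j 1))" if i: "i \<in> I" for i
  proof -
    note h = H0_local_holo[OF bpf_familyD(2)[OF s i] t(1) c(1)]
    have lin: "linear (D i)" using has_derivative_linear[OF holo_fun_on_has_derivative[OF h z]] unfolding D_def .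
    have "D i \<xi> = D i (\<Sum>j\<in>UNIV. \<xi> $ j *s axis j 1)" by (simp add: basis_expansion)
    also have "\<dots> = (\<Sum>j\<in>UNIV. \<xi> $ j * D i (axis j 1))"
      unfolding linear_sum[OF lin] unfolding D_def holo_fun_on_derivative_scale[OF h z] ..
    finally show ?thesis .
  qed
  have "(\<Sum>j\<in>UNIV. \<Sum>l\<in>UNIV. omega M k h0 (fs_potential M k h0 I s) c x $ j $ l * \<xi> $ j * cnj (\<xi> $ l)) =
      (\<Sum>j\<in>UNIV. \<Sum>l\<in>UNIV. \<xi> $ j * levi I (\<lambda>i. s i (frame M t x)) (\<lambda>i. D i (axis j 1)) (\<lambda>i. D i (axis l 1)) * cnj (\<xi> $ l))"
    unfolding omega_fs[OF s c t] D_def by (simp only: mult.commute[of "levi _ _ _ _"])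
  also have "\<dots> = levi I (\<lambda>i. s i (frame M t x)) (\<lambda>i. D i \<xi>) (\<lambda>i. D i \<xi>)"
    unfolding levi_sum[symmetric] by (rule levi_cong) (simp_all add: D\<xi>)
  finally show ?thesis .
qed

context
  fixes I :: "'i set" and f :: "'i \<Rightarrow> 'l \<Rightarrow> complex"
  assumes f: "basis_family I f"
begin

abbreviation \<omega> where "\<omega> \<equiv> omega M k h0 (fs_potential M k h0 I f)"
abbreviation hilb where "hilb \<equiv> Hilb M k h0 (fs_potential M k h0 I f)"
abbreviation pw where "pw \<equiv> pointwise M (metric_of M k h0 (fs_potential M k h0 I f))"

lemma family_bpf: "bpf_family I f"
  by (rule basis_family_bpf[OF f])

lemma omega_hermitian:
  assumes "c \<in> atlas M" "x \<in> fst c"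
  shows "\<omega> c x $ l $ j = cnj (\<omega> c x $ j $ l)"
proof -
  obtain t where t: "t \<in> trivs M" "x \<in> fst t" using triv_cover by blast
  show ?thesis unfolding omega_fs[OF family_bpf assms t] by (rule levi_cnj)
qed

lemma omega_positive:
  assumes c: "c \<in> atlas M" "x \<in> fst c" and \<xi>: "\<xi> \<noteq> 0"
  shows "Re (\<Sum>j\<in>UNIV. \<Sum>l\<in>UNIV. \<omega> c x $ j $ l * \<xi> $ j * cnj (\<xi> $ l)) > 0"
proof -
  obtain t where t: "t \<in> trivs M" "x \<in> fst t" using triv_cover by blast
  show ?thesis
    unfolding omega_fs_quadratic[OF family_bpf c t]
    using basis_family_immersion[OF f c t, of \<xi>] \<xi>
    by (intro levi_pos basis_familyD(1)[OF f] bpf_familyD(3)[OF family_bpf] frame[OF t]) blast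
qed

lemma omega_det_pos:
  assumes "c \<in> atlas M" "x \<in> fst c"
  shows "Im (det (\<omega> c x)) = 0" "Re (det (\<omega> c x)) > 0"
  using det_hermitian_pos[of "\<omega> c x"] omega_hermitian[OF assms] omega_positive[OF assms] by blast+

lemma omega_continuous:
  assumes c: "c \<in> atlas M"
  shows "continuous_on (snd c ` fst c) (\<lambda>z. \<omega> c (chart_inv c z) $ j $ l)"
proof (rule continuous_on_locally)
  fix z assume "z \<in> snd c ` fst c"
  then obtain x where x: "x \<in> fst c" "z = snd c x" by blast
  obtain t where t: "t \<in> trivs M" "x \<in> fst t" using triv_cover by blast
  let ?S = "snd c ` (fst t \<inter> fst c)"
  let ?u = "\<lambda>i z. f i (frame M t (chart_inv c z))"
  have S: "open ?S" by (rule chart_image_open[OF c triv_open[OF t(1)]])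
  note h = H0_local_holo[OF basis_familyD(5)[OF f] t(1) c]
  have "continuous_on ?S (\<lambda>z. levi I (\<lambda>i. ?u i z)
      (\<lambda>i. frechet_derivative (?u i) (at z) (axis j 1)) (\<lambda>i. frechet_derivative (?u i) (at z) (axis l 1)))"
  proof (rule continuous_on_levi[OF basis_familyD(1)[OF f]])
    show "continuous_on ?S (?u i)" if "i \<in> I" for i
      by (rule holo_fun_on_continuous[OF h[OF that]])
    show "continuous_on ?S (\<lambda>z. frechet_derivative (?u i) (at z) v)" if "i \<in> I" for i v
      by (rule holo_fun_on_continuous[OF holo_fun_on_derivative[OF h[OF that] S]])
    then show "continuous_on ?S (\<lambda>z. frechet_derivative (?u i) (at z) (axis l 1))" if "i \<in> I" for i
      using that .
    show "\<exists>i\<in>I. ?u i z \<noteq> 0" if "z \<in> ?S" for z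
      by (rule bpf_familyD(3)[OF family_bpf frame(3)[OF t(1) chart_image_inv(1)[OF c that]]])
  qed
  then have "continuous_on ?S (\<lambda>z. \<omega> c (chart_inv c z) $ j $ l)"
  proof (rule continuous_on_eq)
    fix z assume z: "z \<in> ?S"
    have "chart_inv c z \<in> fst c" "chart_inv c z \<in> fst t" "snd c (chart_inv c z) = z"
      using chart_image_inv[OF c z] z by (auto simp: f_inv_into_f simp del: inv_into_f_f intro!: f_inv_into_f)
    then show "levi I (\<lambda>i. ?u i z)
      (\<lambda>i. frechet_derivative (?u i) (at z) (axis j 1)) (\<lambda>i. frechet_derivative (?u i) (at z) (axis l 1)) =
      \<omega> c (chart_inv c z) $ j $ l"
      using omega_fs[OF family_bpf c _ t(1), of "chart_inv c z" j l] by simp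
  qed
  then show "\<exists>S. open S \<and> z \<in> S \<and> continuous_on S (\<lambda>z. \<omega> c (chart_inv c z) $ j $ l)"
    using S x t by (intro exI[of _ ?S]) auto
qed

lemma pw_continuous:
  assumes c: "c \<in> atlas M" and s: "s \<in> H0 M k" "s' \<in> H0 M k"
  shows "continuous_on (snd c ` fst c) (\<lambda>z. pw s s' (chart_inv c z))"
proof (rule continuous_on_locally)
  fix z assume "z \<in> snd c ` fst c"
  then obtain x where x: "x \<in> fst c" "z = snd c x" by blast
  obtain t where t: "t \<in> trivs M" "x \<in> fst t" using triv_cover by blast
  let ?S = "snd c ` (fst t \<inter> fst c)"
  let ?u = "\<lambda>s z. s (frame M t (chart_inv c z))"
  have S: "open ?S" by (rule chart_image_open[OF c triv_open[OF t(1)]])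
  have h: "continuous_on ?S (?u s)" if "s \<in> H0 M k" for s
    by (rule holo_fun_on_continuous[OF H0_local_holo[OF that t(1) c]])
  have nz: "(\<Sum>i\<in>I. ?u (f i) z * cnj (?u (f i) z)) \<noteq> 0" if "z \<in> ?S" for z
    by (rule sum_mult_cnj_nonzero[OF basis_familyD(1)[OF f]
          bpf_familyD(3)[OF family_bpf frame(3)[OF t(1) chart_image_inv(1)[OF c that]]]])
  have "continuous_on ?S (\<lambda>z. ?u s z * cnj (?u s' z) / (\<Sum>i\<in>I. ?u (f i) z * cnj (?u (f i) z)))"
    by (intro continuous_intros h s basis_familyD(5)[OF f] ballI nz)
  then have "continuous_on ?S (\<lambda>z. pw s s' (chart_inv c z))"
  proof (rule continuous_on_eq)
    fix z assume z: "z \<in> ?S"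
    show "?u s z * cnj (?u s' z) / (\<Sum>i\<in>I. ?u (f i) z * cnj (?u (f i) z)) = pw s s' (chart_inv c z)"
      using pointwise_fs[OF family_bpf frame(3)[OF t(1) chart_image_inv(1)[OF c z]] s]
        frame(1)[OF t(1) chart_image_inv(1)[OF c z]] by simp
  qed
  then show "\<exists>S. open S \<and> z \<in> S \<and> continuous_on S (\<lambda>z. pw s s' (chart_inv c z))"
    using S x t by (intro exI[of _ ?S]) auto
qed

definition density :: "nat \<Rightarrow> ('l \<Rightarrow> complex) \<Rightarrow> ('l \<Rightarrow> complex) \<Rightarrow> complex^'n \<Rightarrow> complex" where
  "density m s s' z = 2 ^ CARD('n) * det (\<omega> (piece_chart m) (chart_inv (piece_chart m) z)) *
     pw s s' (chart_inv (piece_chart m) z)"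

lemma hilb_density:
  "hilb s s' = (\<Sum>m<length (chart_cover M). LINT z:snd (piece_chart m) ` piece m|lborel. density m s s' z)"
  unfolding Hilb_def form_integral_pieces density_def ..

lemma density_integrable:
  assumes m: "m < length (chart_cover M)" and s: "s \<in> H0 M k" "s' \<in> H0 M k"
  shows "set_integrable lborel (snd (piece_chart m) ` piece m) (density m s s')"
proof (rule set_integrable_piece[OF m])
  show "continuous_on (snd (piece_chart m) ` fst (piece_chart m)) (density m s s')"
    unfolding density_def det_def
    by (intro continuous_intros omega_continuous pw_continuous piece_chart(1)[OF m] s)
qed

lemma pw_linear: "pw (\<lambda>v. a * s v + b * s' v) u x = a * pw s u x + b * pw s' u x"
  unfolding pointwise_def Let_def by (simp add: algebra_simps)

lemma pw_cnj: "pw u s x = cnj (pw s u x)"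
  unfolding pointwise_def Let_def by simp

lemma density_self:
  assumes m: "m < length (chart_cover M)" and x: "x \<in> piece m" and s: "s \<in> H0 M k" and v: "nonzero M v" "proj M v = x"
  shows "Re (density m s s (snd (piece_chart m) x)) =
    2 ^ CARD('n) * Re (det (\<omega> (piece_chart m) x)) * ((cmod (s v))\<^sup>2 / (\<Sum>i\<in>I. (cmod (f i v))\<^sup>2))"
proof -
  have xc: "x \<in> fst (piece_chart m)" using piece_chart(2)[OF m] x by blast
  have inv: "chart_inv (piece_chart m) (snd (piece_chart m) x) = x"
    by (rule chart_inv_left[OF piece_chart(1)[OF m] xc])
  have d: "det (\<omega> (piece_chart m) x) = of_real (Re (det (\<omega> (piece_chart m) x)))"
    using omega_det_pos(1)[OF piece_chart(1)[OF m] xc] by (simp add: complex_eq_iff)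
  have p: "pw s s x = of_real ((cmod (s v))\<^sup>2 / (\<Sum>i\<in>I. (cmod (f i v))\<^sup>2))"
    using pointwise_fs[OF family_bpf v(1) s s] v(2)
    unfolding sum_mult_cnj of_real_divide complex_norm_square by simp
  have "density m s s (snd (piece_chart m) x) =
    of_real (2 ^ CARD('n) * Re (det (\<omega> (piece_chart m) x)) * ((cmod (s v))\<^sup>2 / (\<Sum>i\<in>I. (cmod (f i v))\<^sup>2)))"
    unfolding density_def inv p by (subst d) simp
  then show ?thesis by (simp only: Re_complex_of_real)
qed

text \<open>Symmetry holds because the determinant of the form is real. For definiteness, a nonzero
  section is nonzero over an open set, some piece contains a nonempty open part of it, and there the
  integrand is positive since the determinant is.\<close>

lemma hilb_pd_hermitian: "pd_hermitian (H0 M k) hilb"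
  unfolding pd_hermitian_def
proof (intro conjI ballI allI impI H0_subspace)
  let ?n = "length (chart_cover M)" and ?A = "\<lambda>m. snd (piece_chart m) ` piece m"
  fix s u assume s: "s \<in> H0 M k" and u: "u \<in> H0 M k"
  show "hilb (\<lambda>v. a * s v + b * s' v) u = a * hilb s u + b * hilb s' u" if s': "s' \<in> H0 M k" for s' a b
  proof -
    have "(LINT z:?A m|lborel. density m (\<lambda>v. a * s v + b * s' v) u z) =
      a * (LINT z:?A m|lborel. density m s u z) + b * (LINT z:?A m|lborel. density m s' u z)" if m: "m < ?n" for m
    proof -
      have eq: "density m (\<lambda>v. a * s v + b * s' v) u = (\<lambda>z. a * density m s u z + b * density m s' u z)"
        unfolding density_def pw_linear by (simp add: algebra_simps)
      have "set_integrable lborel (?A m) (\<lambda>z. a * density m s u z)" "set_integrable lborel (?A m) (\<lambda>z. b * density m s' u z)"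
        using density_integrable[OF m s u] density_integrable[OF m s' u] by auto
      from set_integral_add(2)[OF this] show ?thesis unfolding eq by simp
    qed
    then show ?thesis unfolding hilb_density by (simp add: sum.distrib sum_distrib_left)
  qed
  show "hilb u s = cnj (hilb s u)"
  proof -
    have "(LINT z:?A m|lborel. density m u s z) = cnj (LINT z:?A m|lborel. density m s u z)" if m: "m < ?n" for m
    proof -
      have "indicator (?A m) z *\<^sub>R density m u s z = cnj (indicator (?A m) z *\<^sub>R density m s u z)" for z
      proof (cases "z \<in> ?A m")
        case True
        then obtain x where x: "x \<in> piece m" "z = snd (piece_chart m) x" by blast
        have xc: "x \<in> fst (piece_chart m)" using piece_chart(2)[OF m] x by blast
        have "chart_inv (piece_chart m) z = x"
          unfolding x(2) by (rule chart_inv_left[OF piece_chart(1)[OF m] xc])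
        moreover have "cnj (det (\<omega> (piece_chart m) x)) = det (\<omega> (piece_chart m) x)"
          using omega_det_pos(1)[OF piece_chart(1)[OF m] xc] by (simp add: complex_eq_iff)
        ultimately show ?thesis using pw_cnj[of u s x] by (simp add: density_def)
      qed simp
      then show ?thesis unfolding set_lebesgue_integral_def by (simp only: Bochner_Integration.integral_cnj)
    qed
    then show ?thesis unfolding hilb_density by simp
  qed
next
  let ?n = "length (chart_cover M)" and ?A = "\<lambda>m. snd (piece_chart m) ` piece m"
  fix s assume s: "s \<in> H0 M k" and s0: "s \<noteq> 0"
  have re: "Re (LINT z:?A m|lborel. density m s s z) = (LINT z:?A m|lborel. Re (density m s s z))"
    and int: "set_integrable lborel (?A m) (\<lambda>z. Re (density m s s z))" if m: "m < ?n" for m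
  proof -
    have i: "integrable lborel (\<lambda>z. indicator (?A m) z *\<^sub>R density m s s z)"
      using density_integrable[OF m s s] unfolding set_integrable_def .
    show "Re (LINT z:?A m|lborel. density m s s z) = (LINT z:?A m|lborel. Re (density m s s z))"
      unfolding set_lebesgue_integral_def using integral_Re[OF i] by simp
    show "set_integrable lborel (?A m) (\<lambda>z. Re (density m s s z))"
      unfolding set_integrable_def using integrable_Re[OF i] by simp
  qed
  have pos: "Re (density m s s z) \<ge> 0" if m: "m < ?n" and z: "z \<in> ?A m" for m z
  proof -
    obtain x where x: "x \<in> piece m" "z = snd (piece_chart m) x" using z by blast
    obtain v where v: "nonzero M v" "proj M v = x" using nonzero_over by blast
    have xc: "x \<in> fst (piece_chart m)" using piece_chart(2)[OF m] x by blast
    show ?thesis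
      unfolding x(2) density_self[OF m x(1) s v]
      using omega_det_pos(2)[OF piece_chart(1)[OF m] xc] bpf_family_sum_pos[OF family_bpf v(1)]
      by (intro mult_nonneg_nonneg divide_nonneg_nonneg) auto
  qed
  have nonneg: "Re (LINT z:?A m|lborel. density m s s z) \<ge> 0" if m: "m < ?n" for m
    unfolding re[OF m] unfolding set_lebesgue_integral_def
    by (rule Bochner_Integration.integral_nonneg) (use pos[OF m] in \<open>simp add: indicator_def\<close>)
  define U where "U = {x. \<exists>v. proj M v = x \<and> s v \<noteq> 0}"
  have "U \<noteq> {}" using s0 unfolding U_def by (auto simp: fun_eq_iff)
  with open_meets_piece[of U] open_section_nonzero[OF s] obtain m W
    where m: "m < ?n" and W: "open W" "W \<noteq> {}" "W \<subseteq> U \<inter> piece m"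
    unfolding U_def by blast
  have Wc: "W \<inter> fst (piece_chart m) = W" using W piece_chart(2)[OF m] by blast
  have "(LINT z:?A m|lborel. Re (density m s s z)) > 0"
  proof (rule set_integral_pos[OF int[OF m] pos[OF m]])
    show "open (snd (piece_chart m) ` W)"
      using chart_image_open[OF piece_chart(1)[OF m] W(1)] unfolding Wc .
    show "snd (piece_chart m) ` W \<noteq> {}" "snd (piece_chart m) ` W \<subseteq> ?A m" using W by auto
    fix z assume "z \<in> snd (piece_chart m) ` W"
    then obtain x where x: "x \<in> W" "z = snd (piece_chart m) x" by blast
    then obtain v where v: "proj M v = x" "s v \<noteq> 0" using W(3) unfolding U_def by blast
    then have nz: "nonzero M v" using H0_zero[OF s] by blast
    have xp: "x \<in> piece m" "x \<in> fst (piece_chart m)" using x W(3) piece_chart(2)[OF m] by auto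
    show "Re (density m s s z) > 0"
      unfolding x(2) density_self[OF m xp(1) s nz v(1)]
      using omega_det_pos(2)[OF piece_chart(1)[OF m] xp(2)] bpf_family_sum_pos[OF family_bpf nz] v(2)
      by (intro mult_pos_pos divide_pos_pos) auto
  qed auto
  then have "(\<Sum>m<?n. Re (LINT z:?A m|lborel. density m s s z)) > 0"
    using m nonneg re by (intro sum_pos2[of _ m]) auto
  then show "Re (hilb s s) > 0" unfolding hilb_density by simp
qed

end

end

section \<open>The maximum principle and polarization\<close>

text \<open>The complex linear part of the derivative is the Levi form. The conjugate linear part
  \<open>K\<close>, which contains second derivatives, is left unspecified: only the linear parts
  have to cancel in a difference.\<close>

lemma has_derivative_dlog_complex:
  fixes f :: "'i \<Rightarrow> complex \<Rightarrow> complex"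
  assumes W: "open W" "\<zeta> \<in> W" and f: "\<And>i. i \<in> I \<Longrightarrow> f i holomorphic_on W" and I: "finite I"
    and nz: "\<exists>i\<in>I. f i \<zeta> \<noteq> 0"
  shows "\<exists>K. ((\<lambda>y. (\<Sum>i\<in>I. f i y * cnj (deriv (f i) y)) / (\<Sum>i\<in>I. f i y * cnj (f i y))) has_derivative
    (\<lambda>v. v * levi I (\<lambda>i. f i \<zeta>) (\<lambda>i. deriv (f i) \<zeta>) (\<lambda>i. deriv (f i) \<zeta>) + cnj v * K)) (at \<zeta>)"
proof -
  let ?f' = "\<lambda>i. deriv (f i)" and ?f'' = "\<lambda>i. deriv (deriv (f i))"
  define S where "S = (\<Sum>i\<in>I. f i \<zeta> * cnj (f i \<zeta>))"
  have S: "S \<noteq> 0" unfolding S_def by (rule sum_mult_cnj_nonzero[OF I nz])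
  have d: "(f i has_derivative (\<lambda>v. ?f' i \<zeta> * v)) (at \<zeta>)" "(?f' i has_derivative (\<lambda>v. ?f'' i \<zeta> * v)) (at \<zeta>)"
    if "i \<in> I" for i
    using holomorphic_derivI[OF f[OF that] W] holomorphic_derivI[OF holomorphic_deriv[OF f[OF that] W(1)] W]
    by (auto simp: has_field_derivative_def)
  define A where "A = (\<Sum>i\<in>I. f i \<zeta> * cnj (?f' i \<zeta>))"
  define K where "K = (\<Sum>i\<in>I. f i \<zeta> * cnj (?f'' i \<zeta>)) / S - A * A / S\<^sup>2"
  have cA: "(\<Sum>i\<in>I. ?f' i \<zeta> * cnj (f i \<zeta>)) = cnj A" by (simp add: A_def mult.commute)
  have "((\<lambda>y. (\<Sum>i\<in>I. f i y * cnj (?f' i y)) / (\<Sum>i\<in>I. f i y * cnj (f i y))) has_derivative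
    (\<lambda>v. (\<Sum>i\<in>I. ?f' i \<zeta> * v * cnj (?f' i \<zeta>) + f i \<zeta> * cnj (?f'' i \<zeta> * v)) / S -
      A * (\<Sum>i\<in>I. ?f' i \<zeta> * v * cnj (f i \<zeta>) + f i \<zeta> * cnj (?f' i \<zeta> * v)) / S\<^sup>2)) (at \<zeta>)"
    unfolding S_def A_def by (rule has_derivative_dlog[OF d]) (use S in \<open>simp_all add: S_def\<close>)
  moreover have "(\<Sum>i\<in>I. ?f' i \<zeta> * v * cnj (?f' i \<zeta>) + f i \<zeta> * cnj (?f'' i \<zeta> * v)) =
      v * (\<Sum>i\<in>I. ?f' i \<zeta> * cnj (?f' i \<zeta>)) + cnj v * (\<Sum>i\<in>I. f i \<zeta> * cnj (?f'' i \<zeta>))" for v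
    by (simp add: sum.distrib sum_distrib_left mult_ac)
  moreover have "(\<Sum>i\<in>I. ?f' i \<zeta> * v * cnj (f i \<zeta>) + f i \<zeta> * cnj (?f' i \<zeta> * v)) = v * cnj A + cnj v * A" for v
    by (simp add: A_def sum.distrib sum_distrib_left mult_ac)
  moreover have "(v * x + cnj v * y) / S - A * (v * cnj A + cnj v * A) / S\<^sup>2 =
      v * (x / S - cnj A * A / S\<^sup>2) + cnj v * (y / S - A * A / S\<^sup>2)" for v x y
    by (simp add: add_divide_distrib algebra_simps)
  ultimately show ?thesis
    unfolding levi_def cA A_def[symmetric] S_def[symmetric] by (intro exI[of _ K]) (simp add: K_def)
qed

text \<open>Equality of the Levi forms makes the difference of the two potentials harmonic on \<open>W\<close>, hence
  the real part of a holomorphic function, to which the maximum modulus principle applies.\<close>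

lemma levi_eq_maximum_principle:
  fixes f :: "'i \<Rightarrow> complex \<Rightarrow> complex" and g :: "'j \<Rightarrow> complex \<Rightarrow> complex"
  assumes W: "open W" "convex W" and I: "finite I" "finite J"
    and f: "\<And>i. i \<in> I \<Longrightarrow> f i holomorphic_on W" and g: "\<And>j. j \<in> J \<Longrightarrow> g j holomorphic_on W"
    and nz: "\<And>\<zeta>. \<zeta> \<in> W \<Longrightarrow> \<exists>i\<in>I. f i \<zeta> \<noteq> 0" "\<And>\<zeta>. \<zeta> \<in> W \<Longrightarrow> \<exists>j\<in>J. g j \<zeta> \<noteq> 0"
    and levi: "\<And>\<zeta>. \<zeta> \<in> W \<Longrightarrow> levi I (\<lambda>i. f i \<zeta>) (\<lambda>i. deriv (f i) \<zeta>) (\<lambda>i. deriv (f i) \<zeta>) =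
      levi J (\<lambda>j. g j \<zeta>) (\<lambda>j. deriv (g j) \<zeta>) (\<lambda>j. deriv (g j) \<zeta>)"
  defines "h \<equiv> \<lambda>\<zeta>. ln (\<Sum>i\<in>I. (cmod (f i \<zeta>))\<^sup>2) - ln (\<Sum>j\<in>J. (cmod (g j \<zeta>))\<^sup>2)"
  assumes a: "a \<in> W" and max: "\<And>\<zeta>. \<zeta> \<in> W \<Longrightarrow> h \<zeta> \<le> h a" and z: "z \<in> W"
  shows "h z = h a"
proof -
  define F where "F y = (\<Sum>i\<in>I. f i y * cnj (deriv (f i) y)) / (\<Sum>i\<in>I. f i y * cnj (f i y))" for y
  define G where "G y = (\<Sum>j\<in>J. g j y * cnj (deriv (g j) y)) / (\<Sum>j\<in>J. g j y * cnj (g j y))" for y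
  \<comment> \<open>Equal Levi forms cancel the linear parts, so \<open>F - G\<close> is
    antiholomorphic and its conjugate holomorphic; moreover \<open>2 * Re (p \<zeta> * v)\<close> is
    the derivative of \<open>h\<close>.\<close>
  define p where "p y = cnj (F y - G y)" for y
  have "p holomorphic_on W"
  proof (rule holomorphic_onI)
    fix \<zeta> assume \<zeta>: "\<zeta> \<in> W"
    define L where "L = levi I (\<lambda>i. f i \<zeta>) (\<lambda>i. deriv (f i) \<zeta>) (\<lambda>i. deriv (f i) \<zeta>)"
    obtain K1 where K1: "(F has_derivative (\<lambda>v. v * L + cnj v * K1)) (at \<zeta>)"
      using has_derivative_dlog_complex[OF W(1) \<zeta> f I(1) nz(1)[OF \<zeta>]] unfolding F_def[abs_def] L_def by blast
    obtain K2 where K2: "(G has_derivative (\<lambda>v. v * L + cnj v * K2)) (at \<zeta>)"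
      using has_derivative_dlog_complex[OF W(1) \<zeta> g I(2) nz(2)[OF \<zeta>]] unfolding G_def[abs_def] L_def levi[OF \<zeta>] by blast
    have "(p has_derivative (\<lambda>v. cnj ((v * L + cnj v * K1) - (v * L + cnj v * K2)))) (at \<zeta>)"
      unfolding p_def[abs_def]
      by (rule bounded_linear.has_derivative[OF bounded_linear_cnj has_derivative_diff[OF K1 K2]])
    then have "(p has_field_derivative cnj (K1 - K2)) (at \<zeta>)"
      unfolding has_field_derivative_def by (rule has_derivative_eq_rhs) (simp add: fun_eq_iff algebra_simps)
    then show "p field_differentiable at \<zeta> within W"
      using field_differentiable_at_within field_differentiable_def by blast
  qed
  then obtain P where P: "\<And>\<zeta>. \<zeta> \<in> W \<Longrightarrow> (P has_field_derivative p \<zeta>) (at \<zeta> within W)"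
    using holomorphic_convex_primitive'[OF W(2,1)] by blast
  have dh: "(h has_derivative (\<lambda>v. 2 * Re (p \<zeta> * v))) (at \<zeta> within W)" if \<zeta>: "\<zeta> \<in> W" for \<zeta>
  proof -
    have df: "(f i has_derivative (\<lambda>v. deriv (f i) \<zeta> * v)) (at \<zeta>)" if "i \<in> I" for i
      using holomorphic_derivI[OF f[OF that] W(1) \<zeta>] by (simp add: has_field_derivative_def)
    have dg: "(g j has_derivative (\<lambda>v. deriv (g j) \<zeta> * v)) (at \<zeta>)" if "j \<in> J" for j
      using holomorphic_derivI[OF g[OF that] W(1) \<zeta>] by (simp add: has_field_derivative_def)
    have F: "(\<Sum>i\<in>I. deriv (f i) \<zeta> * v * cnj (f i \<zeta>)) / (\<Sum>i\<in>I. f i \<zeta> * cnj (f i \<zeta>)) = cnj (F \<zeta>) * v" for v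
      by (simp add: F_def sum_distrib_left mult_ac)
    have G: "(\<Sum>j\<in>J. deriv (g j) \<zeta> * v * cnj (g j \<zeta>)) / (\<Sum>j\<in>J. g j \<zeta> * cnj (g j \<zeta>)) = cnj (G \<zeta>) * v" for v
      by (simp add: G_def sum_distrib_left mult_ac)
    have "(h has_derivative (\<lambda>v. 2 * Re (cnj (F \<zeta>) * v) - 2 * Re (cnj (G \<zeta>) * v))) (at \<zeta>)"
      unfolding h_def F[symmetric] G[symmetric]
      by (intro has_derivative_diff has_derivative_ln_sum_norm_square df dg I nz[OF \<zeta>])
    then have "(h has_derivative (\<lambda>v. 2 * Re (p \<zeta> * v))) (at \<zeta>)"
      by (rule has_derivative_eq_rhs) (simp add: p_def fun_eq_iff algebra_simps)
    then show ?thesis by (rule has_derivative_at_withinI)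
  qed
  have "((\<lambda>\<zeta>. h \<zeta> - 2 * Re (P \<zeta>)) has_derivative (\<lambda>v. 0)) (at \<zeta> within W)" if \<zeta>: "\<zeta> \<in> W" for \<zeta>
  proof -
    have "((\<lambda>\<zeta>. 2 * Re (P \<zeta>)) has_derivative (\<lambda>v. 2 * Re (p \<zeta> * v))) (at \<zeta> within W)"
      using P[OF \<zeta>] unfolding has_field_derivative_def
      by (intro has_derivative_mult_right bounded_linear.has_derivative[OF bounded_linear_Re])
    from has_derivative_diff[OF dh[OF \<zeta>] this] show ?thesis by simp
  qed
  from has_derivative_zero_constant[OF W(2) this]
  obtain c where c: "\<And>\<zeta>. \<zeta> \<in> W \<Longrightarrow> h \<zeta> - 2 * Re (P \<zeta>) = c" by blast
  \<comment> \<open>The factor 2 matches \<open>h = 2 * Re P + c\<close>; the modulus is thus an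
    increasing function of \<open>h\<close> and is maximal at \<open>a\<close> as well.\<close>
  have normE: "norm (exp (2 * P \<zeta>)) = exp (h \<zeta> - c)" if "\<zeta> \<in> W" for \<zeta>
    using c[OF that] by (simp add: norm_exp_eq_Re)
  have "P holomorphic_on W"
    unfolding holomorphic_on_def field_differentiable_def using P by blast
  then have "(\<lambda>\<zeta>. exp (2 * P \<zeta>)) holomorphic_on W" by (intro holomorphic_intros)
  then have "(\<lambda>\<zeta>. exp (2 * P \<zeta>)) constant_on W"
    by (rule maximum_modulus_principle[OF _ W(1) convex_connected[OF W(2)] W(1) order_refl a])
      (use normE a max in simp)
  then have "exp (2 * P z) = exp (2 * P a)" using a z unfolding constant_on_def by metis
  with normE[OF a] normE[OF z] show ?thesis by simp
qed

section \<open>Polarization of identities between sums of squares\<close>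

lemma zero_on_reals_imp_zero:
  assumes f: "f holomorphic_on ball 0 r" and r: "r > 0"
    and 0: "\<And>x. \<bar>x\<bar> < r \<Longrightarrow> f (of_real x) = 0" and w: "w \<in> ball 0 r"
  shows "f w = 0"
proof (rule analytic_continuation[OF f, of "of_real ` {-r<..<r}" 0])
  show "(0::complex) islimpt of_real ` {-r<..<r}"
    unfolding islimpt_approachable
  proof (intro allI impI)
    fix e :: real assume "e > 0"
    then obtain d where "0 < d" "d < e" "d < r" using r dense[of 0 "min e r"] by auto
    then show "\<exists>x'\<in>of_real ` {-r<..<r}. x' \<noteq> (0::complex) \<and> dist x' 0 < e"
      by (intro bexI[OF _ imageI[of d]]) auto
  qed
qed (use r w 0 in auto)

text \<open>With \<open>\<zeta> = x + \<i>y\<close> both sides extend to functions of two complex variables \<open>x\<close>, \<open>y\<close>, holomorphic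
  in each; they agree for real \<open>x\<close>, \<open>y\<close>, hence also for \<open>x = \<zeta>/2\<close>, \<open>y = \<zeta>/(2\<i>)\<close>.\<close>

lemma polarization_ball:
  fixes f :: "'i \<Rightarrow> complex \<Rightarrow> complex" and g :: "'j \<Rightarrow> complex \<Rightarrow> complex"
  assumes f: "\<And>i. i \<in> I \<Longrightarrow> f i holomorphic_on ball 0 r" and g: "\<And>j. j \<in> J \<Longrightarrow> g j holomorphic_on ball 0 r"
    and eq: "\<And>\<zeta>. \<zeta> \<in> ball 0 r \<Longrightarrow> (\<Sum>i\<in>I. f i \<zeta> * cnj (f i \<zeta>)) = (\<Sum>j\<in>J. g j \<zeta> * cnj (g j \<zeta>))"
    and r: "r > 0" and \<zeta>: "\<zeta> \<in> ball 0 r"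
  shows "(\<Sum>i\<in>I. f i \<zeta> * cnj (f i 0)) = (\<Sum>j\<in>J. g j \<zeta> * cnj (g j 0))"
proof -
  \<comment> \<open>For real \<open>x\<close>, \<open>y\<close> the argument
    \<open>x - \<i> * y\<close> is the conjugate of \<open>x + \<i> * y\<close>, so \<open>Q\<close>
    is the difference of the two sums of squares. Conjugation on both sides of \<open>f i\<close>
    keeps the second factor holomorphic.\<close>
  define Q where "Q x y = (\<Sum>i\<in>I. f i (x + \<i> * y) * (cnj \<circ> f i \<circ> cnj) (x - \<i> * y)) -
     (\<Sum>j\<in>J. g j (x + \<i> * y) * (cnj \<circ> g j \<circ> cnj) (x - \<i> * y))" for x y
  \<comment> \<open>Half the radius keeps both \<open>x + \<i> * y\<close> and
    \<open>x - \<i> * y\<close> in the ball of radius \<open>r\<close>, and still admits the point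
    at which \<open>Q\<close> is finally evaluated.\<close>
  let ?B = "ball (0::complex) (r / 2)"
  have B: "x + \<i> * y \<in> ball 0 r" "x - \<i> * y \<in> ball 0 r" if "x \<in> ?B" "y \<in> ?B" for x y :: complex
    using that norm_triangle_ineq[of x "\<i> * y"] norm_triangle_ineq4[of x "\<i> * y"] by (auto simp: norm_mult)
  have cnj_ball: "cnj ` ball 0 r = ball 0 r" unfolding image_cnj_conv_vimage_cnj by auto
  have f': "(cnj \<circ> f i \<circ> cnj) holomorphic_on ball 0 r" if "i \<in> I" for i
    using f[OF that] by (intro holomorphic_on_compose_cnj_cnj) (simp_all add: cnj_ball)
  have g': "(cnj \<circ> g j \<circ> cnj) holomorphic_on ball 0 r" if "j \<in> J" for j
    using g[OF that] by (intro holomorphic_on_compose_cnj_cnj) (simp_all add: cnj_ball)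
  have comp: "(\<lambda>x. u (l x)) holomorphic_on ?B" if "u holomorphic_on ball 0 r" "l holomorphic_on ?B" "l ` ?B \<subseteq> ball 0 r" for u l
    using holomorphic_on_compose_gen[OF that(2,1,3)] by (simp add: comp_def)
  have holx: "(\<lambda>x. Q x y) holomorphic_on ?B" if y: "y \<in> ?B" for y
    unfolding Q_def
    by (intro holomorphic_intros comp[OF f] comp[OF g] comp[OF f'] comp[OF g']) (use B y in auto)
  have holy: "(\<lambda>y. Q x y) holomorphic_on ?B" if x: "x \<in> ?B" for x
    unfolding Q_def
    by (intro holomorphic_intros comp[OF f] comp[OF g] comp[OF f'] comp[OF g']) (use B x in auto)
  have real: "Q (of_real x) (of_real y) = 0" if "\<bar>x\<bar> < r / 2" "\<bar>y\<bar> < r / 2" for x y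
  proof -
    have "of_real x + \<i> * of_real y \<in> ball 0 r" by (rule B) (use that in auto)
    from eq[OF this] show ?thesis by (simp add: Q_def)
  qed
  have Qx: "Q x (of_real y) = 0" if "\<bar>y\<bar> < r / 2" "x \<in> ?B" for x y
    by (rule zero_on_reals_imp_zero[OF holx]) (use real that r in auto)
  have Q: "Q x y = 0" if "x \<in> ?B" "y \<in> ?B" for x y
    by (rule zero_on_reals_imp_zero[OF holy]) (use Qx that r in auto)
  have "Q (\<zeta> / 2) (\<zeta> / (2 * \<i>)) = 0" by (rule Q) (use \<zeta> in \<open>auto simp: norm_divide norm_mult\<close>)
  moreover have "\<zeta> / 2 + \<i> * (\<zeta> / (2 * \<i>)) = \<zeta>" "\<zeta> / 2 - \<i> * (\<zeta> / (2 * \<i>)) = 0"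
    by (simp_all add: field_simps)
  ultimately show ?thesis by (simp add: Q_def)
qed

text \<open>With the second argument frozen at 0 both sides are holomorphic in \<zeta>, so the
  identity spreads from a small ball to all of \<open>W\<close>.\<close>

lemma polarization:
  fixes f :: "'i \<Rightarrow> complex \<Rightarrow> complex" and g :: "'j \<Rightarrow> complex \<Rightarrow> complex"
  assumes W: "open W" "connected W" "0 \<in> W"
    and f: "\<And>i. i \<in> I \<Longrightarrow> f i holomorphic_on W" and g: "\<And>j. j \<in> J \<Longrightarrow> g j holomorphic_on W"
    and eq: "\<And>\<zeta>. \<zeta> \<in> W \<Longrightarrow> (\<Sum>i\<in>I. f i \<zeta> * cnj (f i \<zeta>)) = (\<Sum>j\<in>J. g j \<zeta> * cnj (g j \<zeta>))"
    and \<zeta>: "\<zeta> \<in> W"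
  shows "(\<Sum>i\<in>I. f i \<zeta> * cnj (f i 0)) = (\<Sum>j\<in>J. g j \<zeta> * cnj (g j 0))"
proof -
  obtain r where r: "r > 0" "ball 0 r \<subseteq> W" using W openE by blast
  show ?thesis
  proof (rule analytic_continuation_open[of "ball 0 r" W "\<lambda>\<zeta>. \<Sum>i\<in>I. f i \<zeta> * cnj (f i 0)"
        "\<lambda>\<zeta>. \<Sum>j\<in>J. g j \<zeta> * cnj (g j 0)"])
    show "(\<lambda>\<zeta>. \<Sum>i\<in>I. f i \<zeta> * cnj (f i 0)) holomorphic_on W" by (intro holomorphic_intros f)
    show "(\<lambda>\<zeta>. \<Sum>j\<in>J. g j \<zeta> * cnj (g j 0)) holomorphic_on W" by (intro holomorphic_intros g)
    fix z :: complex assume z: "z \<in> ball 0 r"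
    show "(\<Sum>i\<in>I. f i z * cnj (f i 0)) = (\<Sum>j\<in>J. g j z * cnj (g j 0))"
    proof (rule polarization_ball[OF _ _ _ r(1) z])
      show "f i holomorphic_on ball 0 r" if "i \<in> I" for i by (rule holomorphic_on_subset[OF f[OF that] r(2)])
      show "g j holomorphic_on ball 0 r" if "j \<in> J" for j by (rule holomorphic_on_subset[OF g[OF that] r(2)])
      show "(\<Sum>i\<in>I. f i w * cnj (f i w)) = (\<Sum>j\<in>J. g j w * cnj (g j w))" if "w \<in> ball 0 r" for w
        using that r(2) by (intro eq) blast
    qed
  qed (use W r \<zeta> in auto)
qed

lemma line_preimage_ball:
  fixes a v p :: "complex^'n"
  shows "open {\<zeta>. a + \<zeta> *s v \<in> ball p e}" "convex {\<zeta>. a + \<zeta> *s v \<in> ball p e}"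
proof -
  have eq: "{\<zeta>. a + \<zeta> *s v \<in> ball p e} = (\<lambda>\<zeta>. \<zeta> *s v) -` ball (p - a) e"
    by (auto simp: dist_norm algebra_simps)
  show "open {\<zeta>. a + \<zeta> *s v \<in> ball p e}" unfolding eq
    by (rule open_vimage[OF open_ball]) (rule linear_continuous_on[OF bounded_linear_scale_left])
  show "convex {\<zeta>. a + \<zeta> *s v \<in> ball p e}" unfolding eq
    by (rule convex_linear_vimage[OF bounded_linear.linear[OF bounded_linear_scale_left] convex_ball])
qed

section \<open>Continuation along complex lines in coordinate balls\<close>

context polarized_manifold
begin

text \<open>Any two points \<open>x\<close>, \<open>y\<close> of a coordinate ball over which the bundle is trivial lie on a complex
  line in that ball; \<open>W\<close> is the parameter set of the line, with \<open>x\<close> at \<open>0\<close> and \<open>y\<close> at \<open>1\<close>.\<close>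

lemma coordinate_line:
  obtains c t N where "c \<in> atlas M" "t \<in> trivs M" "open N" "p \<in> N" "N \<subseteq> fst t \<inter> fst c"
    "\<And>x y. x \<in> N \<Longrightarrow> y \<in> N \<Longrightarrow> \<exists>W. open W \<and> convex W \<and> 0 \<in> W \<and> 1 \<in> W \<and>
      (\<forall>\<zeta>\<in>W. snd c x + \<zeta> *s (snd c y - snd c x) \<in> snd c ` N)"
proof -
  obtain c where c: "c \<in> atlas M" "p \<in> fst c" using atlas_cover by blast
  obtain t where t: "t \<in> trivs M" "p \<in> fst t" using triv_cover by blast
  let ?S = "snd c ` (fst t \<inter> fst c)"
  have S: "open ?S" by (rule chart_image_open[OF c(1) triv_open[OF t(1)]])
  have "snd c p \<in> ?S" using c t by blast
  then obtain e where e: "e > 0" "ball (snd c p) e \<subseteq> ?S" using S openE by blast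
  define N where "N = fst t \<inter> fst c \<inter> snd c -` ball (snd c p) e"
  have oN: "open N" unfolding N_def
    by (intro continuous_open_preimage continuous_on_subset[OF homeomorphism_cont1[OF chart_homeomorphism[OF c(1)]]]
        open_Int triv_open[OF t(1)] chart_open(1)[OF c(1)]) auto
  have img: "ball (snd c p) e \<subseteq> snd c ` N"
  proof
    fix z assume z: "z \<in> ball (snd c p) e"
    then obtain x where "x \<in> fst t \<inter> fst c" "z = snd c x" using e(2) by blast
    with z show "z \<in> snd c ` N" unfolding N_def by blast
  qed
  show ?thesis
  proof (rule that[OF c(1) t(1) oN])
    show "p \<in> N" "N \<subseteq> fst t \<inter> fst c" using c t e by (auto simp: N_def)
    fix x y assume xy: "x \<in> N" "y \<in> N"
    let ?W = "{\<zeta>. snd c x + \<zeta> *s (snd c y - snd c x) \<in> ball (snd c p) e}"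
    have "snd c x \<in> ball (snd c p) e" "snd c y \<in> ball (snd c p) e" using xy by (auto simp: N_def)
    then have "0 \<in> ?W" "1 \<in> ?W" by auto
    with line_preimage_ball img
    show "\<exists>W. open W \<and> convex W \<and> 0 \<in> W \<and> 1 \<in> W \<and> (\<forall>\<zeta>\<in>W. snd c x + \<zeta> *s (snd c y - snd c x) \<in> snd c ` N)"
      by (intro exI[of _ ?W]) blast
  qed
qed

lemma manifold_connected: "open Z \<Longrightarrow> closed Z \<Longrightarrow> Z \<noteq> {} \<Longrightarrow> Z = (UNIV :: 'x set)"
  using manifold connected_clopen[of "UNIV :: 'x set"] unfolding compact_complex_manifold_def by auto

lemma section_line_holomorphic:
  assumes s: "s \<in> H0 M k" and c: "c \<in> atlas M" and t: "t \<in> trivs M"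
    and N: "N \<subseteq> fst t \<inter> fst c" and W: "\<And>\<zeta>. \<zeta> \<in> W \<Longrightarrow> a + \<zeta> *s v \<in> snd c ` N"
  shows "(\<lambda>\<zeta>. s (frame M t (chart_inv c (a + \<zeta> *s v)))) holomorphic_on W"
  by (rule holo_fun_on_line_holomorphic[OF H0_local_holo[OF s t c]]) (use N W in blast)

text \<open>\<open>Z\<close> is the largest open set over which \<open>s\<close> vanishes. Near a
  point of its closure, the coordinate line from a point of \<open>Z\<close> to any neighbour
  carries the zeros along by analytic continuation, so \<open>Z\<close> is also closed.\<close>

lemma section_identity:
  assumes s: "s \<in> H0 M k" and U: "open U" "U \<noteq> {}" and 0: "\<And>v. proj M v \<in> U \<Longrightarrow> s v = 0"
  shows "s v = 0"
proof -
  define Z where "Z = \<Union>{U. open U \<and> (\<forall>v. proj M v \<in> U \<longrightarrow> s v = 0)}"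
  have Z0: "s v = 0" if "proj M v \<in> Z" for v using that unfolding Z_def by blast
  have oZ: "open Z" unfolding Z_def by (rule open_Union) blast
  have "p \<in> Z" if p: "p \<in> closure Z" for p
  proof -
    obtain c t N where c: "c \<in> atlas M" and t: "t \<in> trivs M" and N: "open N" "p \<in> N" "N \<subseteq> fst t \<inter> fst c"
      and line: "\<And>x y. x \<in> N \<Longrightarrow> y \<in> N \<Longrightarrow> \<exists>W. open W \<and> convex W \<and> 0 \<in> W \<and> 1 \<in> W \<and>
        (\<forall>\<zeta>\<in>W. snd c x + \<zeta> *s (snd c y - snd c x) \<in> snd c ` N)"
      using coordinate_line[of p] by metis
    obtain x where x: "x \<in> N" "x \<in> Z" using p N unfolding closure_iff_nhds_not_empty by blast
    have "s v = 0" if v: "proj M v \<in> N" for v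
    proof -
      define y where "y = proj M v"
      have y: "y \<in> N" using v by (simp add: y_def)
      obtain W where W: "open W" "convex W" "0 \<in> W" "1 \<in> W"
        "\<And>\<zeta>. \<zeta> \<in> W \<Longrightarrow> snd c x + \<zeta> *s (snd c y - snd c x) \<in> snd c ` N" using line[OF x(1) y] by blast
      let ?l = "\<lambda>\<zeta>. snd c x + \<zeta> *s (snd c y - snd c x)"
      let ?g = "\<lambda>\<zeta>. s (frame M t (chart_inv c (?l \<zeta>)))"
      \<comment> \<open>A neighbourhood of the parameter 0 whose points are mapped into
        \<open>Z\<close>; continuation starts from it.\<close>
      define W0 where "W0 = W \<inter> ?l -` (snd c ` (N \<inter> Z \<inter> fst c))"
      have "open W0" unfolding W0_def
        by (intro open_Int W open_vimage chart_image_open[OF c] N oZ)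
          (intro continuous_intros linear_continuous_on bounded_linear_scale_left)
      moreover have "0 \<in> W0" unfolding W0_def using W x N by auto
      moreover have "?g \<zeta> = 0" if "\<zeta> \<in> W0" for \<zeta>
      proof -
        have m: "?l \<zeta> \<in> snd c ` ((N \<inter> Z) \<inter> fst c)" using that unfolding W0_def by simp
        from chart_image_inv(1)[OF c m] show ?thesis using frame(1)[OF t, of "chart_inv c (?l \<zeta>)"] N by (intro Z0) auto
      qed
      ultimately have "?g 1 = 0"
        by (intro analytic_continuation_open[of W0 W ?g "\<lambda>_. 0" 1])
          (use W section_line_holomorphic[OF s c t N(3) W(5)] in \<open>auto simp: convex_connected W0_def\<close>)
      then have "s (frame M t y) = 0" using chart_inv_left[OF c, of y] y N by (auto simp del: inv_into_f_f)
      then show ?thesis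
        using H0_frame[OF s t, of v] H0_zero[OF s, of v] v N unfolding y_def by (cases "nonzero M v") auto
    qed
    then show "p \<in> Z" using N unfolding Z_def by blast
  qed
  then have "closed Z" using closure_subset_eq by blast
  moreover have "Z \<noteq> {}" using U 0 unfolding Z_def by blast
  ultimately have "Z = UNIV" using manifold_connected oZ by blast
  then show ?thesis using Z0 by simp
qed

text \<open>For fixed \<open>w\<close> both kernels are sections in the variable \<open>v\<close>.
  Polarization on lines starting at the point under \<open>w\<close> makes their difference vanish
  over a neighbourhood, and the identity theorem for sections removes the restriction on
  \<open>v\<close>.\<close>

lemma kernel_polarization:
  fixes s :: "'i \<Rightarrow> 'l \<Rightarrow> complex" and s' :: "'j \<Rightarrow> 'l \<Rightarrow> complex"
  assumes s: "\<And>i. i \<in> I \<Longrightarrow> s i \<in> H0 M k" and s': "\<And>j. j \<in> J \<Longrightarrow> s' j \<in> H0 M k"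
    and eq: "\<And>v. nonzero M v \<Longrightarrow> (\<Sum>i\<in>I. s i v * cnj (s i v)) = (\<Sum>j\<in>J. s' j v * cnj (s' j v))"
  shows "(\<Sum>i\<in>I. s i v * cnj (s i w)) = (\<Sum>j\<in>J. s' j v * cnj (s' j w))"
proof (cases "nonzero M w")
  case False
  then show ?thesis using H0_zero[OF s] H0_zero[OF s'] by simp
next
  case w: True
  define p where "p = proj M w"
  obtain c t N where c: "c \<in> atlas M" and t: "t \<in> trivs M" and N: "open N" "p \<in> N" "N \<subseteq> fst t \<inter> fst c"
    and line: "\<And>x y. x \<in> N \<Longrightarrow> y \<in> N \<Longrightarrow> \<exists>W. open W \<and> convex W \<and> 0 \<in> W \<and> 1 \<in> W \<and>
      (\<forall>\<zeta>\<in>W. snd c x + \<zeta> *s (snd c y - snd c x) \<in> snd c ` N)"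
    using coordinate_line[of p] by metis
  have pt: "p \<in> fst t" using N by blast
  obtain \<alpha> where \<alpha>: "\<And>s. s \<in> H0 M k \<Longrightarrow> s w = \<alpha> * s (frame M t p)"
    using H0_fibre[OF w frame(3)[OF t pt]] frame(1)[OF t pt] unfolding p_def by metis
  define d where "d = (\<lambda>v. \<Sum>i\<in>I. cnj (s i w) * s i v) - (\<lambda>v. \<Sum>j\<in>J. cnj (s' j w) * s' j v)"
  have dH: "d \<in> H0 M k" unfolding d_def
    by (intro sec.subspace_diff[OF H0_subspace] subspace_lincomb[OF H0_subspace] s s')
  have "d u = 0" if u: "proj M u \<in> N" for u
  proof (cases "nonzero M u")
    case nz: True
    define y where "y = proj M u"
    have y: "y \<in> N" "y \<in> fst t" using u N by (auto simp: y_def)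
    obtain \<beta> where \<beta>: "\<And>s. s \<in> H0 M k \<Longrightarrow> s u = \<beta> * s (frame M t y)"
      using H0_fibre[OF nz frame(3)[OF t y(2)]] frame(1)[OF t y(2)] unfolding y_def by metis
    obtain W where W: "open W" "convex W" "0 \<in> W" "1 \<in> W"
      "\<And>\<zeta>. \<zeta> \<in> W \<Longrightarrow> snd c p + \<zeta> *s (snd c y - snd c p) \<in> snd c ` N" using line[OF N(2) y(1)] by blast
    let ?x = "\<lambda>\<zeta>. chart_inv c (snd c p + \<zeta> *s (snd c y - snd c p))"
    have xt: "?x \<zeta> \<in> fst t" if "\<zeta> \<in> W" for \<zeta>
      using W(5)[OF that] chart_image_inv(1)[OF c, of _ "fst t"] N(3) by blast
    have x0: "?x 0 = p" and x1: "?x 1 = y"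
      using chart_inv_left[OF c, of p] chart_inv_left[OF c, of y] N y by (auto simp del: inv_into_f_f)
    have "(\<Sum>i\<in>I. s i (frame M t (?x 1)) * cnj (s i (frame M t (?x 0)))) =
        (\<Sum>j\<in>J. s' j (frame M t (?x 1)) * cnj (s' j (frame M t (?x 0))))"
    proof (rule polarization[OF W(1) convex_connected[OF W(2)] W(3), where f = "\<lambda>i \<zeta>. s i (frame M t (?x \<zeta>))"
            and g = "\<lambda>j \<zeta>. s' j (frame M t (?x \<zeta>))"])
      show "(\<lambda>\<zeta>. s i (frame M t (?x \<zeta>))) holomorphic_on W" if "i \<in> I" for i
        by (rule section_line_holomorphic[OF s[OF that] c t N(3) W(5)])
      show "(\<lambda>\<zeta>. s' j (frame M t (?x \<zeta>))) holomorphic_on W" if "j \<in> J" for j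
        by (rule section_line_holomorphic[OF s'[OF that] c t N(3) W(5)])
    qed (rule eq[OF frame(3)[OF t xt]] W(4); assumption)+
    then have *: "(\<Sum>i\<in>I. s i (frame M t y) * cnj (s i (frame M t p))) =
        (\<Sum>j\<in>J. s' j (frame M t y) * cnj (s' j (frame M t p)))" unfolding x0 x1 .
    have "(\<Sum>i\<in>I. cnj (s i w) * s i u) = \<beta> * cnj \<alpha> * (\<Sum>i\<in>I. s i (frame M t y) * cnj (s i (frame M t p)))"
      unfolding sum_distrib_left by (rule sum.cong[OF refl]) (simp add: \<alpha>[OF s] \<beta>[OF s])
    moreover have "(\<Sum>j\<in>J. cnj (s' j w) * s' j u) = \<beta> * cnj \<alpha> * (\<Sum>j\<in>J. s' j (frame M t y) * cnj (s' j (frame M t p)))"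
      unfolding sum_distrib_left by (rule sum.cong[OF refl]) (simp add: \<alpha>[OF s'] \<beta>[OF s'])
    ultimately show ?thesis using * by (simp add: d_def)
  qed (use H0_zero[OF dH] in simp)
  then have "d v = 0" using section_identity[OF dH N(1)] N(2) by blast
  then show ?thesis by (simp add: d_def mult.commute)
qed

end

context metrized_manifold
begin

text \<open>Both sums scale alike on a fibre, so the logarithm of their ratio is a continuous
  function \<open>r\<close> on the compact X and attains a maximum. The set where it does is closed,
  and open by the maximum principle on coordinate lines; hence it is everything, and the constant is
  the exponential of the maximum.\<close>

lemma omega_eq_imp_sum_eq:
  fixes s :: "'i \<Rightarrow> 'l \<Rightarrow> complex" and s' :: "'j \<Rightarrow> 'l \<Rightarrow> complex"
  assumes s: "bpf_family I s" and s': "bpf_family J s'"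
    and eq: "form_eq M (omega M k h0 (fs_potential M k h0 I s)) (omega M k h0 (fs_potential M k h0 J s'))"
  shows "\<exists>a>0. \<forall>v. nonzero M v \<longrightarrow> (\<Sum>i\<in>I. (cmod (s i v))\<^sup>2) = a * (\<Sum>j\<in>J. (cmod (s' j v))\<^sup>2)"
proof -
  define R where "R v = ln (\<Sum>i\<in>I. (cmod (s i v))\<^sup>2) - ln (\<Sum>j\<in>J. (cmod (s' j v))\<^sup>2)" for v
  define r where "r x = R (frame M (triv_at M x) x)" for x
  have Rr: "R v = r (proj M v)" if v: "nonzero M v" for v
  proof -
    let ?w = "frame M (triv_at M (proj M v)) (proj M v)"
    have w: "nonzero M ?w" "proj M ?w = proj M v" using frame[OF triv_at] by blast+
    obtain \<alpha> where \<alpha>: "\<alpha> \<noteq> 0" "\<And>s. s \<in> H0 M k \<Longrightarrow> s v = \<alpha> * s ?w"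
      using H0_fibre[OF v w(1)] w(2) by metis
    have "(\<Sum>i\<in>I. (cmod (s i v))\<^sup>2) = (cmod \<alpha>)\<^sup>2 * (\<Sum>i\<in>I. (cmod (s i ?w))\<^sup>2)"
      unfolding sum_distrib_left
      by (rule sum.cong[OF refl]) (simp add: \<alpha>(2)[OF bpf_familyD(2)[OF s]] norm_mult power_mult_distrib)
    moreover have "(\<Sum>j\<in>J. (cmod (s' j v))\<^sup>2) = (cmod \<alpha>)\<^sup>2 * (\<Sum>j\<in>J. (cmod (s' j ?w))\<^sup>2)"
      unfolding sum_distrib_left
      by (rule sum.cong[OF refl]) (simp add: \<alpha>(2)[OF bpf_familyD(2)[OF s']] norm_mult power_mult_distrib)
    ultimately show ?thesis
      using \<alpha>(1) bpf_family_sum_pos[OF s w(1)] bpf_family_sum_pos[OF s' w(1)]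
      by (simp add: R_def r_def ln_mult)
  qed
  have rt: "R (frame M t x) = r x" if "t \<in> trivs M" "x \<in> fst t" for t x
    using Rr[OF frame(3)[OF that]] frame(1)[OF that] by simp
  have cont: "continuous_on UNIV r"
  proof (rule continuous_on_locally)
    fix x
    obtain t where t: "t \<in> trivs M" "x \<in> fst t" using triv_cover by blast
    have "continuous_on (fst t) (\<lambda>x. R (frame M t x))"
      unfolding R_def
      using bpf_family_sum_pos[OF s frame(3)[OF t(1)]] bpf_family_sum_pos[OF s' frame(3)[OF t(1)]]
      by (intro continuous_intros section_continuous_on_frame bpf_familyD(2)[OF s] bpf_familyD(2)[OF s'] t(1)) fastforce+
    then have "continuous_on (fst t) r" by (rule continuous_on_eq) (rule rt[OF t(1)])
    then show "\<exists>S. open S \<and> x \<in> S \<and> continuous_on S r" using t triv_open by blast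
  qed
  obtain x0 where x0: "\<And>x. r x \<le> r x0"
    using continuous_attains_sup[OF _ _ cont] manifold unfolding compact_complex_manifold_def by auto
  define Z where "Z = {x. r x = r x0}"
  have "closed Z" unfolding Z_def
    using continuous_closed_vimage[of "{r x0}" r] cont by (auto simp: vimage_def continuous_on_eq_continuous_at)
  moreover have "open Z"
  proof (subst open_subopen, intro ballI)
    fix x assume x: "x \<in> Z"
    obtain c t N where c: "c \<in> atlas M" and t: "t \<in> trivs M" and N: "open N" "x \<in> N" "N \<subseteq> fst t \<inter> fst c"
      and line: "\<And>x y. x \<in> N \<Longrightarrow> y \<in> N \<Longrightarrow> \<exists>W. open W \<and> convex W \<and> 0 \<in> W \<and> 1 \<in> W \<and>
        (\<forall>\<zeta>\<in>W. snd c x + \<zeta> *s (snd c y - snd c x) \<in> snd c ` N)"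
      using coordinate_line[of x] by metis
    have "y \<in> Z" if y: "y \<in> N" for y
    proof -
      obtain W where W: "open W" "convex W" "0 \<in> W" "1 \<in> W"
        "\<And>\<zeta>. \<zeta> \<in> W \<Longrightarrow> snd c x + \<zeta> *s (snd c y - snd c x) \<in> snd c ` N" using line[OF N(2) y] by blast
      define \<xi> where "\<xi> = snd c y - snd c x"
      let ?l = "\<lambda>\<zeta>. snd c x + \<zeta> *s \<xi>"
      let ?x = "\<lambda>\<zeta>. chart_inv c (?l \<zeta>)"
      have lS: "?l \<zeta> \<in> snd c ` (fst t \<inter> fst c)" if "\<zeta> \<in> W" for \<zeta>
        using W(5)[OF that] N(3) unfolding \<xi>_def by blast
      have xt: "?x \<zeta> \<in> fst t" "?x \<zeta> \<in> fst c" "snd c (?x \<zeta>) = ?l \<zeta>" if "\<zeta> \<in> W" for \<zeta>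
        using chart_image_inv[OF c lS[OF that]] lS[OF that] by (auto intro!: f_inv_into_f)
      have x0': "?x 0 = x" and x1: "?x 1 = y"
        using chart_inv_left[OF c, of x] chart_inv_left[OF c, of y] N y by (auto simp: \<xi>_def simp del: inv_into_f_f)
      have hol: "(\<lambda>\<zeta>. u (frame M t (?x \<zeta>))) holomorphic_on W" if "u \<in> H0 M k" for u
        by (rule section_line_holomorphic[OF that c t N(3)]) (use W(5) in \<open>simp add: \<xi>_def\<close>)
      have der: "deriv (\<lambda>\<zeta>. u (frame M t (?x \<zeta>))) \<zeta> =
          frechet_derivative (\<lambda>z. u (frame M t (chart_inv c z))) (at (?l \<zeta>)) \<xi>" if "u \<in> H0 M k" "\<zeta> \<in> W" for u \<zeta>
        by (rule DERIV_imp_deriv[OF holo_fun_on_line[OF H0_local_holo[OF that(1) t c] lS[OF that(2)]]])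
      \<comment> \<open>The Levi form along the line is the form evaluated on its direction, so
        equality of forms yields the hypothesis of the maximum principle. It is stated for any
        family because the two families have different index types.\<close>
      have quad: "levi I (\<lambda>i. s i (frame M t (?x \<zeta>))) (\<lambda>i. deriv (\<lambda>\<zeta>. s i (frame M t (?x \<zeta>))) \<zeta>)
          (\<lambda>i. deriv (\<lambda>\<zeta>. s i (frame M t (?x \<zeta>))) \<zeta>) =
          (\<Sum>j\<in>UNIV. \<Sum>l\<in>UNIV. omega M k h0 (fs_potential M k h0 I s) c (?x \<zeta>) $ j $ l * \<xi> $ j * cnj (\<xi> $ l))"
        if s: "bpf_family I s" and \<zeta>: "\<zeta> \<in> W" for I :: "'m set" and s \<zeta>
        unfolding omega_fs_quadratic[OF s c xt(2)[OF \<zeta>] t xt(1)[OF \<zeta>]] xt(3)[OF \<zeta>]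
        by (rule levi_cong) (simp_all add: der[OF bpf_familyD(2)[OF s] \<zeta>])
      have "R (frame M t (?x 1)) = R (frame M t (?x 0))"
        unfolding R_def
      proof (rule levi_eq_maximum_principle[OF W(1,2) bpf_familyD(1)[OF s] bpf_familyD(1)[OF s'], where a = 0 and z = 1
            and f = "\<lambda>i \<zeta>. s i (frame M t (?x \<zeta>))" and g = "\<lambda>j \<zeta>. s' j (frame M t (?x \<zeta>))"])
        show "(\<lambda>\<zeta>. s i (frame M t (?x \<zeta>))) holomorphic_on W" if "i \<in> I" for i by (rule hol[OF bpf_familyD(2)[OF s that]])
        show "(\<lambda>\<zeta>. s' j (frame M t (?x \<zeta>))) holomorphic_on W" if "j \<in> J" for j by (rule hol[OF bpf_familyD(2)[OF s' that]])
        fix \<zeta> assume \<zeta>: "\<zeta> \<in> W"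
        show "\<exists>i\<in>I. s i (frame M t (?x \<zeta>)) \<noteq> 0" "\<exists>j\<in>J. s' j (frame M t (?x \<zeta>)) \<noteq> 0"
          using bpf_familyD(3)[OF s frame(3)[OF t xt(1)[OF \<zeta>]]] bpf_familyD(3)[OF s' frame(3)[OF t xt(1)[OF \<zeta>]]] .
        show "levi I (\<lambda>i. s i (frame M t (?x \<zeta>))) (\<lambda>i. deriv (\<lambda>\<zeta>. s i (frame M t (?x \<zeta>))) \<zeta>)
            (\<lambda>i. deriv (\<lambda>\<zeta>. s i (frame M t (?x \<zeta>))) \<zeta>) =
          levi J (\<lambda>j. s' j (frame M t (?x \<zeta>))) (\<lambda>j. deriv (\<lambda>\<zeta>. s' j (frame M t (?x \<zeta>))) \<zeta>)
            (\<lambda>j. deriv (\<lambda>\<zeta>. s' j (frame M t (?x \<zeta>))) \<zeta>)"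
          unfolding quad[OF s \<zeta>] quad[OF s' \<zeta>]
          using eq c xt(2)[OF \<zeta>] unfolding form_eq_def by simp
        have "R (frame M t (?x \<zeta>)) \<le> R (frame M t (?x 0))"
          unfolding rt[OF t xt(1)[OF \<zeta>]] rt[OF t xt(1)[OF W(3)]] using x0 x unfolding x0' Z_def by simp
        then show "ln (\<Sum>i\<in>I. (cmod (s i (frame M t (?x \<zeta>))))\<^sup>2) - ln (\<Sum>j\<in>J. (cmod (s' j (frame M t (?x \<zeta>))))\<^sup>2) \<le>
          ln (\<Sum>i\<in>I. (cmod (s i (frame M t (?x 0))))\<^sup>2) - ln (\<Sum>j\<in>J. (cmod (s' j (frame M t (?x 0))))\<^sup>2)"
          unfolding R_def .
      qed (use W in auto)
      moreover have "x \<in> fst t" "y \<in> fst t" using y N by auto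
      ultimately show "y \<in> Z" unfolding x0' x1 using rt[OF t, of x] rt[OF t, of y] x by (simp add: Z_def)
    qed
    then show "\<exists>T. open T \<and> x \<in> T \<and> T \<subseteq> Z" using N by blast
  qed
  moreover have "x0 \<in> Z" by (simp add: Z_def)
  ultimately have Z: "Z = UNIV" using manifold_connected by blast
  show ?thesis
  proof (intro exI[of _ "exp (r x0)"] conjI allI impI)
    fix v assume v: "nonzero M v"
    have "R v = r x0" using Rr[OF v] Z unfolding Z_def by auto
    then have "ln (\<Sum>i\<in>I. (cmod (s i v))\<^sup>2) = r x0 + ln (\<Sum>j\<in>J. (cmod (s' j v))\<^sup>2)" by (simp add: R_def)
    from arg_cong[OF this, of exp] show "(\<Sum>i\<in>I. (cmod (s i v))\<^sup>2) = exp (r x0) * (\<Sum>j\<in>J. (cmod (s' j v))\<^sup>2)"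
      using bpf_family_sum_pos[OF s v] bpf_family_sum_pos[OF s' v] by (simp add: exp_add)
  qed simp
qed

end

section \<open>Balanced metrics\<close>

lemma form_eq_sym: "form_eq M \<omega> \<omega>' \<Longrightarrow> form_eq M \<omega>' \<omega>"
  and form_eq_trans: "form_eq M \<omega> \<omega>' \<Longrightarrow> form_eq M \<omega>' \<omega>'' \<Longrightarrow> form_eq M \<omega> \<omega>''"
  unfolding form_eq_def by simp_all

context polarized_manifold
begin

text \<open>Covers the action of the torus on a weight basis, where \<open>c i\<close> is the value
  of a character.\<close>

lemma basis_family_scale:
  assumes s: "basis_family I s" and c: "\<And>i. i \<in> I \<Longrightarrow> c i \<noteq> 0"
  shows "basis_family I (\<lambda>i v. c i * s i v)"
proof -
  let ?t = "\<lambda>i v. c i * s i v"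
  have I: "finite I" by (rule basis_familyD(1)[OF s])
  have ind: "a i = 0" if a: "\<And>v. (\<Sum>i\<in>I. a i * ?t i v) = 0" and i: "i \<in> I" for a i
  proof -
    have "(\<Sum>i\<in>I. (a i * c i) * s i v) = 0" for v using a[of v] by (simp only: mult.assoc)
    from independent_family_zero[OF basis_familyD(2)[OF s] _ I this i] basis_familyD(3)[OF s]
    show ?thesis using c[OF i] unfolding is_basis_def by simp
  qed
  have "sec.span (?t ` I) = H0 M k"
  proof (rule subset_antisym)
    show "sec.span (?t ` I) \<subseteq> H0 M k"
      by (rule sec.span_minimal[OF _ H0_subspace]) (auto intro!: sec.subspace_scale[OF H0_subspace] basis_familyD(5)[OF s])
    have "s ` I \<subseteq> sec.span (?t ` I)"
    proof
      fix x assume "x \<in> s ` I"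
      then obtain i where i: "i \<in> I" "x = s i" by blast
      have "(\<lambda>v. inverse (c i) * ?t i v) \<in> sec.span (?t ` I)"
        by (intro sec.span_scale sec.span_base imageI i)
      then show "x \<in> sec.span (?t ` I)" using c[OF i(1)] i(2) by (simp add: mult.assoc[symmetric])
    qed
    from sec.span_minimal[OF this sec.subspace_span] show "H0 M k \<subseteq> sec.span (?t ` I)"
      unfolding basis_familyD(4)[OF s] .
  qed
  moreover have "inj_on ?t I" "sec.independent (?t ` I)"
    by (rule independent_familyI[OF I], rule ind, assumption+)+
  ultimately show ?thesis unfolding basis_family_def is_basis_def using I by blast
qed

lemma basis_family_nonzero: "basis_family I s \<Longrightarrow> i \<in> I \<Longrightarrow> s i \<noteq> 0"
  using sec.dependent_zero[of "s ` I"] unfolding basis_family_def is_basis_def by force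

lemma basis_family_orthonormal: "orthonormal_basis (H0 M k) H B \<Longrightarrow> basis_family B (\<lambda>s. s)"
  unfolding orthonormal_basis_def basis_family_def is_basis_def by simp

end

context metrized_manifold
begin

text \<open>The constant is absorbed into the sections as the factor \<open>sqrt a\<close>, which
  makes the potentials literally equal; the constant factor then has zero derivative in
  \<open>levi_multiple\<close>.\<close>

lemma sum_eq_imp_omega_eq:
  fixes s :: "'i \<Rightarrow> 'l \<Rightarrow> complex" and s' :: "'j \<Rightarrow> 'l \<Rightarrow> complex"
  assumes s: "bpf_family I s" and s': "bpf_family J s'" and a: "a > 0"
    and eq: "\<And>v. nonzero M v \<Longrightarrow> (\<Sum>i\<in>I. (cmod (s i v))\<^sup>2) = a * (\<Sum>j\<in>J. (cmod (s' j v))\<^sup>2)"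
  shows "form_eq M (omega M k h0 (fs_potential M k h0 I s)) (omega M k h0 (fs_potential M k h0 J s'))"
proof -
  define g where "g = complex_of_real (sqrt a)"
  have g: "g \<noteq> 0" "(cmod g)\<^sup>2 = a" using a by (auto simp: g_def)
  let ?t = "\<lambda>j v. g * s' j v"
  have t: "bpf_family J ?t"
    using s' g(1) sec.subspace_scale[OF H0_subspace, of _ g] unfolding bpf_family_def by simp
  have "fs_potential M k h0 I s x = fs_potential M k h0 J ?t x" for x
  proof -
    obtain v where v: "nonzero M v" "proj M v = x" using nonzero_over by blast
    show ?thesis
      using fs_potential_eq[OF s v(1)] fs_potential_eq[OF t v(1)] eq[OF v(1)]
      by (simp add: v(2) norm_mult power_mult_distrib g(2) sum_distrib_left)
  qed
  then have pot: "fs_potential M k h0 I s = fs_potential M k h0 J ?t" by (rule ext)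
  show ?thesis unfolding form_eq_def pot
  proof (intro ballI)
    fix c x assume c: "c \<in> atlas M" "x \<in> fst c"
    obtain u where u: "u \<in> trivs M" "x \<in> fst u" using triv_cover by blast
    let ?f = "\<lambda>j z. s' j (frame M u (chart_inv c z))"
    have z: "snd c x \<in> snd c ` (fst u \<inter> fst c)" using c u by auto
    have D: "frechet_derivative (\<lambda>z. g * ?f j z) (at (snd c x)) v = g * frechet_derivative (?f j) (at (snd c x)) v + 0 * ?f j (snd c x)"
      if j: "j \<in> J" for j v
    proof -
      have "((\<lambda>z. g * ?f j z) has_derivative (\<lambda>v. g * frechet_derivative (?f j) (at (snd c x)) v)) (at (snd c x))"
        by (intro has_derivative_mult_right
            holo_fun_on_has_derivative[OF H0_local_holo[OF bpf_familyD(2)[OF s' j] u(1) c(1)] z])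
      from frechet_derivative_at[OF this] show ?thesis by (simp add: fun_eq_iff)
    qed
    have "omega M k h0 (fs_potential M k h0 J ?t) c x $ j $ l = omega M k h0 (fs_potential M k h0 J s') c x $ j $ l" for j l
    proof -
      have "levi J (\<lambda>j. g * s' j (frame M u x)) (\<lambda>i. frechet_derivative (\<lambda>z. g * ?f i z) (at (snd c x)) (axis j 1))
          (\<lambda>i. frechet_derivative (\<lambda>z. g * ?f i z) (at (snd c x)) (axis l 1)) =
        levi J (\<lambda>j. g * s' j (frame M u x)) (\<lambda>i. g * frechet_derivative (?f i) (at (snd c x)) (axis j 1) + 0 * s' i (frame M u x))
          (\<lambda>i. g * frechet_derivative (?f i) (at (snd c x)) (axis l 1) + 0 * s' i (frame M u x))"
        by (rule levi_cong) (simp_all add: D)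
      also have "\<dots> = levi J (\<lambda>j. s' j (frame M u x)) (\<lambda>i. frechet_derivative (?f i) (at (snd c x)) (axis j 1))
          (\<lambda>i. frechet_derivative (?f i) (at (snd c x)) (axis l 1))"
        by (rule levi_multiple[OF g(1) sum_mult_cnj_nonzero[OF bpf_familyD(1)[OF s'] bpf_familyD(3)[OF s' frame(3)[OF u]]]])
      finally show ?thesis unfolding omega_fs[OF t c u] omega_fs[OF s' c u] .
    qed
    then show "omega M k h0 (fs_potential M k h0 J ?t) c x = omega M k h0 (fs_potential M k h0 J s') c x"
      by (simp add: vec_eq_iff)
  qed
qed

text \<open>The action of \<open>\<sigma>\<close> enters only through the family \<open>t\<close>, the pull-back of \<open>s\<close> by \<open>\<sigma>\<close>.\<close>

lemma balanced_iff_orthogonal: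
  assumes s: "basis_family I s" and t: "basis_family I t"
    and pull: "form_eq M (pull_back M \<sigma> (omega M k h0 (fs_potential M k h0 I s))) (omega M k h0 (fs_potential M k h0 I t))"
  defines "H \<equiv> Hilb M k h0 (fs_potential M k h0 I s)"
  shows "sigma_balanced M k h0 \<sigma> (fs_potential M k h0 I s) \<longleftrightarrow>
    (\<forall>j\<in>I. \<forall>l\<in>I. trace_free I (\<lambda>a b. H (t a) (t b)) j l = 0)"
proof -
  have pd: "pd_hermitian (H0 M k) H" unfolding H_def by (rule hilb_pd_hermitian[OF s])
  \<comment> \<open>\<open>FS\<close> makes this very choice, so unfolding it produces
    \<open>B\<close>; Gram--Schmidt shows that there is something to choose.\<close>
  define B where "B = (SOME B. orthonormal_basis (H0 M k) H B)"
  have B: "orthonormal_basis (H0 M k) H B" unfolding B_def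
    by (rule someI_ex) (rule orthonormal_basis_exists[OF pd basis_familyD(3)[OF s]])
  have Bf: "basis_family B (\<lambda>s. s)" by (rule basis_family_orthonormal[OF B])
  note Bb = basis_family_bpf[OF Bf] and tb = basis_family_bpf[OF t]
  have "sigma_balanced M k h0 \<sigma> (fs_potential M k h0 I s) \<longleftrightarrow>
      form_eq M (omega M k h0 (fs_potential M k h0 B (\<lambda>s. s))) (omega M k h0 (fs_potential M k h0 I t))"
    unfolding sigma_balanced_def FS_def H_def[symmetric] B_def[symmetric]
    using pull form_eq_sym form_eq_trans by blast
  also have "\<dots> \<longleftrightarrow> (\<forall>j\<in>I. \<forall>l\<in>I. trace_free I (\<lambda>a b. H (t a) (t b)) j l = 0)"
  proof (intro iffI ballI)
    assume "form_eq M (omega M k h0 (fs_potential M k h0 B (\<lambda>s. s))) (omega M k h0 (fs_potential M k h0 I t))"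
    from omega_eq_imp_sum_eq[OF Bb tb this] obtain a where a: "a > 0"
      "\<And>v. nonzero M v \<Longrightarrow> (\<Sum>b\<in>B. (cmod (b v))\<^sup>2) = a * (\<Sum>i\<in>I. (cmod (t i v))\<^sup>2)" by blast
    \<comment> \<open>\<open>kernel_polarization\<close> compares plain sums, so the constant is
      moved into the family.\<close>
    define g where "g = complex_of_real (sqrt a)"
    have g: "g * cnj g = of_real a" using a(1) by (simp add: g_def flip: of_real_mult)
    have ker: "(\<Sum>b\<in>B. b v * cnj (b w)) = of_real a * (\<Sum>i\<in>I. t i v * cnj (t i w))" for v w
    proof -
      have *: "(\<Sum>i\<in>I. (g * t i v) * cnj (g * t i w)) = of_real a * (\<Sum>i\<in>I. t i v * cnj (t i w))" for v w
        unfolding g[symmetric] sum_distrib_left by (rule sum.cong[OF refl]) (simp add: mult_ac)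
      have "(\<Sum>b\<in>B. b v * cnj (b w)) = (\<Sum>i\<in>I. (g * t i v) * cnj (g * t i w))"
      proof (rule kernel_polarization[where s = "\<lambda>b. b" and s' = "\<lambda>i v. g * t i v"])
        show "b \<in> H0 M k" if "b \<in> B" for b using basis_familyD(5)[OF Bf that] .
        show "(\<lambda>v. g * t i v) \<in> H0 M k" if "i \<in> I" for i
          by (rule sec.subspace_scale[OF H0_subspace basis_familyD(5)[OF t that]])
        show "(\<Sum>b\<in>B. b v * cnj (b v)) = (\<Sum>i\<in>I. (g * t i v) * cnj (g * t i v))" if "nonzero M v" for v
          unfolding * unfolding sum_mult_cnj a(2)[OF that] by simp
      qed
      then show ?thesis unfolding * .
    qed
    fix j l assume jl: "j \<in> I" "l \<in> I"
    have H: "H (t i) (t i') = (if i = i' then of_real (1 / a) else 0)" if "i \<in> I" "i' \<in> I" for i i'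
      using kernel_eq_imp_orthogonal[OF pd B basis_familyD(1-3)[OF t] ker that] a(1)
      by (auto simp: field_simps split: if_splits)
    \<comment> \<open>\<open>trace_free\<close> divides by the size of the index set; the mean of
      the diagonal is \<open>1 / a\<close> because that size is not 0.\<close>
    have "card I \<noteq> 0" using jl basis_familyD(1)[OF t] by auto
    moreover have "(\<Sum>i\<in>I. H (t i) (t i)) = of_nat (card I) * of_real (1 / a)" by (simp add: H)
    ultimately show "trace_free I (\<lambda>a b. H (t a) (t b)) j l = 0" unfolding trace_free_def by (simp add: H jl)
  next
    assume tf: "\<forall>j\<in>I. \<forall>l\<in>I. trace_free I (\<lambda>a b. H (t a) (t b)) j l = 0"
    \<comment> \<open>An index exists because some member of the family is nonzero at a nonzero
      vector; the sign of the scale is read off from its diagonal entry.\<close>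
    obtain j where j: "j \<in> I" using bpf_familyD(3)[OF tb] nonzero_over by blast
    \<comment> \<open>Vanishing of the trace-free part says that the matrix is the mean of its
      diagonal times the identity.\<close>
    define C where "C = (\<Sum>i\<in>I. H (t i) (t i)) / of_nat (card I)"
    have HC: "H (t i) (t l) = (if i = l then C else 0)" if "i \<in> I" "l \<in> I" for i l
      using bspec[OF bspec[OF tf that(1)] that(2)] unfolding trace_free_def C_def[symmetric] by simp
    define c where "c = Re C"
    have tj: "t j \<in> H0 M k" "t j \<noteq> 0" using basis_familyD(5)[OF t j] basis_family_nonzero[OF t j] .
    have C: "C = of_real c" using pd_real[OF pd tj(1)] HC[OF j j] by (simp add: c_def)
    have c: "c > 0" using pd_pos[OF pd tj] HC[OF j j] by (simp add: c_def)
    have ker: "(\<Sum>b\<in>B. b v * cnj (b w)) = of_real (1 / c) * (\<Sum>i\<in>I. t i v * cnj (t i w))" for v w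
      by (rule orthogonal_imp_kernel_eq[OF pd B basis_familyD(1-3)[OF t] c]) (simp add: HC C)
    show "form_eq M (omega M k h0 (fs_potential M k h0 B (\<lambda>s. s))) (omega M k h0 (fs_potential M k h0 I t))"
    proof (rule sum_eq_imp_omega_eq[OF Bb tb])
      show "1 / c > 0" using c by simp
      show "(\<Sum>b\<in>B. (cmod (b v))\<^sup>2) = 1 / c * (\<Sum>i\<in>I. (cmod (t i v))\<^sup>2)" for v
        using ker[of v v] unfolding sum_mult_cnj of_real_mult[symmetric] of_real_eq_iff .
    qed
  qed
  finally show ?thesis .
qed

end

section \<open>Inverses in the complex torus, and the conclusion\<close>

lemma Aut0_subset_AutXL: "Aut0 M \<subseteq> AutXL M"
  using connected_component_of_subset_topspace[of "subtopology compact_open (AutXL M)" id]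
  unfolding Aut0_def by auto

text \<open>\<open>act\<close> goes through the inverse of \<sigma>, to which
  \<open>sl_representation\<close> applies only once it is known to be in \<open>Aut0 M\<close>. The
  inverse is the image under \<theta> of the inverse parameters.\<close>

lemma complexification_inv:
  assumes Tc: "complexification M T Tc" and \<sigma>: "\<sigma> \<in> Tc"
  shows "inv \<sigma> \<in> Tc"
proof -
  have sub: "Tc \<subseteq> Aut0 M" using Tc unfolding complexification_def by (elim conjE)
  obtain r \<theta> where mult': "\<forall>a\<in>cstar_pow r. \<forall>b\<in>cstar_pow r. \<theta> (cmult r a b) = \<theta> a \<circ> \<theta> b"
    and img: "\<theta> ` cstar_pow r = Tc"
    using Tc unfolding complexification_def by (elim conjE exE) (rule that)
  note mult = bspec[OF bspec[OF mult']]
  have bij: "bij f" if "f \<in> Tc" for f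
    using that sub Aut0_subset_AutXL[of M] unfolding AutXL_def by blast
  obtain a where a: "a \<in> cstar_pow r" "\<sigma> = \<theta> a" using \<sigma> img by blast
  define e where "e = (\<lambda>i\<in>{..<r}. 1 :: complex)"
  define b where "b = (\<lambda>i\<in>{..<r}. inverse (a i))"
  have e: "e \<in> cstar_pow r" by (auto simp: e_def cstar_pow_def)
  have b: "b \<in> cstar_pow r" using a(1) by (auto simp: b_def cstar_pow_def PiE_def Pi_def)
  have "cmult r e e = e" by (auto simp: cmult_def e_def)
  then have ee: "\<theta> e = \<theta> e \<circ> \<theta> e" using mult[OF e e] by simp
  have "bij (\<theta> e)" using bij img e by blast
  then have "\<theta> e = id" using ee by (metis bij_is_inj fun.map_comp id_comp inv_o_cancel)
  moreover have "cmult r a b = e"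
    using a(1) by (auto simp: cmult_def e_def b_def cstar_pow_def PiE_def Pi_def)
  ultimately have "\<sigma> \<circ> \<theta> b = id" using mult[OF a(1) b] a(2) by simp
  then have "inv \<sigma> = \<theta> b"
    using bij[OF \<sigma>] by (metis bij_is_inj comp_assoc comp_id id_comp inv_o_cancel)
  then show ?thesis using img b by blast
qed

theorem proposition3p5:
  fixes M :: "('x::t2_space, 'l, 'n::finite) polarized"
    and k :: nat
    and h0 :: "'l \<Rightarrow> real"
    and \<rho> :: "('x \<Rightarrow> 'x) \<Rightarrow> ('l \<Rightarrow> complex) \<Rightarrow> 'l \<Rightarrow> complex"
    and T Tc :: "('x \<Rightarrow> 'x) set"
    and \<sigma> :: "'x \<Rightarrow> 'x"
    and s :: "(('x \<Rightarrow> 'x) \<Rightarrow> complex) \<times> nat \<Rightarrow> 'l \<Rightarrow> complex"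
  assumes "compact_complex_manifold M" and "holo_line_bundle M"
    and "k > 0" and "very_ample M k"
    and "maximal_torus (Aut0 M) T" and "complexification M T Tc"
    and "sl_representation M k \<rho>"
    and "hermitian_metric M h0" and "positive_form M (curvature M h0)"
    and "\<forall>f\<in>T. \<exists>F. lifts M F f \<and> h0 \<circ> F = h0"
    and "\<sigma> \<in> Tc"
    and "s \<in> torus_bases M k \<rho> Tc"
  shows "sigma_balanced M k h0 \<sigma> (fs_potential M k h0 (basis_index M k \<rho> Tc) s) \<longleftrightarrow>
         (\<forall>j\<in>basis_index M k \<rho> Tc. \<forall>l\<in>basis_index M k \<rho> Tc.
            moment_map M k h0 \<rho> \<sigma> (basis_index M k \<rho> Tc) s j l = 0)"
proof -
  interpret metrized_manifold M k h0
    using assms by unfold_locales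
  let ?I = "basis_index M k \<rho> Tc"
  define t where "t j = act \<rho> \<sigma> (s j)" for j
  have s: "inj_on s ?I" "is_basis (H0 M k) (s ` ?I)"
    and sw: "\<And>j. j \<in> ?I \<Longrightarrow> s j \<in> weight_space M k \<rho> Tc (fst j)"
    using assms(12) unfolding torus_bases_def by auto
  have "finite ?I" using s finite_imageD unfolding is_basis_def by blast
  with s have sB: "basis_family ?I s" unfolding basis_family_def by blast
  \<comment> \<open>The first component of an index is the weight, a character, whose value at
    \<sigma> is the nonzero scalar by which \<sigma> acts.\<close>
  have t_eq: "t j = (\<lambda>v. fst j \<sigma> * s j v)" if "j \<in> ?I" for j
    using sw[OF that] assms(11) unfolding t_def weight_space_def by blast
  have "fst j \<sigma> \<noteq> 0" if "j \<in> ?I" for j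
    using that assms(11) unfolding basis_index_def weights_def characters_def by auto
  from basis_family_scale[OF sB, of "\<lambda>j. fst j \<sigma>", OF this] have tB: "basis_family ?I t"
    unfolding basis_family_def by (simp add: t_eq cong: inj_on_cong image_cong)
  have "\<sigma> \<in> AutXL M" "inv \<sigma> \<in> Aut0 M"
    using complexification_inv[OF assms(6,11)] assms(6,11) Aut0_subset_AutXL[of M]
    unfolding complexification_def by blast+
  then have bij: "bij \<sigma>" and hol: "holo_self_map M \<sigma>" unfolding AutXL_def by blast+
  \<comment> \<open>\<open>F\<close> lifts the inverse of \<sigma>, so \<open>inv F\<close> covers
    \<sigma> itself and \<open>t j\<close> is \<open>s j\<close> composed with it: the direction
    that \<open>pull_back_omega_fs\<close> requires.\<close>
  obtain F where F: "lifts M F (inv \<sigma>)" "\<And>u. u \<in> H0 M k \<Longrightarrow> act \<rho> \<sigma> u = u \<circ> inv F"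
    using assms(7) \<open>inv \<sigma> \<in> Aut0 M\<close> unfolding sl_representation_def act_def by blast
  have tF: "t j v = s j (inv F v)" if "j \<in> ?I" for j v
    using F(2)[OF basis_familyD(5)[OF sB that]] by (simp add: t_def)
  have "form_eq M (pull_back M \<sigma> (omega M k h0 (fs_potential M k h0 ?I s))) (omega M k h0 (fs_potential M k h0 ?I t))"
  proof (rule pull_back_omega_fs[OF basis_family_bpf[OF sB] basis_family_bpf[OF tB] hol _ tF])
    fix v assume v: "nonzero M v"
    have "F (inv F v) = v" using F(1) unfolding lifts_def by (simp add: bij_is_surj surj_f_inv_f)
    then have "inv \<sigma> (proj M (inv F v)) = proj M v" using F(1) unfolding lifts_def by metis
    then have "proj M (inv F v) = \<sigma> (proj M v)" using bij by (metis bij_is_surj surj_f_inv_f)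
    \<comment> \<open>That \<open>inv F\<close> preserves nonzero vectors is seen through sections:
      some \<open>t j\<close> is nonzero at \<open>v\<close>, so \<open>s j\<close> is nonzero at
      \<open>inv F v\<close>, while sections are 0 on zero vectors.\<close>
    moreover obtain j where "j \<in> ?I" "t j v \<noteq> 0" using bpf_familyD(3)[OF basis_family_bpf[OF tB] v] by blast
    then have "nonzero M (inv F v)"
      using H0_zero[OF basis_familyD(5)[OF sB]] tF by metis
    ultimately show "nonzero M (inv F v) \<and> proj M (inv F v) = \<sigma> (proj M v)" by simp
  qed
  from balanced_iff_orthogonal[OF sB tB this] show ?thesis
    unfolding moment_map_def t_def by simp
qed

end
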